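(* Let $d\ge2$ and $\alpha\in(0,1)$. With the notation of the context, for any $z\in\mathbb{B}\setminus\{0\}$ there is a version of the set of regular conditional probabilities $\{\mu(z,t):t\ge0\}$ such that $$\mu(z,s)\prec\mu(z,t)\qquad\text{for }0\le s\le t .$$
   Context: $\mathbb{B}$ is the regular rooted $d$-ary tree with root $0$; $|x|$ is the distance of $x$ from the root, $\mathbb{B}(n)=\{x:|x|=n\}$; $y\le x$ means $y$ is an ancestor of $x$ or $y=x$. $\{U_x:x\in\mathbb{B}\}$ are i.i.d. exponential random variables with mean $1$, $T(x)=\sum_{y\le x}\alpha^{|y|}U_y$, $T(0,x)=T(x)-T(0)$, and $T_{\mathsf{not}}(n)=\inf\{T(0,x):x\in\mathbb{B}(n)\}$. $\mathsf{First}_n$ is the a.s. unique vertex in $\mathbb{B}(n)$ attaining $\inf\{T(x):x\in\mathbb{B}(n)\}$. For $z\in\mathbb{B}(n)$, $P_z(\cdot)=P(\cdot\mid\mathsf{First}_n=z)$, and $\{\mu(z,t):t\ge0\}$ is a set of regular conditional probabilities on $(-\infty,0]^{\mathbb{B}(n)}$ for $$P_z\bigl((T_{\mathsf{not}}(n)-T(0,x):x\in\mathbb{B}(n))\in\cdot\mid T_{\mathsf{not}}(n)=t\bigr).$$ For probability laws $\mu,\nu$ on $(-\infty,0]^{\mathbb{B}(n)}$ with the coordinatewise partial order, $\mu\prec\nu$ means $\int\psi\,d\mu\le\int\psi\,d\nu$ for every bounded measurable non-decreasing $\psi$. *)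

theory Defs
  imports "HOL-Probability.Probability" "HOL-Library.Sublist"
begin

text \<open>The vertices of the rooted \<open>d\<close>-ary tree are the words over \<open>{..<d}\<close>: the root is \<open>[]\<close>, the
  children of \<open>x\<close> are \<open>x @ [i]\<close> with \<open>i < d\<close>, the distance from the root is \<^const>\<open>length\<close>, and
  ``\<open>y\<close> is an ancestor of \<open>x\<close> or \<open>y = x\<close>'' is \<^const>\<open>prefix\<close>.\<close>

definition tree :: "nat \<Rightarrow> nat list set" where
  "tree d = lists {..<d}"

definition level :: "nat \<Rightarrow> nat \<Rightarrow> nat list set" where
  "level d n = {x \<in> tree d. length x = n}"

definition T :: "real \<Rightarrow> (nat list \<Rightarrow> 'a \<Rightarrow> real) \<Rightarrow> nat list \<Rightarrow> 'a \<Rightarrow> real" where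
  "T \<alpha> U x \<omega> = (\<Sum>y | prefix y x. \<alpha> ^ length y * U y \<omega>)"

definition T0 :: "real \<Rightarrow> (nat list \<Rightarrow> 'a \<Rightarrow> real) \<Rightarrow> nat list \<Rightarrow> 'a \<Rightarrow> real" where
  "T0 \<alpha> U x \<omega> = T \<alpha> U x \<omega> - T \<alpha> U [] \<omega>"

definition T_not :: "nat \<Rightarrow> real \<Rightarrow> (nat list \<Rightarrow> 'a \<Rightarrow> real) \<Rightarrow> nat \<Rightarrow> 'a \<Rightarrow> real" where
  "T_not d \<alpha> U n \<omega> = (INF x \<in> level d n. T0 \<alpha> U x \<omega>)"

text \<open>Unspecified on the null event that the minimiser is not unique.\<close>

definition First :: "nat \<Rightarrow> real \<Rightarrow> (nat list \<Rightarrow> 'a \<Rightarrow> real) \<Rightarrow> nat \<Rightarrow> 'a \<Rightarrow> nat list" where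
  "First d \<alpha> U n \<omega> =
     (THE z. z \<in> level d n \<and> T \<alpha> U z \<omega> = (INF x \<in> level d n. T \<alpha> U x \<omega>))"

text \<open>\<^const>\<open>uniform_measure\<close> \<open>M A\<close> is \<open>B \<mapsto> M (A \<inter> B) / M A\<close>, i.e.\ conditioning on the event \<open>A\<close>.\<close>

definition P_cond :: "'a measure \<Rightarrow> nat \<Rightarrow> real \<Rightarrow> (nat list \<Rightarrow> 'a \<Rightarrow> real) \<Rightarrow> nat list \<Rightarrow> 'a measure" where
  "P_cond M d \<alpha> U z = uniform_measure M {\<omega> \<in> space M. First d \<alpha> U (length z) \<omega> = z}"

definition nonpos_space :: "'i set \<Rightarrow> ('i \<Rightarrow> real) measure" where
  "nonpos_space I = (\<Pi>\<^sub>M i\<in>I. restrict_space borel {..0})"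

definition gap :: "nat \<Rightarrow> real \<Rightarrow> (nat list \<Rightarrow> 'a \<Rightarrow> real) \<Rightarrow> nat \<Rightarrow> 'a \<Rightarrow> nat list \<Rightarrow> real" where
  "gap d \<alpha> U n \<omega> = (\<lambda>x\<in>level d n. T_not d \<alpha> U n \<omega> - T0 \<alpha> U x \<omega>)"

text \<open>\<open>\<kappa>\<close> is a version of the regular conditional probabilities \<open>P (X \<in> \<cdot> | Y = t)\<close>, \<open>t \<ge> 0\<close>, on
  the measurable space \<open>S\<close>: a probability kernel with \<open>\<kappa> (Y) A = P (X \<in> A | \<sigma>(Y))\<close> a.s.\ for every
  measurable \<open>A\<close>. Only \<open>t \<ge> 0\<close> is indexed, so this is meant for \<open>Y\<close> that is a.s.\ nonnegative.\<close>

definition regular_cond_prob ::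
  "'a measure \<Rightarrow> 'b measure \<Rightarrow> ('a \<Rightarrow> 'b) \<Rightarrow> ('a \<Rightarrow> real) \<Rightarrow> (real \<Rightarrow> 'b measure) \<Rightarrow> bool" where
  "regular_cond_prob P S X Y \<kappa> \<longleftrightarrow>
     \<kappa> \<in> restrict_space borel {0..} \<rightarrow>\<^sub>M prob_algebra S \<and>
     (\<forall>A\<in>sets S. AE \<omega> in P.
        real_cond_exp P (vimage_algebra (space P) Y borel) (\<lambda>\<omega>. indicator A (X \<omega>)) \<omega>
          = measure (\<kappa> (Y \<omega>)) A)"

text \<open>Points of \<^term>\<open>space (nonpos_space I)\<close> agree outside \<open>I\<close>, so there the pointwise order on functions,
  which \<^const>\<open>mono_on\<close> uses, is the coordinatewise order over \<open>I\<close>.\<close>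

definition stoch_le :: "'i set \<Rightarrow> ('i \<Rightarrow> real) measure \<Rightarrow> ('i \<Rightarrow> real) measure \<Rightarrow> bool" where
  "stoch_le I \<mu> \<nu> \<longleftrightarrow>
     (\<forall>\<psi> :: ('i \<Rightarrow> real) \<Rightarrow> real.
        \<psi> \<in> borel_measurable (nonpos_space I) \<longrightarrow>
        bounded (\<psi> ` space (nonpos_space I)) \<longrightarrow>
        mono_on (space (nonpos_space I)) \<psi> \<longrightarrow>
        (\<integral>v. \<psi> v \<partial>\<mu>) \<le> (\<integral>v. \<psi> v \<partial>\<nu>))"

end

theory Submission
  imports Defs
begin

text \<open>
  Let \<open>V\<close> be a random vector over a finite index set \<open>I\<close>. It is determined by the position \<open>z\<close> of its
  minimum, the value \<open>w\<close> of its minimum, and the gaps \<open>w - V x \<le> 0\<close>. Say that \<open>V\<close> is well decomposed if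

  \<^item> the position \<open>z\<close> is uniform on \<open>I\<close> and independent of \<open>w\<close>: the law of \<open>(z, w)\<close> is the product of
    the counting measure on \<open>I\<close> and a measure \<open>\<nu>\<close> on \<open>(0, \<infinity>)\<close>, without atoms and charging all intervals;
  \<^item> given \<open>(z, w)\<close>, the gaps have the law of \<open>\<Phi> z w \<omega>\<close>, where \<open>\<omega>\<close> is a family of independent uniform
    variables and \<open>\<Phi>\<close> is nondecreasing in \<open>w\<close> for every fixed \<open>\<omega>\<close>;
  \<^item> the tail \<open>r \<mapsto> \<nu> (r, \<infinity>)\<close> is log-concave.

  For a well decomposed vector the law of \<open>\<Phi> z t \<omega>\<close> is a version of the conditional law of the gaps
  given the position \<open>z\<close> and the value \<open>t\<close> of the minimum, and the pointwise monotonicity of \<open>\<Phi>\<close> in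
  \<open>t\<close> gives the stochastic order. It remains to see that the vector of the \<open>T0 x\<close>, \<open>x\<close> in a level below the root,
  is well decomposed. It arises from single exponential variables (\<open>base_decomposition\<close>) by two
  operations: independent copies put side by side, one for each child of a vertex
  (\<open>join_decomposition\<close>), and adding an independent exponential variable, the weight of a vertex, to all
  coordinates (\<open>shift_decomposition\<close>). Both preserve well decomposed vectors.

  Side by side: if the minimum \<open>w\<close> is attained in one copy, then the other copies are independent and
  conditioned to have their minimum above \<open>w\<close>. For such a copy \<open>V\<close>, the vector \<open>w - V\<close> can be sampled as
  a nondecreasing function of \<open>w\<close> (\<open>thinning\<close>): sample the minimum of \<open>V\<close> from the tail of \<open>\<nu>\<close> beyond \<open>w\<close>
  by its quantile function. This minimum grows with \<open>w\<close>, hence so do the gaps inside \<open>V\<close>, while its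
  excess over \<open>w\<close> decreases, by log-concavity. The position of the minimum of \<open>V\<close> can be sampled
  independently of \<open>w\<close>, because it is uniform.

  Adding a variable with density \<open>l * exp (- l * e)\<close>: given that the new minimum is \<open>w\<close>, the old minimum
  has density proportional to \<open>exp (l * m)\<close> with respect to \<open>\<nu>\<close>, truncated to \<open>m \<le> w\<close>. The quantiles of a
  truncated law grow with the truncation level, and the gaps grow with the old minimum.

  Log-concavity of the tails is preserved because the tail of a minimum of independent copies is a
  power, and the tail of the sum is, up to an exponential factor, a primitive of a log-concave function
  (\<open>log_concave_primitive\<close>).
\<close>

section \<open>Sampling from a uniform variable\<close>

text \<open>The uniform distribution on \<open>(0, 1)\<close>. The space is the open interval itself, so that statements about
  quantiles hold for all sample points rather than almost all.\<close>

definition unif :: "real measure" where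
  "unif = restrict_space lborel {0<..<1}"

lemma space_unif: "space unif = {0<..<1}"
  by (simp add: unif_def space_restrict_space)

lemma prob_space_unif: "prob_space unif"
  by (rule prob_spaceI) (simp add: unif_def emeasure_restrict_space space_restrict_space)

lemma measurable_unif_id: "(\<lambda>u. u) \<in> borel_measurable unif"
  unfolding unif_def by (rule measurable_restrict_space1) simp

lemma emeasure_unif: "A \<in> sets borel \<Longrightarrow> A \<subseteq> {0<..<1} \<Longrightarrow> emeasure unif A = emeasure lborel A"
  unfolding unif_def by (simp add: emeasure_restrict_space)

lemma emeasure_unif_lessThan:
  assumes "0 \<le> a"
  shows "emeasure unif {u \<in> space unif. u < a} = ennreal (min 1 a)"
proof -
  have "{u \<in> space unif. u < a} = {0<..<min 1 a}" by (auto simp: space_unif)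
  moreover have "emeasure unif {0<..<min 1 a} = emeasure lborel {0<..<min 1 a}"
    by (intro emeasure_unif) auto
  ultimately show ?thesis using assms by (simp add: min_def)
qed

lemma emeasure_unif_greaterThan:
  assumes "0 \<le> a"
  shows "emeasure unif {u \<in> space unif. a < u} = ennreal (max 0 (1 - a))"
proof (cases "a \<le> 1")
  case True
  have "{u \<in> space unif. a < u} = {a<..<1}" using assms by (auto simp: space_unif)
  moreover have "emeasure unif {a<..<1} = emeasure lborel {a<..<1}"
    using assms by (intro emeasure_unif) auto
  ultimately show ?thesis using True by simp
next
  case False
  then have *: "{u \<in> space unif. a < u} = {}" by (auto simp: space_unif)
  show ?thesis using False unfolding * by simp
qed

text \<open>A finite set can be sampled uniformly from a uniform variable.\<close>

lemma uniform_choice: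
  fixes I :: "'i set"
  assumes "finite I" "I \<noteq> {}"
  obtains Z :: "real \<Rightarrow> 'i" where
    "\<And>u. u \<in> space unif \<Longrightarrow> Z u \<in> I" "Z \<in> unif \<rightarrow>\<^sub>M count_space I"
    "\<And>f :: 'i \<Rightarrow> ennreal. of_nat (card I) * (\<integral>\<^sup>+u. f (Z u) \<partial>unif) = (\<Sum>z\<in>I. f z)"
proof -
  note measurable_unif_id [measurable]
  let ?n = "card I"
  have n: "0 < ?n" using assms by (simp add: card_gt_0_iff)
  obtain e where e: "bij_betw e {..<?n} I"
    using assms(1) bij_betw_from_nat_into_finite by blast
  \<comment> \<open>Split the unit interval into \<open>card I\<close> intervals of equal length.\<close>
  define K where "K u = nat \<lfloor>real ?n * u\<rfloor>" for u :: real
  have Kiff: "K u = k \<longleftrightarrow> real k / ?n \<le> u \<and> u < real (Suc k) / ?n" if "u \<in> space unif" for u k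
  proof -
    have "K u = k \<longleftrightarrow> \<lfloor>real ?n * u\<rfloor> = int k"
      using that by (auto simp: K_def space_unif)
    also have "\<dots> \<longleftrightarrow> real k \<le> real ?n * u \<and> real ?n * u < real k + 1"
      by (subst floor_eq_iff) simp
    finally show ?thesis using n by (simp add: field_simps)
  qed
  have Klt: "K u < ?n" if "u \<in> space unif" for u
  proof -
    have "real ?n * u < real ?n" using that n by (simp add: space_unif)
    then have "\<lfloor>real ?n * u\<rfloor> < int ?n" by (simp add: floor_less_iff)
    then show ?thesis using n by (auto simp: K_def nat_less_iff)
  qed
  have Km: "K \<in> unif \<rightarrow>\<^sub>M count_space UNIV" unfolding K_def by measurable
  define Z where "Z u = e (K u)" for u
  have ZI: "Z u \<in> I" if "u \<in> space unif" for u
    using Klt[OF that] e by (auto simp: Z_def bij_betw_def)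
  have "K \<in> unif \<rightarrow>\<^sub>M count_space {..<?n}"
    using measurable_sets[OF Km] Klt by (subst measurable_count_space_eq2_countable) auto
  moreover have "e \<in> count_space {..<?n} \<rightarrow>\<^sub>M count_space I"
    using e by (auto simp: bij_betw_def)
  ultimately have Zm: "Z \<in> unif \<rightarrow>\<^sub>M count_space I"
    unfolding Z_def by (rule measurable_compose)
  have main: "of_nat ?n * (\<integral>\<^sup>+u. f (Z u) \<partial>unif) = (\<Sum>z\<in>I. f z)" for f :: "'i \<Rightarrow> ennreal"
  proof -
    have em: "emeasure unif {u \<in> space unif. K u = k} = ennreal (1 / ?n)" if k: "k < ?n" for k
    proof -
      define a b where "a = real k / ?n" and "b = real (Suc k) / ?n"
      have ab: "0 \<le> a" "a \<le> b" "b \<le> 1" "b - a = 1 / ?n"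
        using k n by (auto simp: a_def b_def field_simps)
      have "{u \<in> space unif. K u = k} = {u \<in> space unif. a \<le> u \<and> u < b}"
        using Kiff unfolding a_def b_def by blast
      also have "\<dots> = {a..<b} - {0}" using ab(1-3) by (auto simp: space_unif)
      finally have *: "{u \<in> space unif. K u = k} = {a..<b} - {0}" .
      have "emeasure unif {u \<in> space unif. K u = k} = emeasure lborel ({a..<b} - {0})"
        unfolding * using ab(1-3) by (intro emeasure_unif) auto
      also have "\<dots> = emeasure lborel {a..<b}"
        by (intro emeasure_Diff_null_set) auto
      also have "\<dots> = ennreal (1 / ?n)"
        using ab by simp
      finally show ?thesis .
    qed
    have "(\<integral>\<^sup>+u. f (Z u) \<partial>unif)
        = (\<integral>\<^sup>+u. (\<Sum>k<?n. f (e k) * indicator {u \<in> space unif. K u = k} u) \<partial>unif)"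
    proof (rule nn_integral_cong)
      fix u assume u: "u \<in> space unif"
      have "(\<Sum>k<?n. f (e k) * indicator {u \<in> space unif. K u = k} u)
          = (\<Sum>k<?n. if k = K u then f (e k) else 0)"
        using u by (intro sum.cong) (auto simp: indicator_def)
      then show "f (Z u) = (\<Sum>k<?n. f (e k) * indicator {u \<in> space unif. K u = k} u)"
        using Klt[OF u] by (simp add: Z_def)
    qed
    also have "\<dots> = (\<Sum>k<?n. f (e k) * emeasure unif {u \<in> space unif. K u = k})"
      using Km by (subst nn_integral_sum) (auto simp: nn_integral_cmult_indicator)
    also have "\<dots> = (\<Sum>k<?n. f (e k)) * ennreal (1 / ?n)"
      by (simp add: em sum_distrib_right)
    also have "(\<Sum>k<?n. f (e k)) = (\<Sum>z\<in>I. f z)"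
      by (rule sum.reindex_bij_betw[OF e])
    finally have "of_nat ?n * (\<integral>\<^sup>+u. f (Z u) \<partial>unif)
        = (\<Sum>z\<in>I. f z) * (of_nat ?n * ennreal (1 / ?n))" by (simp add: mult_ac)
    also have "of_nat ?n * ennreal (1 / ?n) = 1"
      using n by (simp add: ennreal_of_nat_eq_real_of_nat ennreal_mult[symmetric] ennreal_1[symmetric] del: ennreal_1)
    finally show ?thesis by simp
  qed
  show ?thesis by (rule that[OF ZI Zm main])
qed

section \<open>Log-concave functions\<close>

text \<open>This is log-concavity written without logarithms: the ratio \<open>G (r + s) / G r\<close> decreases in \<open>r\<close>.
  Values \<open>0\<close> and \<open>\<infinity>\<close> are allowed.\<close>

definition log_concave :: "(real \<Rightarrow> ennreal) \<Rightarrow> bool" where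
  "log_concave G \<longleftrightarrow> (\<forall>r r' s. r \<le> r' \<longrightarrow> 0 \<le> s \<longrightarrow> G (r' + s) * G r \<le> G (r + s) * G r')"

lemma log_concaveD: "log_concave G \<Longrightarrow> r \<le> r' \<Longrightarrow> 0 \<le> s \<Longrightarrow> G (r' + s) * G r \<le> G (r + s) * G r'"
  by (simp add: log_concave_def)

lemma log_concave_mult:
  assumes "log_concave f" "log_concave g"
  shows "log_concave (\<lambda>r. f r * g r)"
  unfolding log_concave_def
proof safe
  fix r r' s :: real assume "r \<le> r'" "0 \<le> s"
  then have "(f (r' + s) * f r) * (g (r' + s) * g r) \<le> (f (r + s) * f r') * (g (r + s) * g r')"
    using assms by (intro mult_mono log_concaveD) auto
  then show "f (r' + s) * g (r' + s) * (f r * g r) \<le> f (r + s) * g (r + s) * (f r' * g r')"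
    by (simp add: mult_ac)
qed

lemma log_concave_const: "log_concave (\<lambda>_. c)"
  by (simp add: log_concave_def)

lemma log_concave_power: "log_concave f \<Longrightarrow> log_concave (\<lambda>r. f r ^ n)"
  by (induction n) (auto intro: log_concave_mult log_concave_const)

lemma log_concave_exp: "log_concave (\<lambda>r. ennreal (exp (c * r)))"
  by (simp add: log_concave_def ennreal_mult[symmetric] exp_add[symmetric] algebra_simps)

text \<open>Both \<open>K (r + s) - K r\<close> and \<open>K r\<close> are integrals of \<open>k\<close>, over shifts \<open>a \<in> (0, s]\<close> and \<open>- v \<le> 0\<close> of the
  point \<open>r\<close>. The claim is then the integral over \<open>a\<close> and \<open>v\<close> of the log-concavity of \<open>k\<close> for the points
  \<open>r - v \<le> r' - v\<close> and the increment \<open>a + v\<close>.\<close>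

lemma log_concave_primitive:
  fixes k :: "real \<Rightarrow> ennreal"
  assumes k [measurable]: "k \<in> borel_measurable borel" and lc: "log_concave k"
  shows "log_concave (\<lambda>r. \<integral>\<^sup>+y. k y * indicator {..r} y \<partial>lborel)"
  unfolding log_concave_def
proof safe
  fix r r' s :: real assume r: "r \<le> r'" and s: "0 \<le> s"
  define K where "K r = (\<integral>\<^sup>+y. k y * indicator {..r} y \<partial>lborel)" for r
  define J where "J r = (\<integral>\<^sup>+a. k (r + a) * indicator {0<..s} a \<partial>lborel)" for r
  have refl: "K x = (\<integral>\<^sup>+v. k (x - v) * indicator {0..} v \<partial>lborel)" for x
  proof -
    have "K x = (\<integral>\<^sup>+v. k (x + (-1) * v) * indicator {..x} (x + (-1) * v) \<partial>lborel)"
      unfolding K_def by (subst nn_integral_real_affine[where c="-1" and t=x]) auto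
    then show ?thesis by (auto intro!: nn_integral_cong split: split_indicator)
  qed
  have add: "K (x + s) = K x + J x" for x
  proof -
    have "J x = (\<integral>\<^sup>+y. k y * indicator {x<..x + s} y \<partial>lborel)"
      unfolding J_def
      by (subst nn_integral_real_affine[where c=1 and t=x])
         (auto intro!: nn_integral_cong split: split_indicator)
    then have "K x + J x = (\<integral>\<^sup>+y. k y * indicator {..x} y + k y * indicator {x<..x + s} y \<partial>lborel)"
      by (simp add: K_def nn_integral_add)
    also have "\<dots> = K (x + s)"
      unfolding K_def using s by (intro nn_integral_cong) (auto split: split_indicator)
    finally show ?thesis by simp
  qed
  have prod: "J x * K y = (\<integral>\<^sup>+a. (\<integral>\<^sup>+v. (k (x + a) * k (y - v)) * (indicator {0<..s} a * indicator {0..} v) \<partial>lborel) \<partial>lborel)" for x y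
    unfolding J_def refl[of y]
    by (subst nn_integral_multc[symmetric], simp)
       (auto intro!: nn_integral_cong simp: nn_integral_cmult[symmetric] mult_ac)
  have "J r' * K r = (\<integral>\<^sup>+a. (\<integral>\<^sup>+v. (k (r' + a) * k (r - v)) * (indicator {0<..s} a * indicator {0..} v) \<partial>lborel) \<partial>lborel)"
    by (rule prod)
  also have "\<dots> \<le> (\<integral>\<^sup>+a. (\<integral>\<^sup>+v. (k (r + a) * k (r' - v)) * (indicator {0<..s} a * indicator {0..} v) \<partial>lborel) \<partial>lborel)"
  proof (intro nn_integral_mono)
    fix a v :: real
    show "(k (r' + a) * k (r - v)) * (indicator {0<..s} a * indicator {0..} v)
      \<le> (k (r + a) * k (r' - v)) * (indicator {0<..s} a * indicator {0..} v)"
      using log_concaveD[OF lc, of "r - v" "r' - v" "a + v"] r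
      by (auto split: split_indicator)
  qed
  also have "\<dots> = J r * K r'"
    by (rule prod[symmetric])
  finally have "K r' * K r + J r' * K r \<le> K r' * K r + J r * K r'"
    by (rule add_left_mono)
  then have "K (r' + s) * K r \<le> K (r + s) * K r'"
    by (simp add: add distrib_left distrib_right mult_ac)
  then show "(\<integral>\<^sup>+y. k y * indicator {..r' + s} y \<partial>lborel) * (\<integral>\<^sup>+y. k y * indicator {..r} y \<partial>lborel)
    \<le> (\<integral>\<^sup>+y. k y * indicator {..r + s} y \<partial>lborel) * (\<integral>\<^sup>+y. k y * indicator {..r'} y \<partial>lborel)"
    by (simp add: K_def)
qed

lemma log_concave_cancel:
  assumes "log_concave (\<lambda>r. c * f r)" "c \<noteq> 0" "c \<noteq> top"
  shows "log_concave f"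
  unfolding log_concave_def
proof safe
  fix r r' s :: real assume "r \<le> r'" "0 \<le> s"
  from log_concaveD[OF assms(1) this]
  have "c * (c * (f (r' + s) * f r)) \<le> c * (c * (f (r + s) * f r'))" by (simp add: mult_ac)
  then show "f (r' + s) * f r \<le> f (r + s) * f r'"
    using assms(2,3) by (simp add: ennreal_mult_le_mult_iff)
qed

section \<open>Measures on the half-line and quantile transforms\<close>

text \<open>Atomless, locally finite measures on \<open>(0, \<infinity>)\<close> that charge every interval: their distribution function
  is continuous, vanishes on \<open>(-\<infinity>, 0]\<close> and is strictly increasing on \<open>[0, \<infinity>)\<close>. The total mass may be
  infinite, as happens after weighting with an exponential.\<close>

locale halfline_measure =
  fixes \<nu> :: "real measure"
  assumes sets_nu [measurable_cong, simp]: "sets \<nu> = sets borel"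
    and atMost_finite: "\<And>t. emeasure \<nu> {..t} < \<infinity>"
    and nonpos_null: "emeasure \<nu> {..0} = 0"
    and atomless: "\<And>x. emeasure \<nu> {x} = 0"
    and interval_pos: "\<And>a b. 0 \<le> a \<Longrightarrow> a < b \<Longrightarrow> 0 < emeasure \<nu> {a<..b}"
begin

text \<open>The distribution function of \<open>\<nu>\<close>.\<close>

definition F :: "real \<Rightarrow> real" where "F t = measure \<nu> {..t}"

lemma space_nu [simp]: "space \<nu> = UNIV"
  using sets_eq_imp_space_eq[OF sets_nu] by simp

lemma measurable_nu [simp]: "borel_measurable \<nu> = borel_measurable borel"
  by (rule measurable_cong_sets) auto

lemma emeasure_atMost: "emeasure \<nu> {..t} = ennreal (F t)"
  using atMost_finite[of t] by (simp add: F_def emeasure_eq_ennreal_measure)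

lemma F_nonneg: "0 \<le> F t" by (simp add: F_def)

lemma F_nonpos: "t \<le> 0 \<Longrightarrow> F t = 0"
  using emeasure_mono[of "{..t}" "{..0}" \<nu>] nonpos_null by (simp add: F_def measure_def)

lemma emeasure_interval: "a \<le> b \<Longrightarrow> emeasure \<nu> {a<..b} = ennreal (F b - F a)"
proof -
  assume ab: "a \<le> b"
  have "{a<..b} = {..b} - {..a}" using ab by auto
  then have "emeasure \<nu> {a<..b} = emeasure \<nu> {..b} - emeasure \<nu> {..a}"
    using ab atMost_finite[of a] by (simp add: emeasure_Diff)
  then show ?thesis by (simp add: emeasure_atMost F_nonneg ennreal_minus)
qed

lemma F_less: "0 \<le> a \<Longrightarrow> a < b \<Longrightarrow> F a < F b"
  using interval_pos[of a b] emeasure_interval[of a b] by simp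

lemma F_mono: "a \<le> b \<Longrightarrow> F a \<le> F b"
  by (metis F_less F_nonneg F_nonpos le_less linear)

lemma F_le_iff: "0 \<le> a \<Longrightarrow> 0 \<le> b \<Longrightarrow> F a \<le> F b \<longleftrightarrow> a \<le> b"
  by (meson F_less F_mono not_le)

lemma F_pos: "0 < t \<Longrightarrow> 0 < F t"
  using F_less[of 0 t] F_nonpos[of 0] by simp

lemma isCont_F: "isCont F t"
proof -
  let ?D = "density \<nu> (indicator {..t + 1})"
  have fin: "finite_measure ?D"
    by (rule finite_measureI) (use atMost_finite[of "t+1"] in \<open>auto simp: emeasure_restricted\<close>)
  interpret D: finite_borel_measure ?D
    using fin by (intro finite_borel_measure.intro finite_borel_measure_axioms.intro) auto
  have "emeasure ?D {t} = 0"
    by (simp add: emeasure_restricted atomless)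
  then have "isCont (cdf ?D) t" by (simp add: D.isCont_cdf measure_def)
  moreover have "\<forall>\<^sub>F x in nhds t. cdf ?D x = F x"
  proof -
    have "\<forall>\<^sub>F x in nhds t. x \<in> {..<t + 1}"
      by (rule eventually_nhds_in_open) auto
    then show ?thesis
    proof eventually_elim
      case (elim x)
      have "{..t + 1} \<inter> {..x} = {..x}" using elim by auto
      then have "emeasure ?D {..x} = emeasure \<nu> {..x}"
        by (simp add: emeasure_restricted)
      then show ?case by (simp add: cdf_def F_def measure_def)
    qed
  qed
  ultimately show ?thesis by (simp add: isCont_cong)
qed

text \<open>The inverse of \<^term>\<open>F\<close> on its range; unspecified elsewhere.\<close>

definition quantile :: "real \<Rightarrow> real" where
  "quantile y = (THE x. 0 \<le> x \<and> F x = y)"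

lemma quantile:
  assumes "0 \<le> y" "y \<le> F t"
  shows "0 \<le> quantile y" "F (quantile y) = y"
proof -
  have "\<exists>x. 0 \<le> x \<and> x \<le> max 0 t \<and> F x = y"
  proof (rule IVT)
    show "F 0 \<le> y" using assms F_nonpos[of 0] by simp
    show "y \<le> F (max 0 t)" using assms F_mono[of t "max 0 t"] by simp
  qed (auto simp: isCont_F)
  then obtain x where x: "0 \<le> x" "F x = y" by blast
  have "x' = x" if "0 \<le> x' \<and> F x' = y" for x'
    by (rule antisym) (use that x F_le_iff[of x x'] F_le_iff[of x' x] in auto)
  then have "quantile y = x"
    unfolding quantile_def using x by (intro the_equality) blast+
  with x show "0 \<le> quantile y" "F (quantile y) = y" by simp_all
qed

lemma quantile_le_iff:
  assumes "0 \<le> y" "y \<le> F t"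
  shows "quantile y \<le> x \<longleftrightarrow> 0 \<le> x \<and> y \<le> F x"
  using quantile[OF assms] F_le_iff[of "quantile y" x] order_trans by metis

lemma measurable_F [measurable]: "F \<in> borel_measurable borel"
  by (intro borel_measurable_mono monoI F_mono)

text \<open>The quantile function of \<open>\<nu>\<close> restricted to \<open>(-\<infinity>, t]\<close> and normalised. For \<open>t \<le> 0\<close>, where that restriction is null,
  its value is \<open>0\<close>.\<close>

definition trunc_quantile :: "real \<Rightarrow> real \<Rightarrow> real" where
  "trunc_quantile t u = quantile (u * F t)"

lemma trunc_arg:
  assumes "u \<in> space unif"
  shows "0 \<le> u * F t" "u * F t \<le> F t"
  using assms F_nonneg[of t] by (auto simp: space_unif intro: mult_left_le_one_le)

lemma trunc_quantile_le_iff: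
  "u \<in> space unif \<Longrightarrow> trunc_quantile t u \<le> x \<longleftrightarrow> 0 \<le> x \<and> u * F t \<le> F x"
  unfolding trunc_quantile_def by (rule quantile_le_iff[OF trunc_arg])

lemma trunc_quantile_mono:
  assumes "u \<in> space unif" "s \<le> t"
  shows "trunc_quantile s u \<le> trunc_quantile t u"
proof -
  have "u * F s \<le> u * F t" using assms F_mono by (auto simp: space_unif intro: mult_left_mono)
  then show ?thesis
    using quantile[OF trunc_arg[OF assms(1), of t]] unfolding trunc_quantile_le_iff[OF assms(1)]
    by (auto simp: trunc_quantile_def)
qed

lemma measurable_trunc_quantile [measurable]:
  "(\<lambda>(t, u). trunc_quantile t u) \<in> borel_measurable (borel \<Otimes>\<^sub>M unif)"
proof (rule borel_measurableI_le)
  note measurable_unif_id [measurable]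
  fix y
  have "{x \<in> space (borel \<Otimes>\<^sub>M unif). (case x of (t, u) \<Rightarrow> trunc_quantile t u) \<le> y}
      = {x \<in> space (borel \<Otimes>\<^sub>M unif). 0 \<le> y \<and> snd x * F (fst x) \<le> F y}"
    by (auto simp: trunc_quantile_le_iff space_pair_measure)
  also have "\<dots> \<in> sets (borel \<Otimes>\<^sub>M unif)" by measurable
  finally show "{x \<in> space (borel \<Otimes>\<^sub>M unif). (case x of (t, u) \<Rightarrow> trunc_quantile t u) \<le> y}
      \<in> sets (borel \<Otimes>\<^sub>M unif)" .
qed

text \<open>Inverse transform sampling from the restriction of \<open>\<nu>\<close> to \<open>(-\<infinity>, t]\<close>.\<close>

lemma nn_integral_trunc_quantile:
  assumes [measurable]: "g \<in> borel_measurable borel"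
  shows "(\<integral>\<^sup>+m. g m * indicator {..t} m \<partial>\<nu>) = ennreal (F t) * (\<integral>\<^sup>+u. g (trunc_quantile t u) \<partial>unif)"
proof -
  have [measurable]: "trunc_quantile t \<in> borel_measurable unif"
    using measurable_compose_Pair1[OF _ measurable_trunc_quantile, of t] by simp
  let ?M = "density \<nu> (indicator {..t})"
  let ?N = "scale_measure (ennreal (F t)) (distr unif borel (trunc_quantile t))"
  have eM: "emeasure ?M {x<..} = ennreal (F t - F (min x t))" for x
  proof -
    have "{..t} \<inter> {x<..} = {min x t<..t}" by auto
    then have "emeasure ?M {x<..} = emeasure \<nu> {min x t<..t}"
      by (simp add: emeasure_restricted)
    then show ?thesis using emeasure_interval[of "min x t" t] by simp
  qed
  have "?M = ?N"
  proof (rule measure_eqI_lessThan)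
    show "emeasure ?M {x<..} < \<infinity>" for x by (simp add: eM)
    fix x
    have "emeasure ?N {x<..} = ennreal (F t) * emeasure unif {u \<in> space unif. x < trunc_quantile t u}"
      by (simp add: emeasure_distr vimage_def Int_def conj_commute)
    also have "{u \<in> space unif. x < trunc_quantile t u} = {u \<in> space unif. x < 0 \<or> F x < u * F t}"
      using trunc_quantile_le_iff[of _ t x] by (auto simp: not_le[symmetric])
    also have "ennreal (F t) * emeasure unif \<dots> = ennreal (F t - F (min x t))"
    proof (cases "F t = 0 \<or> x < 0")
      case True
      then show ?thesis
      proof
        assume "F t = 0"
        then show ?thesis using F_nonneg[of "min x t"] by (simp add: ennreal_neg)
      next
        assume x: "x < 0"
        then have "F (min x t) = 0" by (intro F_nonpos) auto
        moreover have "{u \<in> space unif. x < 0 \<or> F x < u * F t} = space unif" using x by auto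
        ultimately show ?thesis using prob_space.emeasure_space_1[OF prob_space_unif] by simp
      qed
    next
      case False
      then have pos: "0 < F t" using F_nonneg[of t] by simp
      have "{u \<in> space unif. x < 0 \<or> F x < u * F t} = {u \<in> space unif. F x / F t < u}"
        using pos False by (intro Collect_cong) (simp add: pos_divide_less_eq)
      then have "ennreal (F t) * emeasure unif {u \<in> space unif. x < 0 \<or> F x < u * F t}
          = ennreal (F t * max 0 (1 - F x / F t))"
        using pos by (simp add: emeasure_unif_greaterThan F_nonneg ennreal_mult)
      also have "F t * max 0 (1 - F x / F t) = F t - F (min x t)"
        using pos F_mono[of x t] F_mono[of t x] by (auto simp: max_def min_def field_simps)
      finally show ?thesis .
    qed
    finally show "emeasure ?M {x<..} = emeasure ?N {x<..}" by (simp add: eM)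
  qed auto
  then have "(\<integral>\<^sup>+m. g m \<partial>?M) = (\<integral>\<^sup>+m. g m \<partial>?N)" by simp
  moreover have "(\<integral>\<^sup>+m. g m \<partial>?M) = (\<integral>\<^sup>+m. g m * indicator {..t} m \<partial>\<nu>)"
    by (subst nn_integral_density) (auto simp: mult.commute[of "g _"])
  ultimately show ?thesis
    by (simp add: nn_integral_scale_measure nn_integral_distr)
qed

end

locale finite_halfline_measure = halfline_measure +
  assumes total_finite: "emeasure \<nu> UNIV < \<infinity>"
begin

text \<open>The tail of \<open>\<nu>\<close>.\<close>

definition G :: "real \<Rightarrow> real" where "G r = measure \<nu> {r<..}"

lemma emeasure_greaterThan: "emeasure \<nu> {r<..} = ennreal (G r)"
proof -
  have "emeasure \<nu> {r<..} \<le> emeasure \<nu> UNIV" by (rule emeasure_mono) auto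
  then have "emeasure \<nu> {r<..} \<noteq> top" using total_finite by (auto simp: top_unique)
  then show ?thesis by (simp add: G_def emeasure_eq_ennreal_measure)
qed

lemma G_nonneg: "0 \<le> G r" by (simp add: G_def)

lemma finite_measure_nu: "finite_measure \<nu>"
  by (rule finite_measureI) (use total_finite in auto)

lemma G_eq: "G r = measure \<nu> UNIV - F r"
proof -
  interpret finite_measure \<nu> by (rule finite_measure_nu)
  have "{r<..} = UNIV - {..r}" by auto
  then show ?thesis using finite_measure_Diff[of UNIV "{..r}"] by (simp add: G_def F_def)
qed

lemma G_pos: "0 < G r"
  using F_less[of "max 0 r" "max 0 r + 1"] F_mono[of r "max 0 r"] G_nonneg[of "max 0 r + 1"]
    G_eq[of r] G_eq[of "max 0 r + 1"]
  by linarith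

lemma measurable_G [measurable]: "G \<in> borel_measurable borel"
proof -
  have "G = (\<lambda>r. measure \<nu> UNIV - F r)" by (rule ext) (rule G_eq)
  then show ?thesis by simp
qed

lemma F_at_top: "(F \<longlongrightarrow> measure \<nu> UNIV) at_top"
proof -
  interpret finite_borel_measure \<nu>
    using finite_measure_nu by (intro finite_borel_measure.intro finite_borel_measure_axioms.intro) auto
  show ?thesis using cdf_lim_at_top by (simp add: cdf_def F_def[abs_def])
qed

text \<open>The point at which the tail has dropped to \<open>u * G r\<close>: a quantile function of \<open>\<nu>\<close> restricted to \<open>(r, \<infinity>)\<close>.\<close>

definition tail_quantile :: "real \<Rightarrow> real \<Rightarrow> real" where
  "tail_quantile r u = quantile (measure \<nu> UNIV - u * G r)"

lemma tail_arg:
  assumes "u \<in> space unif"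
  shows "0 \<le> measure \<nu> UNIV - u * G r" "\<exists>t. measure \<nu> UNIV - u * G r \<le> F t"
proof -
  have "u * G r \<le> G r" using assms G_nonneg[of r] by (auto simp: space_unif intro: mult_left_le_one_le)
  then show "0 \<le> measure \<nu> UNIV - u * G r" using F_nonneg[of r] G_eq[of r] by linarith
  have "0 < u * G r" using assms G_pos by (simp add: space_unif)
  then have "\<forall>\<^sub>F t in at_top. measure \<nu> UNIV - u * G r < F t"
    by (intro order_tendstoD(1)[OF F_at_top]) simp
  then obtain t where "measure \<nu> UNIV - u * G r < F t"
    unfolding eventually_at_top_linorder by blast
  then show "\<exists>t. measure \<nu> UNIV - u * G r \<le> F t" by (auto intro: less_imp_le)
qed

lemma tail_quantile:
  assumes "u \<in> space unif"
  shows "0 \<le> tail_quantile r u" "G (tail_quantile r u) = u * G r"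
proof -
  obtain t where t: "measure \<nu> UNIV - u * G r \<le> F t" using tail_arg(2)[OF assms] by blast
  show "0 \<le> tail_quantile r u"
    unfolding tail_quantile_def by (rule quantile(1)[OF tail_arg(1)[OF assms] t])
  have "F (tail_quantile r u) = measure \<nu> UNIV - u * G r"
    unfolding tail_quantile_def by (rule quantile(2)[OF tail_arg(1)[OF assms] t])
  then show "G (tail_quantile r u) = u * G r"
    unfolding G_eq[of "tail_quantile r u"] by linarith
qed

lemma G_le_iff: "0 \<le> a \<Longrightarrow> 0 \<le> b \<Longrightarrow> G a \<le> G b \<longleftrightarrow> b \<le> a"
  unfolding G_eq[of a] G_eq[of b] using F_le_iff[of b a] by linarith

lemma tail_quantile_le_iff:
  assumes "u \<in> space unif"
  shows "tail_quantile r u \<le> x \<longleftrightarrow> 0 \<le> x \<and> G x \<le> u * G r"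
  using tail_quantile[OF assms, of r] G_le_iff[of x "tail_quantile r u"] order_trans by metis

lemma tail_quantile_greater:
  assumes "u \<in> space unif"
  shows "r < tail_quantile r u"
proof -
  have "u * G r < G r" using assms G_pos[of r] by (simp add: space_unif)
  then show ?thesis using tail_quantile_le_iff[OF assms, of r r] by (simp add: not_le[symmetric])
qed

lemma G_antimono: "a \<le> b \<Longrightarrow> G b \<le> G a" using F_mono by (simp add: G_eq)

lemma tail_quantile_mono:
  assumes "u \<in> space unif" "r \<le> r'"
  shows "tail_quantile r u \<le> tail_quantile r' u"
proof -
  have "u * G r' \<le> u * G r" using assms G_antimono by (auto simp: space_unif intro: mult_left_mono)
  then show ?thesis
    using tail_quantile[OF assms(1), of r'] unfolding tail_quantile_le_iff[OF assms(1)] by auto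
qed

text \<open>Log-concavity of the tail means that the excess over a threshold, given that the threshold is
  exceeded, is stochastically decreasing in the threshold.\<close>

lemma tail_quantile_excess_antimono:
  assumes lc: "log_concave (\<lambda>r. emeasure \<nu> {r<..})" and u: "u \<in> space unif" and r: "r \<le> r'"
  shows "tail_quantile r' u - r' \<le> tail_quantile r u - r"
proof -
  define x where "x = tail_quantile r u - r"
  have x: "0 < x" using tail_quantile_greater[OF u] by (simp add: x_def)
  have "ennreal (G (r' + x)) * ennreal (G r) \<le> ennreal (G (r + x)) * ennreal (G r')"
    using lc r x unfolding log_concave_def emeasure_greaterThan by simp
  then have "G (r' + x) * G r \<le> G (r + x) * G r'"
    by (simp add: ennreal_mult[symmetric] G_nonneg)
  also have "G (r + x) = u * G r" using tail_quantile[OF u] by (simp add: x_def)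
  finally have "G (r' + x) \<le> u * G r'" using G_pos[of r] by (simp add: mult_ac)
  moreover have "0 \<le> r' + x" using r tail_quantile(1)[OF u, of r] by (simp add: x_def)
  ultimately have "tail_quantile r' u \<le> r' + x" by (simp add: tail_quantile_le_iff[OF u])
  then show ?thesis by (simp add: x_def)
qed

lemma measurable_tail_quantile [measurable]:
  "(\<lambda>(t, u). tail_quantile t u) \<in> borel_measurable (borel \<Otimes>\<^sub>M unif)"
proof (rule borel_measurableI_le)
  note measurable_unif_id [measurable]
  fix y
  have "{x \<in> space (borel \<Otimes>\<^sub>M unif). (case x of (t, u) \<Rightarrow> tail_quantile t u) \<le> y}
      = {x \<in> space (borel \<Otimes>\<^sub>M unif). 0 \<le> y \<and> G y \<le> snd x * G (fst x)}"
    by (auto simp: tail_quantile_le_iff space_pair_measure)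
  also have "\<dots> \<in> sets (borel \<Otimes>\<^sub>M unif)" by measurable
  finally show "{x \<in> space (borel \<Otimes>\<^sub>M unif). (case x of (t, u) \<Rightarrow> tail_quantile t u) \<le> y}
      \<in> sets (borel \<Otimes>\<^sub>M unif)" .
qed

text \<open>Inverse transform sampling from the restriction of \<open>\<nu>\<close> to \<open>(r, \<infinity>)\<close>.\<close>

lemma nn_integral_tail_quantile:
  assumes [measurable]: "g \<in> borel_measurable borel"
  shows "(\<integral>\<^sup>+m. g m * indicator {r<..} m \<partial>\<nu>)
    = emeasure \<nu> {r<..} * (\<integral>\<^sup>+u. g (tail_quantile r u) \<partial>unif)"
proof -
  have [measurable]: "tail_quantile r \<in> borel_measurable unif"
    using measurable_compose_Pair1[OF _ measurable_tail_quantile, of r] by simp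
  let ?M = "density \<nu> (indicator {r<..})"
  let ?N = "scale_measure (ennreal (G r)) (distr unif borel (tail_quantile r))"
  have eM: "emeasure ?M {x<..} = ennreal (G (max x r))" for x
  proof -
    have "{r<..} \<inter> {x<..} = {max x r<..}" by auto
    then have "emeasure ?M {x<..} = emeasure \<nu> {max x r<..}"
      by (simp add: emeasure_restricted)
    then show ?thesis using emeasure_greaterThan[of "max x r"] by simp
  qed
  have "?M = ?N"
  proof (rule measure_eqI_lessThan)
    show "emeasure ?M {x<..} < \<infinity>" for x by (simp add: eM)
    fix x
    have "emeasure ?N {x<..} = ennreal (G r) * emeasure unif {u \<in> space unif. x < tail_quantile r u}"
      by (simp add: emeasure_distr vimage_def Int_def conj_commute)
    also have "{u \<in> space unif. x < tail_quantile r u} = {u \<in> space unif. x < 0 \<or> u * G r < G x}"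
      using tail_quantile_le_iff[of _ r x] by (auto simp: not_le[symmetric])
    also have "\<dots> = {u \<in> space unif. u < G (max x 0) / G r}"
    proof (cases "x < 0")
      case True
      have "G r \<le> G 0" using G_eq[of r] G_eq[of 0] F_nonpos[of 0] F_nonneg[of r] by linarith
      then have "1 \<le> G 0 / G r" using G_pos[of r] by simp
      then show ?thesis using True by (auto simp: max_def space_unif)
    next
      case False
      then show ?thesis using G_pos[of r]
        by (intro Collect_cong) (simp add: pos_less_divide_eq max_def)
    qed
    also have "ennreal (G r) * emeasure unif \<dots> = ennreal (G r * min 1 (G (max x 0) / G r))"
      using G_pos[of r] G_nonneg by (simp add: emeasure_unif_lessThan ennreal_mult)
    also have "G r * min 1 (G (max x 0) / G r) = min (G r) (G (max x 0))"
      using G_pos[of r] by (auto simp: min_def field_simps)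
    also have "G (max x 0) = G x" by (auto simp: max_def G_eq F_nonpos)
    also have "min (G r) (G x) = G (max x r)"
      using G_antimono[of x r] G_antimono[of r x] by (auto simp: max_def min_def)
    finally show "emeasure ?M {x<..} = emeasure ?N {x<..}" by (simp add: eM)
  qed auto
  then have "(\<integral>\<^sup>+m. g m \<partial>?M) = (\<integral>\<^sup>+m. g m \<partial>?N)" by simp
  moreover have "(\<integral>\<^sup>+m. g m \<partial>?M) = (\<integral>\<^sup>+m. g m * indicator {r<..} m \<partial>\<nu>)"
    by (subst nn_integral_density) (auto simp: mult.commute[of "g _"])
  ultimately show ?thesis
    by (simp add: nn_integral_scale_measure nn_integral_distr emeasure_greaterThan)
qed

end

lemma halfline_measure_density:
  assumes "halfline_measure \<nu>" and f [measurable]: "f \<in> borel_measurable borel"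
    and pos: "\<And>x. 0 < f x" and fin: "\<And>t. emeasure (density \<nu> f) {..t} < \<infinity>"
  shows "halfline_measure (density \<nu> f)"
proof -
  interpret halfline_measure \<nu> by fact
  have null: "emeasure (density \<nu> f) A = 0" if "emeasure \<nu> A = 0" "A \<in> sets borel" for A
  proof -
    have "A \<in> null_sets \<nu>" using that by auto
    then have "A \<in> null_sets (density \<nu> f)"
      using absolutely_continuousI_density[of f \<nu>] f by (auto simp: absolutely_continuous_def)
    then show ?thesis by auto
  qed
  show ?thesis
  proof
    show "emeasure (density \<nu> f) {..0} = 0" by (rule null) (auto simp: nonpos_null)
    show "emeasure (density \<nu> f) {x} = 0" for x by (rule null) (auto simp: atomless)
    show "0 < emeasure (density \<nu> f) {a<..b}" if ab: "0 \<le> a" "a < b" for a b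
    proof (rule ccontr)
      assume "\<not> 0 < emeasure (density \<nu> f) {a<..b}"
      then have "(\<integral>\<^sup>+x. f x * indicator {a<..b} x \<partial>\<nu>) = 0"
        by (simp add: emeasure_density)
      then have "AE x in \<nu>. f x * indicator {a<..b} x = 0"
        by (subst (asm) nn_integral_0_iff_AE) auto
      then have "AE x in \<nu>. x \<notin> {a<..b}"
      proof eventually_elim
        case (elim x)
        show ?case
        proof
          assume "x \<in> {a<..b}"
          then have "f x = 0" using elim by simp
          then show False using pos[of x] by simp
        qed
      qed
      then have "emeasure \<nu> {a<..b} = 0"
        by (subst (asm) AE_iff_measurable[where N="{a<..b}"]) auto
      then show False using interval_pos[OF ab] by simp
    qed
  qed (use fin in auto)
qed

lemma finite_halfline_measure_density:
  assumes "finite_halfline_measure \<nu>" and f [measurable]: "f \<in> borel_measurable borel"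
    and pos: "\<And>x. 0 < f x" and fin: "emeasure (density \<nu> f) UNIV < \<infinity>"
  shows "finite_halfline_measure (density \<nu> f)"
proof (rule finite_halfline_measure.intro[OF halfline_measure_density])
  interpret finite_halfline_measure \<nu> by fact
  show "halfline_measure \<nu>" by (rule halfline_measure_axioms)
  show "emeasure (density \<nu> f) {..t} < \<infinity>" for t
    using fin emeasure_mono[of "{..t}" UNIV "density \<nu> f"] by (auto intro: le_less_trans)
qed (use f pos fin in \<open>auto intro: finite_halfline_measure_axioms.intro\<close>)

lemma finite_halfline_density_lborel:
  assumes f [measurable]: "f \<in> borel_measurable borel"
    and zero: "\<And>x. x < 0 \<Longrightarrow> f x = 0" and pos: "\<And>x. 0 < x \<Longrightarrow> 0 < f x"
    and fin: "emeasure (density lborel f) UNIV < \<infinity>"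
  shows "finite_halfline_measure (density lborel f)"
proof
  have point: "emeasure (density lborel f) {x} = 0" for x
  proof -
    have "{x} \<in> null_sets lborel" by (rule finite_imp_null_set_lborel) simp
    then have "{x} \<in> null_sets (density lborel f)"
      using absolutely_continuousI_density[of f lborel] by (auto simp: absolutely_continuous_def)
    then show ?thesis by auto
  qed
  then show "emeasure (density lborel f) {x} = 0" for x .
  show "emeasure (density lborel f) {..t} < \<infinity>" for t
    using fin emeasure_mono[of "{..t}" UNIV "density lborel f"] by (auto intro: le_less_trans)
  show "emeasure (density lborel f) {..0} = 0"
  proof -
    have "emeasure (density lborel f) {..<0} = (\<integral>\<^sup>+x. f x * indicator {..<0} x \<partial>lborel)"
      by (rule emeasure_density) auto
    also have "\<dots> = (\<integral>\<^sup>+(x::real). 0 \<partial>lborel)"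
      by (rule nn_integral_cong) (auto simp: zero split: split_indicator)
    finally have "emeasure (density lborel f) ({..<0} \<union> {0}) = 0"
      using emeasure_subadditive[of "{..<0}" "density lborel f" "{0}"] point[of 0] by simp
    moreover have "{..<0} \<union> {0} = {..0::real}" by auto
    ultimately show ?thesis by simp
  qed
  show "0 < emeasure (density lborel f) {a<..b}" if ab: "0 \<le> a" "a < b" for a b
  proof (rule ccontr)
    assume "\<not> 0 < emeasure (density lborel f) {a<..b}"
    then have "(\<integral>\<^sup>+x. f x * indicator {a<..b} x \<partial>lborel) = 0"
      by (simp add: emeasure_density)
    then have "AE x in lborel. f x * indicator {a<..b} x = 0"
      by (subst (asm) nn_integral_0_iff_AE) auto
    then have "AE x in lborel. x \<notin> {a<..b}"
    proof eventually_elim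
      case (elim x)
      show ?case
      proof
        assume x: "x \<in> {a<..b}"
        then have "f x = 0" using elim by simp
        then show False using pos[of x] x ab by simp
      qed
    qed
    then have "emeasure lborel {a<..b} = 0"
      by (subst (asm) AE_iff_measurable[where N="{a<..b}"]) auto
    then show False using ab by simp
  qed
qed (use fin in auto)

section \<open>Product measures\<close>

lemma measure_eqI_nn_integral:
  assumes "sets M = sets N"
    and "\<And>f. f \<in> borel_measurable M \<Longrightarrow> (\<integral>\<^sup>+x. f x \<partial>M) = (\<integral>\<^sup>+x. f x \<partial>N)"
  shows "M = N"
proof (rule measure_eqI[OF assms(1)])
  fix A assume A: "A \<in> sets M"
  have "emeasure M A = (\<integral>\<^sup>+x. indicator A x \<partial>M)" using A by simp
  also have "\<dots> = (\<integral>\<^sup>+x. indicator A x \<partial>N)" using A by (intro assms(2)) simp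
  also have "\<dots> = emeasure N A" using A assms(1) by simp
  finally show "emeasure M A = emeasure N A" .
qed

lemma measurable_comp_component:
  assumes "j \<in> J" "f \<in> M j \<rightarrow>\<^sub>M L"
  shows "(\<lambda>v. f (v j)) \<in> PiM J M \<rightarrow>\<^sub>M L"
  by (rule measurable_compose[OF _ assms(2)]) (rule measurable_component_singleton[OF assms(1)])

lemma measurable_restrict_map:
  "Y \<in> W \<rightarrow>\<^sub>M N \<Longrightarrow> (\<lambda>\<xi>. \<lambda>j\<in>J. Y (\<xi> j)) \<in> PiM J (\<lambda>_. W) \<rightarrow>\<^sub>M PiM J (\<lambda>_. N)"
  by (intro measurable_restrict measurable_comp_component)

text \<open>If weighting \<open>N\<close> with \<open>\<eta> j\<close> gives \<open>c\<close> times the law of \<open>Y\<close> under \<open>W\<close>, for every \<open>j\<close>, then weighting the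
  product of copies of \<open>N\<close> with the product of the \<open>\<eta> j\<close> gives \<open>c ^ card J\<close> times the law of
  independent copies of \<open>Y\<close>.\<close>

lemma nn_integral_PiM_replace:
  fixes \<eta> :: "'j \<Rightarrow> 'v \<Rightarrow> ennreal"
  assumes N: "prob_space N" and W: "prob_space W" and J: "finite J"
    and Y [measurable]: "Y \<in> W \<rightarrow>\<^sub>M N"
    and \<eta> [measurable]: "\<And>j. j \<in> J \<Longrightarrow> \<eta> j \<in> borel_measurable N"
    and eq: "\<And>j f. j \<in> J \<Longrightarrow> f \<in> borel_measurable N \<Longrightarrow>
      (\<integral>\<^sup>+v. f v * \<eta> j v \<partial>N) = c * (\<integral>\<^sup>+\<omega>. f (Y \<omega>) \<partial>W)"
    and F: "F \<in> borel_measurable (PiM J (\<lambda>_. N))"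
  shows "(\<integral>\<^sup>+v. F v * (\<Prod>j\<in>J. \<eta> j (v j)) \<partial>PiM J (\<lambda>_. N))
    = c ^ card J * (\<integral>\<^sup>+\<xi>. F (\<lambda>j\<in>J. Y (\<xi> j)) \<partial>PiM J (\<lambda>_. W))"
  using J \<eta> eq F
proof (induction J arbitrary: F)
  case empty
  interpret N: product_sigma_finite "\<lambda>_. N"
    using N by (simp add: product_sigma_finite_def prob_space_imp_sigma_finite)
  interpret W: product_sigma_finite "\<lambda>_. W"
    using W by (simp add: product_sigma_finite_def prob_space_imp_sigma_finite)
  show ?case by (simp add: N.nn_integral_empty W.nn_integral_empty restrict_def PiM_empty nn_integral_count_space_finite)
next
  case (insert i J)
  interpret W': prob_space W by (rule W)
  interpret N: product_sigma_finite "\<lambda>_. N"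
    using N by (simp add: product_sigma_finite_def prob_space_imp_sigma_finite)
  interpret W: product_sigma_finite "\<lambda>_. W"
    using W by (simp add: product_sigma_finite_def prob_space_imp_sigma_finite)
  note [measurable] = insert.prems(3)
  have \<eta> [measurable]: "\<eta> j \<in> borel_measurable N" if "j \<in> insert i J" for j
    by (rule insert.prems(1)[OF that])
  have upd: "(\<lambda>p. F ((fst p)(i := snd p))) \<in> borel_measurable (PiM J (\<lambda>_. N) \<Otimes>\<^sub>M N)"
    by (rule measurable_compose[OF _ insert.prems(3)])
       (use measurable_add_dim[of i J "\<lambda>_. N"] in \<open>simp only: case_prod_beta'\<close>)
  have updv: "(\<lambda>a. F (v(i := a))) \<in> borel_measurable N" if "v \<in> space (PiM J (\<lambda>_. N))" for v
    using measurable_compose[OF measurable_Pair1'[OF that] upd] by simp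
  have "(\<lambda>p. F ((fst p)(i := Y (snd p)))) \<in> borel_measurable (PiM J (\<lambda>_. N) \<Otimes>\<^sub>M W)"
    using measurable_compose[OF _ upd, of "\<lambda>p. (fst p, Y (snd p))"] by simp
  from W'.borel_measurable_nn_integral_fst[OF this]
  have inner [measurable]: "(\<lambda>v. \<integral>\<^sup>+\<omega>. F (v(i := Y \<omega>)) \<partial>W) \<in> borel_measurable (PiM J (\<lambda>_. N))" by simp
  have upd': "v(i := a) \<in> space (PiM (insert i J) (\<lambda>_. N))"
    if "v \<in> space (PiM J (\<lambda>_. N))" "a \<in> space N" for v a
    using that by (auto simp: space_PiM PiE_iff extensional_def)
  have "(\<integral>\<^sup>+v. F v * (\<Prod>j\<in>insert i J. \<eta> j (v j)) \<partial>PiM (insert i J) (\<lambda>_. N))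
      = (\<integral>\<^sup>+v. (\<integral>\<^sup>+a. F (v(i := a)) * (\<Prod>j\<in>insert i J. \<eta> j ((v(i := a)) j)) \<partial>N) \<partial>PiM J (\<lambda>_. N))"
    by (rule N.product_nn_integral_insert[OF insert.hyps])
       (intro borel_measurable_times_ennreal insert.prems borel_measurable_prod_ennreal
         measurable_comp_component \<eta>)
  also have "\<dots> = (\<integral>\<^sup>+v. (c * (\<integral>\<^sup>+\<omega>. F (v(i := Y \<omega>)) \<partial>W)) * (\<Prod>j\<in>J. \<eta> j (v j)) \<partial>PiM J (\<lambda>_. N))"
  proof (rule nn_integral_cong)
    fix v assume v: "v \<in> space (PiM J (\<lambda>_. N))"
    note [measurable] = updv[OF v]
    have "(\<Prod>j\<in>insert i J. \<eta> j ((v(i := a)) j)) = \<eta> i a * (\<Prod>j\<in>J. \<eta> j (v j))" for a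
      using insert.hyps by (simp add: fun_upd_def) (auto intro!: prod.cong arg_cong2[where f="(*)"])
    then have "(\<integral>\<^sup>+a. F (v(i := a)) * (\<Prod>j\<in>insert i J. \<eta> j ((v(i := a)) j)) \<partial>N)
        = (\<integral>\<^sup>+a. (F (v(i := a)) * \<eta> i a) * (\<Prod>j\<in>J. \<eta> j (v j)) \<partial>N)"
      by (simp add: mult_ac)
    also have "\<dots> = (\<integral>\<^sup>+a. F (v(i := a)) * \<eta> i a \<partial>N) * (\<Prod>j\<in>J. \<eta> j (v j))"
      by (rule nn_integral_multc) simp
    also have "(\<integral>\<^sup>+a. F (v(i := a)) * \<eta> i a \<partial>N) = c * (\<integral>\<^sup>+\<omega>. F (v(i := Y \<omega>)) \<partial>W)"
      by (rule insert.prems(2)) simp_all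
    finally show "(\<integral>\<^sup>+a. F (v(i := a)) * (\<Prod>j\<in>insert i J. \<eta> j ((v(i := a)) j)) \<partial>N)
      = (c * (\<integral>\<^sup>+\<omega>. F (v(i := Y \<omega>)) \<partial>W)) * (\<Prod>j\<in>J. \<eta> j (v j))" .
  qed
  also have "\<dots> = c ^ card J * (\<integral>\<^sup>+\<xi>. c * (\<integral>\<^sup>+\<omega>. F ((\<lambda>j\<in>J. Y (\<xi> j))(i := Y \<omega>)) \<partial>W) \<partial>PiM J (\<lambda>_. W))"
  proof (rule insert.IH)
    show "(\<lambda>v. c * (\<integral>\<^sup>+\<omega>. F (v(i := Y \<omega>)) \<partial>W)) \<in> borel_measurable (PiM J (\<lambda>_. N))"
      using inner by simp
  qed (use insert.prems in auto)
  also have "(\<integral>\<^sup>+\<xi>. c * (\<integral>\<^sup>+\<omega>. F ((\<lambda>j\<in>J. Y (\<xi> j))(i := Y \<omega>)) \<partial>W) \<partial>PiM J (\<lambda>_. W))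
      = c * (\<integral>\<^sup>+\<xi>. (\<integral>\<^sup>+\<omega>. F ((\<lambda>j\<in>J. Y (\<xi> j))(i := Y \<omega>)) \<partial>W) \<partial>PiM J (\<lambda>_. W))"
    by (rule nn_integral_cmult, rule measurable_compose[OF measurable_restrict_map[OF Y] inner])
  also have "(\<integral>\<^sup>+\<xi>. (\<integral>\<^sup>+\<omega>. F ((\<lambda>j\<in>J. Y (\<xi> j))(i := Y \<omega>)) \<partial>W) \<partial>PiM J (\<lambda>_. W))
      = (\<integral>\<^sup>+\<xi>. (\<integral>\<^sup>+\<omega>. F (\<lambda>j\<in>insert i J. Y ((\<xi>(i := \<omega>)) j)) \<partial>W) \<partial>PiM J (\<lambda>_. W))"
    using insert.hyps by (intro nn_integral_cong arg_cong[where f=F]) (auto simp: fun_eq_iff)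
  also have "\<dots> = (\<integral>\<^sup>+\<xi>. F (\<lambda>j\<in>insert i J. Y (\<xi> j)) \<partial>PiM (insert i J) (\<lambda>_. W))"
    by (rule W.product_nn_integral_insert[OF insert.hyps, symmetric])
       (rule measurable_compose[OF measurable_restrict_map[OF Y] insert.prems(3)])
  also have "c ^ card J * (c * X) = c ^ card (insert i J) * X" for X
    using insert.hyps by (simp add: mult_ac)
  finally show ?case .
qed

text \<open>Independent variables with law \<open>B\<close>, one for each word over the natural numbers. All words are used as
  indices, so that the family above a vertex has the same type and law as the whole family.\<close>

abbreviation tree_prod :: "'s measure \<Rightarrow> (nat list \<Rightarrow> 's) measure" where
  "tree_prod B \<equiv> PiM UNIV (\<lambda>_. B)"

text \<open>The family seen from the child \<open>i\<close> of the root.\<close>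

definition subtree :: "nat \<Rightarrow> (nat list \<Rightarrow> 's) \<Rightarrow> nat list \<Rightarrow> 's" where
  "subtree i \<omega> = (\<lambda>y. \<omega> (i # y))"

text \<open>The family with given root variable and given families above the children of the root.\<close>

definition graft :: "'s \<times> (nat \<Rightarrow> nat list \<Rightarrow> 's) \<Rightarrow> nat list \<Rightarrow> 's" where
  "graft p y = (case y of [] \<Rightarrow> fst p | i # x \<Rightarrow> snd p i x)"

lemma measurable_subtree [measurable]: "subtree i \<in> tree_prod B \<rightarrow>\<^sub>M tree_prod B"
  unfolding subtree_def
  by (rule measurable_abs_UNIV) simp

lemma prob_space_tree_prod: "prob_space B \<Longrightarrow> prob_space (tree_prod B)"
  by (intro prob_space_PiM) auto

lemma measurable_graft [measurable]:
  "graft \<in> B \<Otimes>\<^sub>M PiM UNIV (\<lambda>_::nat. tree_prod B) \<rightarrow>\<^sub>M tree_prod B"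
proof -
  have "(\<lambda>p. graft p y) \<in> B \<Otimes>\<^sub>M PiM UNIV (\<lambda>_::nat. tree_prod B) \<rightarrow>\<^sub>M B" for y
  proof (cases y)
    case Nil then show ?thesis by (simp add: graft_def)
  next
    case (Cons i x)
    have "(\<lambda>\<xi>. \<xi> i x) \<in> PiM UNIV (\<lambda>_::nat. tree_prod B) \<rightarrow>\<^sub>M B"
      by (rule measurable_compose[where f="\<lambda>\<xi>. \<xi> i" and N="tree_prod B"]; rule measurable_component_singleton) simp_all
    then have "(\<lambda>p. snd p i x) \<in> B \<Otimes>\<^sub>M PiM UNIV (\<lambda>_::nat. tree_prod B) \<rightarrow>\<^sub>M B"
      by (rule measurable_compose[OF measurable_snd])
    then show ?thesis using Cons by (simp add: graft_def)
  qed
  then have "(\<lambda>p y. graft p y) \<in> B \<Otimes>\<^sub>M PiM UNIV (\<lambda>_::nat. tree_prod B) \<rightarrow>\<^sub>M PiM UNIV (\<lambda>_. B)"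
    by (rule measurable_abs_UNIV)
  then show ?thesis .
qed

text \<open>The root variable and the families above the children of the root are independent, and each of the
  latter is distributed as the whole family.\<close>

lemma distr_graft:
  assumes "prob_space B"
  shows "distr (B \<Otimes>\<^sub>M PiM UNIV (\<lambda>_::nat. tree_prod B)) (tree_prod B) graft = tree_prod B"
proof -
  interpret B: prob_space B by fact
  interpret T: product_prob_space "\<lambda>_::nat list. B" UNIV by unfold_locales
  interpret TP: prob_space "tree_prod B" by (rule prob_space_tree_prod) fact
  interpret S: product_prob_space "\<lambda>_::nat. tree_prod B" UNIV by unfold_locales
  let ?S = "PiM UNIV (\<lambda>_::nat. tree_prod B)"
  let ?D = "distr (B \<Otimes>\<^sub>M ?S) (PiM UNIV (\<lambda>_. B)) graft"
  have gm: "graft \<in> B \<Otimes>\<^sub>M ?S \<rightarrow>\<^sub>M PiM UNIV (\<lambda>_. B)"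
    by (rule measurable_graft)
  have "?D = PiM UNIV (\<lambda>_. B)"
  proof (rule T.PiM_eq)
    fix J :: "nat list set" and A
    assume J: "finite J" and A: "\<And>j. j \<in> J \<Longrightarrow> A j \<in> sets B"
    \<comment> \<open>A cylinder over the words \<open>J\<close> splits into a condition on the root and, for each first letter in \<open>H\<close>,
      a cylinder over the remaining words \<open>L i\<close>.\<close>
    define H where "H = hd ` (J - {[]})"
    define L where "L i = {x. i # x \<in> J}" for i
    define R where "R = (if [] \<in> J then A [] else space B)"
    define C where "C i = {\<omega> \<in> space (tree_prod B). \<forall>x\<in>L i. \<omega> x \<in> A (i # x)}" for i
    have finL: "finite (L i)" for i
    proof -
      have "L i \<subseteq> tl ` J" by (force simp: L_def image_iff)
      then show ?thesis using J by (meson finite_imageI finite_subset)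
    qed
    have finH: "finite H" using J by (simp add: H_def)
    have Rm: "R \<in> sets B" using A by (auto simp: R_def)
    have Cm: "C i \<in> sets (tree_prod B)" for i
    proof -
      have "C i = {\<omega> \<in> space (tree_prod B). \<forall>x\<in>L i. \<omega> x \<in> A (i # x)}" by (simp add: C_def)
      also have "\<dots> \<in> sets (tree_prod B)"
        using A finL by (intro sets.sets_Collect_finite_All) (auto simp: L_def)
      finally show ?thesis .
    qed
    have emC: "emeasure (tree_prod B) (C i) = (\<Prod>x\<in>L i. emeasure B (A (i # x)))" for i
      unfolding C_def
      by (rule T.emeasure_PiM_Collect) (use A finL in \<open>auto simp: L_def\<close>)
    let ?E = "prod_emb UNIV (\<lambda>_. B) J (\<Pi>\<^sub>E j\<in>J. A j)"
    have pre: "graft -` ?E \<inter> space (B \<Otimes>\<^sub>M ?S) = R \<times> {\<xi> \<in> space ?S. \<forall>i\<in>H. \<xi> i \<in> C i}"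
      (is "?P = ?Q")
    proof (intro set_eqI iffI)
      fix p assume p: "p \<in> ?P"
      then obtain b \<xi> where be: "p = (b, \<xi>)" "b \<in> space B" "\<xi> \<in> space ?S"
        by (auto simp: space_pair_measure)
      have 1: "graft p y \<in> A y" if "y \<in> J" for y
        using p that by (auto simp: prod_emb_def PiE_iff)
      have "b \<in> R" using 1[of "[]"] be by (auto simp: R_def graft_def)
      moreover have "\<xi> i \<in> C i" for i
        using be 1[of "i # _"] by (auto simp: C_def L_def graft_def space_PiM)
      ultimately show "p \<in> ?Q" using be by auto
    next
      fix p assume "p \<in> ?Q"
      then obtain b \<xi> where be: "p = (b, \<xi>)" "b \<in> R" "\<xi> \<in> space ?S" "\<And>i. i \<in> H \<Longrightarrow> \<xi> i \<in> C i"
        by auto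
      have b: "b \<in> space B" using be(2) Rm sets.sets_into_space by blast
      have p: "p \<in> space (B \<Otimes>\<^sub>M ?S)" using be b by (simp add: space_pair_measure)
      have "graft p \<in> space (PiM UNIV (\<lambda>_. B))"
        by (rule measurable_space[OF gm p])
      moreover have "graft p y \<in> A y" if y: "y \<in> J" for y
      proof (cases y)
        case Nil
        then show ?thesis using be y by (auto simp: R_def graft_def)
      next
        case (Cons i x)
        then have "i \<in> H" using y by (force simp: H_def)
        then show ?thesis using be(4)[of i] be(1) Cons y by (auto simp: graft_def C_def L_def)
      qed
      ultimately show "p \<in> ?P" using p
        by (auto simp: prod_emb_def PiE_iff space_PiM)
    qed
    have "emeasure ?D ?E = emeasure (B \<Otimes>\<^sub>M ?S) (R \<times> {\<xi> \<in> space ?S. \<forall>i\<in>H. \<xi> i \<in> C i})"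
      unfolding pre[symmetric] by (rule emeasure_distr[OF gm]) (use J A in \<open>auto intro!: sets_PiM_I\<close>)
    also have "\<dots> = emeasure B R * emeasure ?S {\<xi> \<in> space ?S. \<forall>i\<in>H. \<xi> i \<in> C i}"
    proof (rule S.P.emeasure_pair_measure_Times[OF Rm])
      show "{\<xi> \<in> space ?S. \<forall>i\<in>H. \<xi> i \<in> C i} \<in> sets ?S"
      proof (rule sets.sets_Collect_finite_All[OF _ finH])
        fix i
        have "(\<lambda>\<xi>. \<xi> i) -` C i \<inter> space ?S \<in> sets ?S"
          by (rule measurable_sets[OF _ Cm], rule measurable_component_singleton) simp
        also have "(\<lambda>\<xi>. \<xi> i) -` C i \<inter> space ?S = {\<xi> \<in> space ?S. \<xi> i \<in> C i}" by blast
        finally show "{\<xi> \<in> space ?S. \<xi> i \<in> C i} \<in> sets ?S" .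
      qed
    qed
    also have "emeasure ?S {\<xi> \<in> space ?S. \<forall>i\<in>H. \<xi> i \<in> C i} = (\<Prod>i\<in>H. emeasure (tree_prod B) (C i))"
      by (rule S.emeasure_PiM_Collect[OF subset_UNIV finH Cm])
    also have "\<dots> = (\<Prod>(i, x)\<in>Sigma H L. emeasure B (A (i # x)))"
      unfolding emC using finH finL by (subst prod.Sigma) auto
    also have "\<dots> = (\<Prod>y\<in>J - {[]}. emeasure B (A y))"
    proof (rule prod.reindex_bij_witness[where i="\<lambda>y. (hd y, tl y)" and j="\<lambda>(i, x). i # x"])
      fix y assume "y \<in> J - {[]}"
      then show "(hd y, tl y) \<in> Sigma H L" by (auto simp: H_def L_def)
    qed (auto simp: H_def L_def)
    also have "emeasure B R * (\<Prod>y\<in>J - {[]}. emeasure B (A y)) = (\<Prod>y\<in>J. emeasure B (A y))"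
    proof (cases "[] \<in> J")
      case True
      then show ?thesis using J by (simp add: R_def prod.remove)
    next
      case False
      then show ?thesis by (simp add: R_def B.emeasure_space_1)
    qed
    finally show "emeasure ?D ?E = (\<Prod>j\<in>J. emeasure B (A j))" .
  qed simp
  then show ?thesis .
qed

lemma nn_integral_tree_prod:
  assumes B: "prob_space B"
    and F [measurable]: "F \<in> borel_measurable (B \<Otimes>\<^sub>M PiM {..<k} (\<lambda>_. tree_prod B))"
  shows "(\<integral>\<^sup>+\<omega>. F (\<omega> [], \<lambda>i\<in>{..<k}. subtree i \<omega>) \<partial>tree_prod B)
    = (\<integral>\<^sup>+b. (\<integral>\<^sup>+\<xi>. F (b, \<xi>) \<partial>PiM {..<k} (\<lambda>_. tree_prod B)) \<partial>B)"
proof -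
  interpret B: prob_space B by fact
  interpret TP: prob_space "tree_prod B" by (rule prob_space_tree_prod) fact
  interpret S: product_prob_space "\<lambda>_::nat. tree_prod B" UNIV by unfold_locales
  let ?S = "PiM UNIV (\<lambda>_::nat. tree_prod B)"
  have restr [measurable]: "(\<lambda>\<xi>. restrict \<xi> {..<k}) \<in> ?S \<rightarrow>\<^sub>M PiM {..<k} (\<lambda>_. tree_prod B)"
    by (rule measurable_restrict_subset) simp
  have [measurable]: "(\<lambda>\<omega>. \<lambda>i\<in>{..<k}. subtree i \<omega>) \<in> tree_prod B \<rightarrow>\<^sub>M PiM {..<k} (\<lambda>_. tree_prod B)"
    by (intro measurable_restrict measurable_subtree)
  have "(\<integral>\<^sup>+\<omega>. F (\<omega> [], \<lambda>i\<in>{..<k}. subtree i \<omega>) \<partial>tree_prod B)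
      = (\<integral>\<^sup>+\<omega>. F (\<omega> [], \<lambda>i\<in>{..<k}. subtree i \<omega>) \<partial>distr (B \<Otimes>\<^sub>M ?S) (tree_prod B) graft)"
    by (simp only: distr_graft[OF B])
  also have "\<dots> = (\<integral>\<^sup>+p. F (graft p [], \<lambda>i\<in>{..<k}. subtree i (graft p)) \<partial>(B \<Otimes>\<^sub>M ?S))"
    by (subst nn_integral_distr) measurable
  also have "\<dots> = (\<integral>\<^sup>+p. F (fst p, restrict (snd p) {..<k}) \<partial>(B \<Otimes>\<^sub>M ?S))"
    by (simp add: graft_def subtree_def)
  also have "\<dots> = (\<integral>\<^sup>+b. (\<integral>\<^sup>+\<xi>. F (b, restrict \<xi> {..<k}) \<partial>?S) \<partial>B)"
    by (subst S.P.nn_integral_fst[symmetric]) simp_all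
  also have "\<dots> = (\<integral>\<^sup>+b. (\<integral>\<^sup>+\<xi>. F (b, \<xi>) \<partial>distr ?S (PiM {..<k} (\<lambda>_. tree_prod B)) (\<lambda>\<xi>. restrict \<xi> {..<k})) \<partial>B)"
    by (intro nn_integral_cong, subst nn_integral_distr) (simp_all add: restr)
  also have "distr ?S (PiM {..<k} (\<lambda>_. tree_prod B)) (\<lambda>\<xi>. restrict \<xi> {..<k}) = PiM {..<k} (\<lambda>_. tree_prod B)"
    by (rule S.distr_PiM_restrict_finite) auto
  finally show ?thesis .
qed

lemma nn_integral_root_subtree:
  assumes B: "prob_space B"
    and F [measurable]: "F \<in> borel_measurable (B \<Otimes>\<^sub>M tree_prod B)"
  shows "(\<integral>\<^sup>+\<omega>. F (\<omega> [], subtree 0 \<omega>) \<partial>tree_prod B) = (\<integral>\<^sup>+b. (\<integral>\<^sup>+\<omega>. F (b, \<omega>) \<partial>tree_prod B) \<partial>B)"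
proof -
  interpret B: prob_space B by fact
  interpret TP: prob_space "tree_prod B" by (rule prob_space_tree_prod) fact
  interpret S: product_prob_space "\<lambda>_::nat. tree_prod B" "{..<Suc 0}" by unfold_locales
  have "(\<integral>\<^sup>+\<omega>. F (\<omega> [], subtree 0 \<omega>) \<partial>tree_prod B)
      = (\<integral>\<^sup>+\<omega>. (\<lambda>(b, \<xi>). F (b, \<xi> 0)) (\<omega> [], \<lambda>i\<in>{..<Suc 0}. subtree i \<omega>) \<partial>tree_prod B)"
    by simp
  also have "\<dots> = (\<integral>\<^sup>+b. (\<integral>\<^sup>+\<xi>. F (b, \<xi> 0) \<partial>PiM {..<Suc 0} (\<lambda>_. tree_prod B)) \<partial>B)"
    by (subst nn_integral_tree_prod[OF B]) auto
  also have "\<dots> = (\<integral>\<^sup>+b. (\<integral>\<^sup>+\<omega>. F (b, \<omega>) \<partial>distr (PiM {..<Suc 0} (\<lambda>_. tree_prod B)) (tree_prod B) (\<lambda>\<xi>. \<xi> 0)) \<partial>B)"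
    by (intro nn_integral_cong, subst nn_integral_distr) auto
  also have "distr (PiM {..<Suc 0} (\<lambda>_. tree_prod B)) (tree_prod B) (\<lambda>\<xi>. \<xi> 0) = tree_prod B"
    by (rule S.PiM_component) simp
  finally show ?thesis .
qed

lemma nn_integral_subtrees:
  assumes B: "prob_space B"
    and F: "F \<in> borel_measurable (PiM {..<k} (\<lambda>_. tree_prod B))"
  shows "(\<integral>\<^sup>+\<omega>. F (\<lambda>i\<in>{..<k}. subtree i \<omega>) \<partial>tree_prod B) = (\<integral>\<^sup>+\<xi>. F \<xi> \<partial>PiM {..<k} (\<lambda>_. tree_prod B))"
proof -
  have "(\<lambda>p. F (snd p)) \<in> borel_measurable (B \<Otimes>\<^sub>M PiM {..<k} (\<lambda>_. tree_prod B))"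
    by (rule measurable_compose[OF measurable_snd F])
  from nn_integral_tree_prod[OF B this] show ?thesis
    by (simp add: prob_space.emeasure_space_1[OF B])
qed

section \<open>Decomposing a random vector at its minimum\<close>

text \<open>The auxiliary randomness from which the gaps are sampled.\<close>

abbreviation seeds :: "(nat list \<Rightarrow> real) measure" where
  "seeds \<equiv> tree_prod unif"

lemma seeds_component: "\<omega> \<in> space seeds \<Longrightarrow> \<omega> y \<in> space unif"
  by (auto simp: space_PiM PiE_iff)

lemma subtree_seeds: "\<omega> \<in> space seeds \<Longrightarrow> subtree i \<omega> \<in> space seeds"
  by (rule measurable_space[OF measurable_subtree])

interpretation seeds: prob_space seeds
  by (rule prob_space_tree_prod[OF prob_space_unif])

interpretation unif: prob_space unif
  by (rule prob_space_unif)

abbreviation vectors :: "'i set \<Rightarrow> ('i \<Rightarrow> real) measure" where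
  "vectors I \<equiv> PiM I (\<lambda>_. borel)"

text \<open>The vectors all of whose coordinates, hence whose minimum, exceed \<open>r\<close>.\<close>

abbreviation above :: "'i set \<Rightarrow> real \<Rightarrow> ('i \<Rightarrow> real) set" where
  "above I r \<equiv> {v \<in> space (vectors I). \<forall>x\<in>I. r < v x}"

text \<open>A random vector with law \<open>N\<close>, decomposed at its minimum: the position \<open>z\<close> and the value \<open>w\<close> of the minimum
  have the law of the counting measure on \<open>I\<close> times \<open>\<nu>\<close> (so \<open>\<nu>\<close> has mass \<open>1 / card I\<close>), and given \<open>z\<close>
  and \<open>w\<close> the gaps are sampled as \<open>\<Phi> z w \<omega>\<close>, nondecreasing in \<open>w\<close>. Since the gaps away from
  \<open>z\<close> are strictly negative, ties at the minimum have probability zero. Values of \<open>\<Phi> z w\<close> for \<open>w \<le> 0\<close> do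
  not affect the law, but they are required to be monotone as well.\<close>

locale min_decomposition = finite_halfline_measure \<nu>
  for \<nu> :: "real measure" +
  fixes I :: "nat list set" and N :: "(nat list \<Rightarrow> real) measure"
    and \<Phi> :: "nat list \<Rightarrow> real \<Rightarrow> (nat list \<Rightarrow> real) \<Rightarrow> nat list \<Rightarrow> real"
  assumes finite_I: "finite I" and I_nonempty: "I \<noteq> {}"
    and sets_N [measurable_cong]: "sets N = sets (vectors I)"
    and prob_N: "prob_space N"
    and measurable_\<Phi>: "\<And>z x. z \<in> I \<Longrightarrow> x \<in> I \<Longrightarrow>
      (\<lambda>(w, \<omega>). \<Phi> z w \<omega> x) \<in> borel_measurable (borel \<Otimes>\<^sub>M seeds)"
    and \<Phi>_mono: "\<And>z x \<omega> s t. z \<in> I \<Longrightarrow> x \<in> I \<Longrightarrow> \<omega> \<in> space seeds \<Longrightarrow> s \<le> t \<Longrightarrow> \<Phi> z s \<omega> x \<le> \<Phi> z t \<omega> x"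
    and \<Phi>_self: "\<And>z w \<omega>. z \<in> I \<Longrightarrow> \<omega> \<in> space seeds \<Longrightarrow> \<Phi> z w \<omega> z = 0"
    and \<Phi>_neg: "\<And>z x w \<omega>. z \<in> I \<Longrightarrow> x \<in> I \<Longrightarrow> x \<noteq> z \<Longrightarrow> \<omega> \<in> space seeds \<Longrightarrow> \<Phi> z w \<omega> x < 0"
    and nn_integral_N: "\<And>g. g \<in> borel_measurable (vectors I) \<Longrightarrow>
      (\<integral>\<^sup>+v. g v \<partial>N) = (\<Sum>z\<in>I. \<integral>\<^sup>+w. (\<integral>\<^sup>+\<omega>. g (\<lambda>x\<in>I. w - \<Phi> z w \<omega> x) \<partial>seeds) \<partial>\<nu>)"
begin

text \<open>The vector with minimum \<open>w\<close> at \<open>z\<close> and gaps \<open>\<Phi> z w \<omega>\<close>.\<close>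

definition recon :: "nat list \<Rightarrow> real \<Rightarrow> (nat list \<Rightarrow> real) \<Rightarrow> nat list \<Rightarrow> real" where
  "recon z w \<omega> = (\<lambda>x\<in>I. w - \<Phi> z w \<omega> x)"

lemma \<Phi>_nonpos: "z \<in> I \<Longrightarrow> x \<in> I \<Longrightarrow> \<omega> \<in> space seeds \<Longrightarrow> \<Phi> z w \<omega> x \<le> 0"
  using \<Phi>_self[of z \<omega> w] \<Phi>_neg[of z x \<omega> w] by (cases "x = z") auto

lemma measurable_recon [measurable]:
  assumes "z \<in> I"
  shows "(\<lambda>p. recon z (fst p) (snd p)) \<in> borel \<Otimes>\<^sub>M seeds \<rightarrow>\<^sub>M vectors I"
  unfolding recon_def
proof (rule measurable_restrict)
  fix x assume "x \<in> I"
  from measurable_\<Phi>[OF assms this]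
  show "(\<lambda>p. fst p - \<Phi> z (fst p) (snd p) x) \<in> borel_measurable (borel \<Otimes>\<^sub>M seeds)"
    by (simp add: case_prod_beta')
qed

lemma measurable_recon2:
  assumes "z \<in> I" "f \<in> borel_measurable M" "h \<in> M \<rightarrow>\<^sub>M seeds"
  shows "(\<lambda>x. recon z (f x) (h x)) \<in> M \<rightarrow>\<^sub>M vectors I"
  using measurable_compose[OF measurable_Pair[OF assms(2,3)] measurable_recon[OF assms(1)]] by simp

lemma nn_integral_recon:
  "g \<in> borel_measurable (vectors I) \<Longrightarrow>
    (\<integral>\<^sup>+v. g v \<partial>N) = (\<Sum>z\<in>I. \<integral>\<^sup>+w. (\<integral>\<^sup>+\<omega>. g (recon z w \<omega>) \<partial>seeds) \<partial>\<nu>)"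
  using nn_integral_N by (simp add: recon_def)

lemma recon_greater_iff:
  assumes "z \<in> I" "\<omega> \<in> space seeds"
  shows "(\<forall>x\<in>I. r < recon z w \<omega> x) \<longleftrightarrow> r < w"
proof
  assume "\<forall>x\<in>I. r < recon z w \<omega> x"
  then have "r < recon z w \<omega> z" using assms by blast
  then show "r < w" using assms \<Phi>_self by (simp add: recon_def)
next
  assume "r < w"
  then show "\<forall>x\<in>I. r < recon z w \<omega> x"
    using \<Phi>_nonpos[OF assms(1) _ assms(2), of _ w] by (force simp: recon_def)
qed

lemma recon_ge_iff:
  assumes "z \<in> I" "\<omega> \<in> space seeds"
  shows "(\<forall>x\<in>I. r \<le> recon z w \<omega> x) \<longleftrightarrow> r \<le> w"
proof
  assume "\<forall>x\<in>I. r \<le> recon z w \<omega> x"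
  then have "r \<le> recon z w \<omega> z" using assms by blast
  then show "r \<le> w" using assms \<Phi>_self by (simp add: recon_def)
next
  assume "r \<le> w"
  then show "\<forall>x\<in>I. r \<le> recon z w \<omega> x"
    using \<Phi>_nonpos[OF assms(1) _ assms(2), of _ w] by (force simp: recon_def)
qed

lemma sets_min_greater [measurable]: "above I r \<in> sets (vectors I)"
  using finite_I by (intro sets.sets_Collect_finite_All) auto

lemma sets_min_ge [measurable]: "{v \<in> space (vectors I). \<forall>x\<in>I. r \<le> v x} \<in> sets (vectors I)"
  using finite_I by (intro sets.sets_Collect_finite_All) auto

lemma recon_space: "z \<in> I \<Longrightarrow> recon z w \<omega> \<in> space (vectors I)"
  by (simp add: recon_def space_PiM)

lemma measurable_inner [measurable]:
  assumes "z \<in> I" and [measurable]: "g \<in> borel_measurable (vectors I)"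
  shows "(\<lambda>w. \<integral>\<^sup>+\<omega>. g (recon z w \<omega>) \<partial>seeds) \<in> borel_measurable borel"
proof -
  have "(\<lambda>p. g (recon z (fst p) (snd p))) \<in> borel_measurable (borel \<Otimes>\<^sub>M seeds)"
    using measurable_recon[OF assms(1)] by measurable
  from seeds.borel_measurable_nn_integral_fst[OF this] show ?thesis by simp
qed

lemma nn_integral_min_greater:
  assumes g [measurable]: "g \<in> borel_measurable (vectors I)"
  shows "(\<integral>\<^sup>+v. g v * indicator (above I r) v \<partial>N)
    = emeasure \<nu> {r<..} * (\<Sum>z\<in>I. \<integral>\<^sup>+u. (\<integral>\<^sup>+\<omega>. g (recon z (tail_quantile r u) \<omega>) \<partial>seeds) \<partial>unif)"
proof -
  have "(\<integral>\<^sup>+v. g v * indicator (above I r) v \<partial>N)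
      = (\<Sum>z\<in>I. \<integral>\<^sup>+w. (\<integral>\<^sup>+\<omega>. g (recon z w \<omega>) *
          indicator (above I r) (recon z w \<omega>) \<partial>seeds) \<partial>\<nu>)"
    by (subst nn_integral_recon) auto
  also have "\<dots> = (\<Sum>z\<in>I. \<integral>\<^sup>+w. (\<integral>\<^sup>+\<omega>. g (recon z w \<omega>) \<partial>seeds) * indicator {r<..} w \<partial>\<nu>)"
  proof (intro sum.cong nn_integral_cong refl)
    fix z w assume z: "z \<in> I"
    have [measurable]: "(\<lambda>\<omega>. recon z w \<omega>) \<in> seeds \<rightarrow>\<^sub>M vectors I"
      using z by (intro measurable_recon2) auto
    have "(\<integral>\<^sup>+\<omega>. g (recon z w \<omega>) * indicator (above I r) (recon z w \<omega>) \<partial>seeds)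
        = (\<integral>\<^sup>+\<omega>. g (recon z w \<omega>) * indicator {r<..} w \<partial>seeds)"
      using recon_greater_iff[OF z, of _ r w] recon_space[OF z]
      by (intro nn_integral_cong) (simp add: indicator_def)
    then show "(\<integral>\<^sup>+\<omega>. g (recon z w \<omega>) * indicator (above I r) (recon z w \<omega>) \<partial>seeds)
        = (\<integral>\<^sup>+\<omega>. g (recon z w \<omega>) \<partial>seeds) * indicator {r<..} w"
      by (simp add: nn_integral_multc)
  qed
  also have "\<dots> = (\<Sum>z\<in>I. emeasure \<nu> {r<..} * (\<integral>\<^sup>+u. (\<integral>\<^sup>+\<omega>. g (recon z (tail_quantile r u) \<omega>) \<partial>seeds) \<partial>unif))"
    by (intro sum.cong refl nn_integral_tail_quantile measurable_inner g)
  finally show ?thesis by (simp add: sum_distrib_left)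
qed

lemma emeasure_min_greater:
  "emeasure N (above I r) = of_nat (card I) * emeasure \<nu> {r<..}"
proof -
  have "emeasure N (above I r)
      = (\<integral>\<^sup>+v. 1 * indicator (above I r) v \<partial>N)"
    by simp
  also have "\<dots> = emeasure \<nu> {r<..} * of_nat (card I)"
    by (subst nn_integral_min_greater) (simp_all add: seeds.emeasure_space_1 unif.emeasure_space_1)
  finally show ?thesis by (simp add: mult.commute)
qed

lemma emeasure_total: "of_nat (card I) * emeasure \<nu> UNIV = 1"
proof -
  interpret prob_space N by (rule prob_N)
  have "1 = (\<integral>\<^sup>+v. 1 \<partial>N)" by (simp add: emeasure_space_1)
  also have "\<dots> = of_nat (card I) * emeasure \<nu> UNIV"
    by (subst nn_integral_recon) (simp_all add: seeds.emeasure_space_1)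
  finally show ?thesis by simp
qed

lemma N_min_atomless: "AE v in N. (\<forall>x\<in>I. r \<le> v x) \<longrightarrow> (\<forall>x\<in>I. r < v x)"
proof -
  let ?A = "{v \<in> space (vectors I). \<forall>x\<in>I. r \<le> v x} - above I r"
  have "emeasure N ?A = (\<integral>\<^sup>+v. indicator ?A v \<partial>N)" by (subst nn_integral_indicator) auto
  also have "\<dots> = (\<Sum>z\<in>I. \<integral>\<^sup>+w. (\<integral>\<^sup>+\<omega>. indicator ?A (recon z w \<omega>) \<partial>seeds) \<partial>\<nu>)"
    by (rule nn_integral_recon) auto
  also have "\<dots> = (\<Sum>z\<in>I. \<integral>\<^sup>+w. (\<integral>\<^sup>+\<omega>. indicator {r} w \<partial>seeds) \<partial>\<nu>)"
  proof (intro sum.cong nn_integral_cong refl)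
    fix z w \<omega> assume z: "z \<in> I" and \<omega>: "\<omega> \<in> space seeds"
    show "indicator ?A (recon z w \<omega>) = indicator {r} w"
      using recon_greater_iff[OF z \<omega>, of r w] recon_ge_iff[OF z \<omega>, of r w] recon_space[OF z, of w \<omega>]
      by (auto simp: indicator_def)
  qed
  also have "\<dots> = 0" by (simp add: seeds.emeasure_space_1 atomless)
  finally have "?A \<in> null_sets N" by (auto simp: sets_N)
  then show ?thesis
    by (rule AE_I') (auto simp: sets_eq_imp_space_eq[OF sets_N] Ball_def)
qed

end

locale log_concave_min_decomposition = min_decomposition +
  assumes tail_log_concave: "log_concave (\<lambda>r. emeasure \<nu> {r<..})"
begin

text \<open>Given that all coordinates exceed \<open>r\<close>, the vector is distributed as \<open>r - \<tau> r \<omega>\<close> with \<open>\<tau>\<close> nondecreasing in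
  \<open>r\<close>. The seed at the root samples the minimum, a second one the position of the minimum,
  and the remaining ones the gaps.\<close>

lemma thinning:
  obtains \<tau> :: "real \<Rightarrow> (nat list \<Rightarrow> real) \<Rightarrow> nat list \<Rightarrow> real" where
    "\<And>x. x \<in> I \<Longrightarrow> (\<lambda>(r, \<omega>). \<tau> r \<omega> x) \<in> borel_measurable (borel \<Otimes>\<^sub>M seeds)"
    "\<And>x \<omega> r r'. x \<in> I \<Longrightarrow> \<omega> \<in> space seeds \<Longrightarrow> r \<le> r' \<Longrightarrow> \<tau> r \<omega> x \<le> \<tau> r' \<omega> x"
    "\<And>x \<omega> r. x \<in> I \<Longrightarrow> \<omega> \<in> space seeds \<Longrightarrow> \<tau> r \<omega> x < 0"
    "\<And>g r. g \<in> borel_measurable (vectors I) \<Longrightarrow>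
      (\<integral>\<^sup>+v. g v * indicator (above I r) v \<partial>N)
        = of_nat (card I) * emeasure \<nu> {r<..} * (\<integral>\<^sup>+\<omega>. g (\<lambda>x\<in>I. r - \<tau> r \<omega> x) \<partial>seeds)"
proof -
  obtain Z where Z: "\<And>u. u \<in> space unif \<Longrightarrow> Z u \<in> I" "Z \<in> unif \<rightarrow>\<^sub>M count_space I"
    "\<And>f :: nat list \<Rightarrow> ennreal. of_nat (card I) * (\<integral>\<^sup>+u. f (Z u) \<partial>unif) = (\<Sum>z\<in>I. f z)"
    using uniform_choice[OF finite_I I_nonempty] by metis
  define \<tau> where "\<tau> r \<omega> x = r - tail_quantile r (\<omega> [])
    + \<Phi> (Z (subtree 0 \<omega> [])) (tail_quantile r (\<omega> [])) (subtree 0 (subtree 0 \<omega>)) x" for r \<omega> x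
  note [measurable] = Z(2)
  have \<tau>_eq: "(\<lambda>x\<in>I. r - \<tau> r \<omega> x)
      = recon (Z (subtree 0 \<omega> [])) (tail_quantile r (\<omega> [])) (subtree 0 (subtree 0 \<omega>))" for r \<omega>
    by (simp add: \<tau>_def recon_def)
  have recon_Z: "(\<lambda>p. recon (Z (f p)) (h p) (k p)) \<in> M \<rightarrow>\<^sub>M vectors I"
    if "f \<in> M \<rightarrow>\<^sub>M unif" "h \<in> borel_measurable M" "k \<in> M \<rightarrow>\<^sub>M seeds" for f h k and M :: "'b measure"
  proof (rule measurable_compose_countable'[where f="\<lambda>z p. recon z (h p) (k p)" and g="\<lambda>p. Z (f p)" and I=I])
    show "(\<lambda>p. Z (f p)) \<in> M \<rightarrow>\<^sub>M count_space I" using that Z(2) by measurable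
    show "countable I" using finite_I by (rule countable_finite)
  qed (intro measurable_recon2 that)
  have R: "(\<lambda>p. tail_quantile (fst p) (snd p [])) \<in> borel_measurable (borel \<Otimes>\<^sub>M seeds)"
    using measurable_compose[OF measurable_Pair[OF measurable_fst measurable_compose[OF measurable_snd
        measurable_component_singleton[of "[]" UNIV "\<lambda>_. unif"]]] measurable_tail_quantile] by simp
  show thesis
  proof (rule that[of \<tau>])
    fix x assume x: "x \<in> I"
    have "(\<lambda>p. fst p - recon (Z (subtree 0 (snd p) [])) (tail_quantile (fst p) (snd p [])) (subtree 0 (subtree 0 (snd p))) x)
        \<in> borel_measurable (borel \<Otimes>\<^sub>M seeds)"
      using x by (intro borel_measurable_diff measurable_fst
          measurable_compose[OF recon_Z measurable_component_singleton] R) measurable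
    also have "(\<lambda>p. fst p - recon (Z (subtree 0 (snd p) [])) (tail_quantile (fst p) (snd p [])) (subtree 0 (subtree 0 (snd p))) x)
        = (\<lambda>(r, \<omega>). \<tau> r \<omega> x)"
      using x by (auto simp: fun_eq_iff \<tau>_def recon_def)
    finally show "(\<lambda>(r, \<omega>). \<tau> r \<omega> x) \<in> borel_measurable (borel \<Otimes>\<^sub>M seeds)" .
  next
    fix x \<omega> and r r' :: real assume x: "x \<in> I" and \<omega>: "\<omega> \<in> space seeds" and r: "r \<le> r'"
    have u: "\<omega> [] \<in> space unif" and z: "Z (subtree 0 \<omega> []) \<in> I"
      and \<omega>': "subtree 0 (subtree 0 \<omega>) \<in> space seeds"
      using \<omega> by (auto intro!: Z(1) seeds_component subtree_seeds)
    \<comment> \<open>The excess of the minimum over \<open>r\<close> decreases, and the gaps below the minimum increase with it.\<close>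
    show "\<tau> r \<omega> x \<le> \<tau> r' \<omega> x"
      using tail_quantile_excess_antimono[OF tail_log_concave u r]
        \<Phi>_mono[OF z x \<omega>' tail_quantile_mono[OF u r]] by (simp add: \<tau>_def)
  next
    fix x \<omega> r assume x: "x \<in> I" and \<omega>: "\<omega> \<in> space seeds"
    have u: "\<omega> [] \<in> space unif" and z: "Z (subtree 0 \<omega> []) \<in> I"
      and \<omega>': "subtree 0 (subtree 0 \<omega>) \<in> space seeds"
      using \<omega> by (auto intro!: Z(1) seeds_component subtree_seeds)
    show "\<tau> r \<omega> x < 0"
      using tail_quantile_greater[OF u, of r] \<Phi>_nonpos[OF z x \<omega>', of "tail_quantile r (\<omega> [])"]
      by (simp add: \<tau>_def)
  next
    fix g :: "(nat list \<Rightarrow> real) \<Rightarrow> ennreal" and r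
    assume g [measurable]: "g \<in> borel_measurable (vectors I)"
    have Rr [measurable]: "tail_quantile r \<in> borel_measurable unif"
      using measurable_compose_Pair1[OF _ measurable_tail_quantile, of r] by simp
    define H where "H z u = (\<integral>\<^sup>+\<omega>. g (recon z (tail_quantile r u) \<omega>) \<partial>seeds)" for z u
    have H [measurable]: "z \<in> I \<Longrightarrow> H z \<in> borel_measurable unif" for z
      unfolding H_def by (rule measurable_compose[OF Rr measurable_inner]) auto
    have 1: "(\<lambda>p. g (recon (Z (snd p [])) (tail_quantile r (fst p)) (subtree 0 (snd p)))) \<in> borel_measurable (unif \<Otimes>\<^sub>M seeds)"
      by (rule measurable_compose[OF recon_Z g]) measurable
    have 2: "(\<lambda>p. g (recon (Z (fst p)) w (snd p))) \<in> borel_measurable (unif \<Otimes>\<^sub>M seeds)" for w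
      by (rule measurable_compose[OF recon_Z g]) measurable
    have Z3: "of_nat (card I) * (\<integral>\<^sup>+u'. H (Z u') u \<partial>unif) = (\<Sum>z\<in>I. H z u)" for u
      by (rule Z(3))
    have "(\<integral>\<^sup>+\<omega>. g (\<lambda>x\<in>I. r - \<tau> r \<omega> x) \<partial>seeds)
        = (\<integral>\<^sup>+u. (\<integral>\<^sup>+\<omega>. g (recon (Z (\<omega> [])) (tail_quantile r u) (subtree 0 \<omega>)) \<partial>seeds) \<partial>unif)"
      unfolding \<tau>_eq using nn_integral_root_subtree[OF prob_space_unif 1] by simp
    also have "\<dots> = (\<integral>\<^sup>+u. (\<integral>\<^sup>+u'. H (Z u') u \<partial>unif) \<partial>unif)"
      unfolding H_def using nn_integral_root_subtree[OF prob_space_unif 2] by simp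
    finally have "of_nat (card I) * (\<integral>\<^sup>+\<omega>. g (\<lambda>x\<in>I. r - \<tau> r \<omega> x) \<partial>seeds)
        = (\<integral>\<^sup>+u. of_nat (card I) * (\<integral>\<^sup>+u'. H (Z u') u \<partial>unif) \<partial>unif)"
    proof (simp only:, intro nn_integral_cmult[symmetric])
      have "(\<lambda>u. \<Sum>z\<in>I. H z u) \<in> borel_measurable unif" by measurable
      then have *: "(\<lambda>u. of_nat (card I) * (\<integral>\<^sup>+u'. H (Z u') u \<partial>unif)) \<in> borel_measurable unif"
        unfolding Z3 .
      have c: "(of_nat (card I) :: ennreal) \<noteq> 0" "(of_nat (card I) :: ennreal) \<noteq> top"
        using finite_I I_nonempty by auto
      have "(\<lambda>u. \<integral>\<^sup>+u'. H (Z u') u \<partial>unif)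
          = (\<lambda>u. of_nat (card I) * (\<integral>\<^sup>+u'. H (Z u') u \<partial>unif) / of_nat (card I))"
        by (simp only: mult.commute[of "of_nat (card I)"] ennreal_mult_divide_eq[OF c])
      then show "(\<lambda>u. \<integral>\<^sup>+u'. H (Z u') u \<partial>unif) \<in> borel_measurable unif"
        using * by simp
    qed
    also have "\<dots> = (\<Sum>z\<in>I. \<integral>\<^sup>+u. H z u \<partial>unif)"
      unfolding Z3 by (rule nn_integral_sum) measurable
    finally show "(\<integral>\<^sup>+v. g v * indicator (above I r) v \<partial>N)
        = of_nat (card I) * emeasure \<nu> {r<..} * (\<integral>\<^sup>+\<omega>. g (\<lambda>x\<in>I. r - \<tau> r \<omega> x) \<partial>seeds)"
      unfolding nn_integral_min_greater[OF g] H_def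
        mult.commute[of "of_nat (card I)" "emeasure \<nu> {r<..}"] mult.assoc by simp
  qed
qed

end

section \<open>Independent copies side by side\<close>

text \<open>Breaking ties in favour of the smallest index makes the index of the minimum unique.\<close>

lemma first_minimum_unique:
  fixes f :: "nat \<Rightarrow> real"
  assumes "0 < d"
  shows "\<exists>!i. i < d \<and> (\<forall>j<d. j \<noteq> i \<longrightarrow> (if j < i then f i < f j else f i \<le> f j))"
proof -
  have "\<exists>k<d. \<forall>j<d. f k \<le> f j"
    using assms ex_min_if_finite[of "f ` {..<d}"] by (fastforce simp: not_less)
  then obtain k where k: "k < d" "\<forall>j<d. f k \<le> f j" by blast
  define i where "i = (LEAST i. i < d \<and> f i = f k)"
  have i: "i < d \<and> f i = f k" unfolding i_def by (rule LeastI[where k=k]) (use k in simp)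
  have least: "f i < f j" if "j < i" for j
    using not_less_Least[of j "\<lambda>i. i < d \<and> f i = f k"] that i k unfolding i_def[symmetric]
    by (metis less_trans order_le_less)
  show ?thesis
  proof (rule ex1I[of _ i])
    show "i < d \<and> (\<forall>j<d. j \<noteq> i \<longrightarrow> (if j < i then f i < f j else f i \<le> f j))"
      using i k least by auto
  next
    fix i' assume i': "i' < d \<and> (\<forall>j<d. j \<noteq> i' \<longrightarrow> (if j < i' then f i' < f j else f i' \<le> f j))"
    show "i' = i"
    proof (rule ccontr)
      assume "i' \<noteq> i"
      then consider "i < i'" | "i' < i" by linarith
      then show False
      proof cases
        case 1
        then have "f i' < f i" using i'[THEN conjunct2, rule_format, of i] i by simp
        moreover have "f k \<le> f i'" using i' k by blast
        ultimately show False using i by simp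
      next
        case 2
        then have "f i < f i'" by (rule least)
        moreover have "f i' \<le> f i" using i' i 2 by auto
        ultimately show False by simp
      qed
    qed
  qed
qed

text \<open>Indices for \<open>d\<close> vectors over \<open>I\<close> put side by side: the letter in front names the vector.\<close>

definition join_index :: "nat \<Rightarrow> nat list set \<Rightarrow> nat list set" where
  "join_index d I = {i # x | i x. i < d \<and> x \<in> I}"

text \<open>The vectors \<open>v 0\<close>, ..., \<open>v (d - 1)\<close> over \<open>I\<close> as one vector.\<close>

definition join_vec :: "nat \<Rightarrow> nat list set \<Rightarrow> (nat \<Rightarrow> nat list \<Rightarrow> real) \<Rightarrow> nat list \<Rightarrow> real" where
  "join_vec d I v = (\<lambda>y\<in>join_index d I. v (hd y) (tl y))"

text \<open>The law of \<open>d\<close> independent vectors with law \<open>N\<close>, put side by side.\<close>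

definition join_law :: "nat \<Rightarrow> nat list set \<Rightarrow> (nat list \<Rightarrow> real) measure \<Rightarrow> (nat list \<Rightarrow> real) measure" where
  "join_law d I N = distr (PiM {..<d} (\<lambda>_. N)) (vectors (join_index d I)) (join_vec d I)"

lemma join_index_bij: "bij_betw (\<lambda>(i, x). i # x) ({..<d} \<times> I) (join_index d I)"
  by (rule bij_betwI[where g="\<lambda>y. (hd y, tl y)"]) (auto simp: join_index_def)

lemma measurable_join: "join_vec d I \<in> PiM {..<d} (\<lambda>_. vectors I) \<rightarrow>\<^sub>M vectors (join_index d I)"
  unfolding join_vec_def
proof (rule measurable_restrict)
  fix y assume "y \<in> join_index d I"
  then obtain i x where "y = i # x" "i < d" "x \<in> I" by (auto simp: join_index_def)
  then show "(\<lambda>v. v (hd y) (tl y)) \<in> borel_measurable (PiM {..<d} (\<lambda>_. vectors I))"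
    using measurable_compose[OF measurable_component_singleton[of i "{..<d}" "\<lambda>_. vectors I"]
        measurable_component_singleton[of x I "\<lambda>_. borel"]] by simp
qed

lemma measurable_restrict_coord:
  "j \<in> J \<Longrightarrow> x \<in> I \<Longrightarrow> (\<lambda>v. v j x) \<in> borel_measurable (PiM J (\<lambda>_. vectors I))"
  using measurable_compose[OF measurable_component_singleton[of j J "\<lambda>_. vectors I"]
      measurable_component_singleton[of x I "\<lambda>_. borel"]] by simp

text \<open>The new minimum is that of one copy, and all other copies are thinned at its value \<open>w\<close>; each of them
  contributes a factor \<open>c w\<close>, the probability that its minimum exceeds \<open>w\<close>. This factor does not depend on
  the position of the minimum, so the new position is again uniform and independent of the value.\<close>

theorem (in log_concave_min_decomposition) join_decomposition:
  assumes d: "0 < d"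
  shows "\<exists>\<nu>' \<Phi>'. log_concave_min_decomposition \<nu>' (join_index d I) (join_law d I N) \<Phi>'"
proof -
  obtain \<tau> where \<tau>_meas: "\<And>x. x \<in> I \<Longrightarrow> (\<lambda>(r, \<omega>). \<tau> r \<omega> x) \<in> borel_measurable (borel \<Otimes>\<^sub>M seeds)"
    and \<tau>_mono: "\<And>x \<omega> r r'. x \<in> I \<Longrightarrow> \<omega> \<in> space seeds \<Longrightarrow> r \<le> r' \<Longrightarrow> \<tau> r \<omega> x \<le> \<tau> r' \<omega> x"
    and \<tau>_neg: "\<And>x \<omega> r. x \<in> I \<Longrightarrow> \<omega> \<in> space seeds \<Longrightarrow> \<tau> r \<omega> x < 0"
    and \<tau>_law: "\<And>g r. g \<in> borel_measurable (vectors I) \<Longrightarrow>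
      (\<integral>\<^sup>+v. g v * indicator (above I r) v \<partial>N)
        = of_nat (card I) * emeasure \<nu> {r<..} * (\<integral>\<^sup>+\<omega>. g (\<lambda>x\<in>I. r - \<tau> r \<omega> x) \<partial>seeds)"
    by (rule thinning, rule that; assumption)
  let ?PN = "PiM {..<d} (\<lambda>_. N)"
  interpret N: prob_space N by (rule prob_N)
  interpret PN: product_sigma_finite "\<lambda>_::nat. N"
    by (simp add: product_sigma_finite_def prob_space_imp_sigma_finite[OF prob_N])
  interpret PS: product_sigma_finite "\<lambda>_::nat. seeds"
    by (simp add: product_sigma_finite_def seeds.sigma_finite_measure_axioms)
  define I' where "I' = join_index d I"
  define c where "c r = of_nat (card I) * emeasure \<nu> {r<..}" for r
  define Y where "Y r \<omega> = (\<lambda>x\<in>I. r - \<tau> r \<omega> x)" for r \<omega>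
  define m where "m a = Min ((\<lambda>x. a x) ` I)" for a :: "nat list \<Rightarrow> real"
  \<comment> \<open>Indicator of the event that copy \<open>j\<close> stays above the level \<open>r\<close> of copy \<open>i\<close>, with ties won by the smaller index.\<close>
  define \<eta> where "\<eta> i j r v = (indicator {v \<in> space (vectors I). \<forall>x\<in>I. if j < i then r < v x else r \<le> v x} v :: ennreal)"
    for i j :: nat and r v
  \<comment> \<open>Indicator of the event that copy \<open>i\<close> is the first one to attain the overall minimum.\<close>
  define first where "first i v = (\<Prod>j\<in>{..<d} - {i}. \<eta> i j (m (v i)) (v j))" for i v
  define \<nu>' where "\<nu>' = density \<nu> (\<lambda>w. c w ^ (d - 1))"
  define \<Phi>' where "\<Phi>' y0 w \<omega> y = (if hd y = hd y0 then \<Phi> (tl y0) w (subtree (hd y) \<omega>) (tl y)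
    else \<tau> w (subtree (hd y) \<omega>) (tl y))" for y0 w \<omega> y
  \<comment> \<open>Copy \<open>i\<close> is given as \<open>a\<close>, the others are sampled above the level \<open>r\<close>.\<close>
  define assemble where "assemble i r a \<xi> = (\<lambda>y\<in>I'. if hd y = i then a (tl y) else r - \<tau> r (\<xi> (hd y)) (tl y))"
    for i :: nat and r a and \<xi> :: "nat \<Rightarrow> nat list \<Rightarrow> real"
  have mN: "borel_measurable N = borel_measurable (vectors I)"
    by (rule measurable_cong_sets) (auto simp: sets_N)
  have PNs: "sets (PiM J (\<lambda>_. N)) = sets (PiM J (\<lambda>_. vectors I))" for J :: "nat set"
    by (rule sets_PiM_cong) (auto simp: sets_N)
  have mPN: "measurable (PiM J (\<lambda>_. N)) M = measurable (PiM J (\<lambda>_. vectors I)) M" for J :: "nat set" and M :: "'z measure"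
    by (rule measurable_cong_sets) (auto simp: PNs)
  have spPN: "space (PiM J (\<lambda>_. N)) = space (PiM J (\<lambda>_. vectors I))" for J :: "nat set"
    by (rule sets_eq_imp_space_eq[OF PNs])
  have c_meas [measurable]: "c \<in> borel_measurable borel"
    unfolding c_def emeasure_greaterThan by measurable
  have card_pos: "0 < card I" using finite_I I_nonempty by (simp add: card_gt_0_iff)
  have c_pos: "0 < c r" for r
    unfolding c_def emeasure_greaterThan using card_pos G_pos[of r] by (simp add: ennreal_zero_less_mult_iff)
  have \<tau>2: "(\<lambda>p. \<tau> (f p) (h p) x) \<in> borel_measurable M"
    if "x \<in> I" "f \<in> borel_measurable M" "h \<in> M \<rightarrow>\<^sub>M seeds" for f h x and M :: "'b measure"
    using measurable_compose[OF measurable_Pair[OF that(2,3)] \<tau>_meas[OF that(1)]] by simp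
  have \<Phi>2: "(\<lambda>p. \<Phi> z (f p) (h p) x) \<in> borel_measurable M"
    if "z \<in> I" "x \<in> I" "f \<in> borel_measurable M" "h \<in> M \<rightarrow>\<^sub>M seeds" for f h z x and M :: "'b measure"
    using measurable_compose[OF measurable_Pair[OF that(3,4)] measurable_\<Phi>[OF that(1,2)]] by simp
  have I'E: "\<exists>i x. y = i # x \<and> i < d \<and> x \<in> I" if "y \<in> I'" for y
    using that by (auto simp: I'_def join_index_def)
  have assemble_meas: "(\<lambda>p. assemble i (f p) (a p) (\<xi> p)) \<in> M \<rightarrow>\<^sub>M vectors I'"
    if "f \<in> borel_measurable M" "a \<in> M \<rightarrow>\<^sub>M vectors I"
      "\<And>j. j < d \<Longrightarrow> j \<noteq> i \<Longrightarrow> (\<lambda>p. \<xi> p j) \<in> M \<rightarrow>\<^sub>M seeds" for i f a \<xi> and M :: "'b measure"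
    unfolding assemble_def
  proof (rule measurable_restrict)
    fix y assume "y \<in> I'"
    then obtain j x where y: "y = j # x" "j < d" "x \<in> I" using I'E by blast
    show "(\<lambda>p. if hd y = i then a p (tl y) else f p - \<tau> (f p) (\<xi> p (hd y)) (tl y)) \<in> borel_measurable M"
    proof (cases "j = i")
      case True
      then show ?thesis
        using measurable_compose[OF that(2) measurable_component_singleton[of x I "\<lambda>_. borel"]] y by simp
    next
      case False
      then show ?thesis using y that by (auto intro!: borel_measurable_diff \<tau>2)
    qed
  qed
  have m_meas [measurable]: "m \<in> borel_measurable (vectors I)"
    unfolding m_def[abs_def] using finite_I by (intro borel_measurable_Min) auto
  have m_iff: "r < m a \<longleftrightarrow> (\<forall>x\<in>I. r < a x)" "r \<le> m a \<longleftrightarrow> (\<forall>x\<in>I. r \<le> a x)" for r a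
    using finite_I I_nonempty by (auto simp: m_def)
  have m_recon: "m (recon z w \<omega>) = w" if "z \<in> I" "\<omega> \<in> space seeds" for z w \<omega>
    using recon_greater_iff[OF that, of _ w] unfolding m_iff(1)[symmetric]
    by (metis less_irrefl linorder_neqE)
  have \<eta>_meas: "\<eta> i j r \<in> borel_measurable N" for i j r
    unfolding mN \<eta>_def by (cases "j < i") (simp_all add: sets_min_greater sets_min_ge)
  have Y_meas: "Y r \<in> seeds \<rightarrow>\<^sub>M N" for r
    unfolding Y_def measurable_cong_sets[OF refl sets_N]
    by (intro measurable_restrict borel_measurable_diff \<tau>2) simp_all
  have \<eta>_law: "(\<integral>\<^sup>+v. g v * \<eta> i j r v \<partial>N) = c r * (\<integral>\<^sup>+\<omega>. g (Y r \<omega>) \<partial>seeds)"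
    if "g \<in> borel_measurable N" for g i j r
  proof -
    have "(\<integral>\<^sup>+v. g v * \<eta> i j r v \<partial>N)
        = (\<integral>\<^sup>+v. g v * indicator (above I r) v \<partial>N)"
    proof (rule nn_integral_cong_AE)
      show "AE v in N. g v * \<eta> i j r v = g v * indicator (above I r) v"
        using N_min_atomless[of r]
        by eventually_elim (auto simp: \<eta>_def indicator_def less_imp_le)
    qed
    also have "\<dots> = c r * (\<integral>\<^sup>+\<omega>. g (Y r \<omega>) \<partial>seeds)"
      unfolding c_def Y_def by (rule \<tau>_law) (use that mN in simp)
    finally show ?thesis .
  qed
  have \<nu>'_int: "(\<integral>\<^sup>+w. f w \<partial>\<nu>') = (\<integral>\<^sup>+w. c w ^ (d - 1) * f w \<partial>\<nu>)"
    if "f \<in> borel_measurable borel" for f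
    unfolding \<nu>'_def using that by (subst nn_integral_density) auto
  have assemble_eq: "assemble i w (recon z w (subtree i \<omega>)) (\<lambda>j\<in>{..<d}. subtree j \<omega>) = (\<lambda>y\<in>I'. w - \<Phi>' (i # z) w \<omega> y)"
    if "i < d" for i z w \<omega>
    unfolding assemble_def
  proof (rule restrict_ext)
    fix y assume "y \<in> I'"
    then obtain j x where y: "y = j # x" "j < d" "x \<in> I" using I'E by blast
    show "(if hd y = i then recon z w (subtree i \<omega>) (tl y) else w - \<tau> w ((\<lambda>j\<in>{..<d}. subtree j \<omega>) (hd y)) (tl y))
      = w - \<Phi>' (i # z) w \<omega> y"
      using y by (simp add: \<Phi>'_def recon_def)
  qed
  have gjoin: "(\<lambda>v. g (join_vec d I v)) \<in> borel_measurable ?PN"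
    if g: "g \<in> borel_measurable (vectors I')" for g
    unfolding mPN using measurable_compose[OF measurable_join g[unfolded I'_def]] .
  have meas: "(\<lambda>v. g (join_vec d I v) * first i v) \<in> borel_measurable ?PN"
    if i: "i < d" and g: "g \<in> borel_measurable (vectors I')" for i g
    unfolding first_def
  proof (intro borel_measurable_times_ennreal gjoin[OF g] borel_measurable_prod_ennreal)
    fix j assume j: "j \<in> {..<d} - {i}"
    let ?VS = "PiM {..<d} (\<lambda>_. vectors I)"
    let ?B = "{v \<in> space ?VS. \<forall>x\<in>I. if j < i then m (v i) < v j x else m (v i) \<le> v j x}"
    have mi: "(\<lambda>v. m (v i)) \<in> borel_measurable ?VS"
      using i by (intro measurable_comp_component m_meas) auto
    have "?B \<in> sets ?VS"
    proof (rule sets.sets_Collect_finite_All[OF _ finite_I])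
      fix x assume x: "x \<in> I"
      have "(\<lambda>v. v j x) \<in> borel_measurable ?VS"
        using j x by (intro measurable_restrict_coord) auto
      then show "{v \<in> space ?VS. if j < i then m (v i) < v j x else m (v i) \<le> v j x}
          \<in> sets ?VS"
        using mi by (cases "j < i") auto
    qed
    then have "(indicator ?B :: _ \<Rightarrow> ennreal)
        \<in> borel_measurable ?VS" by (rule borel_measurable_indicator)
    then show "(\<lambda>v. \<eta> i j (m (v i)) (v j)) \<in> borel_measurable ?PN"
      unfolding mPN
      by (rule measurable_cong[THEN iffD1, rotated])
         (use j in \<open>auto simp: \<eta>_def indicator_def space_PiM PiE_iff\<close>)
  qed
  have block: "(\<integral>\<^sup>+v. g (join_vec d I v) * first i v \<partial>?PN)
      = (\<Sum>z\<in>I. \<integral>\<^sup>+w. (\<integral>\<^sup>+\<omega>. g (\<lambda>y\<in>I'. w - \<Phi>' (i # z) w \<omega> y) \<partial>seeds) \<partial>\<nu>')"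
    if i: "i < d" and g: "g \<in> borel_measurable (vectors I')" for i g
  proof -
    let ?J = "{..<d} - {i}"
    have ins: "{..<d} = insert i ?J" using i by auto
    let ?SJ = "PiM ?J (\<lambda>_. seeds)"
    have cardJ: "card ?J = d - 1" using i by simp
    define h where "h a = c (m a) ^ (d - 1) * (\<integral>\<^sup>+\<xi>. g (assemble i (m a) a \<xi>) \<partial>?SJ)" for a
    note gjoin = gjoin[OF g] and meas = meas[OF i g]
    interpret SJ: prob_space "PiM ?J (\<lambda>_. seeds)"
      by (intro prob_space_PiM seeds.prob_space_axioms)
    have h_meas: "h \<in> borel_measurable (vectors I)"
    proof -
      have "(\<lambda>p. g (assemble i (m (fst p)) (fst p) (snd p))) \<in> borel_measurable (vectors I \<Otimes>\<^sub>M ?SJ)"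
        by (rule measurable_compose[OF assemble_meas g]) (auto intro!: measurable_compose[OF measurable_snd])
      from SJ.borel_measurable_nn_integral_fst[OF this]
      have 1: "(\<lambda>a. \<integral>\<^sup>+\<xi>. g (assemble i (m a) a \<xi>) \<partial>?SJ) \<in> borel_measurable (vectors I)"
        by simp
      have "(\<lambda>r. c r ^ (d - 1)) \<in> borel_measurable borel" by measurable
      from borel_measurable_times_ennreal[OF measurable_compose[OF m_meas this] 1]
      show ?thesis unfolding h_def[abs_def] .
    qed
    have "(\<integral>\<^sup>+v. g (join_vec d I v) * first i v \<partial>?PN)
        = (\<integral>\<^sup>+a. (\<integral>\<^sup>+v. g (join_vec d I (v(i := a))) * (\<Prod>j\<in>?J. \<eta> i j (m a) (v j)) \<partial>PiM ?J (\<lambda>_. N)) \<partial>N)"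
    proof -
      have "(\<integral>\<^sup>+v. g (join_vec d I v) * (\<Prod>j\<in>?J. \<eta> i j (m (v i)) (v j)) \<partial>PiM (insert i ?J) (\<lambda>_. N))
          = (\<integral>\<^sup>+a. (\<integral>\<^sup>+v. g (join_vec d I (v(i := a))) * (\<Prod>j\<in>?J. \<eta> i j (m ((v(i := a)) i)) ((v(i := a)) j)) \<partial>PiM ?J (\<lambda>_. N)) \<partial>N)"
        by (rule PN.product_nn_integral_insert_rev) (use meas[unfolded first_def] ins in auto)
      also have "\<dots> = (\<integral>\<^sup>+a. (\<integral>\<^sup>+v. g (join_vec d I (v(i := a))) * (\<Prod>j\<in>?J. \<eta> i j (m a) (v j)) \<partial>PiM ?J (\<lambda>_. N)) \<partial>N)"
        by (intro nn_integral_cong arg_cong2[where f="(*)"] prod.cong refl) auto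
      finally show ?thesis unfolding ins[symmetric] first_def .
    qed
    also have "\<dots> = (\<integral>\<^sup>+a. h a \<partial>N)"
    proof (rule nn_integral_cong)
      fix a assume a: "a \<in> space N"
      have upd: "(\<lambda>v. v(i := a)) \<in> PiM ?J (\<lambda>_. N) \<rightarrow>\<^sub>M ?PN"
        using measurable_compose[OF measurable_Pair2'[OF a] measurable_add_dim[of i ?J "\<lambda>_. N"]] ins by simp
      have "(\<integral>\<^sup>+v. g (join_vec d I (v(i := a))) * (\<Prod>j\<in>?J. \<eta> i j (m a) (v j)) \<partial>PiM ?J (\<lambda>_. N))
          = c (m a) ^ card ?J * (\<integral>\<^sup>+\<xi>. g (join_vec d I ((\<lambda>j\<in>?J. Y (m a) (\<xi> j))(i := a))) \<partial>?SJ)"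
        by (rule nn_integral_PiM_replace[OF prob_N seeds.prob_space_axioms _ Y_meas \<eta>_meas \<eta>_law
              measurable_compose[OF upd gjoin]]) auto
      also have "(\<integral>\<^sup>+\<xi>. g (join_vec d I ((\<lambda>j\<in>?J. Y (m a) (\<xi> j))(i := a))) \<partial>?SJ)
          = (\<integral>\<^sup>+\<xi>. g (assemble i (m a) a \<xi>) \<partial>?SJ)"
      proof (rule nn_integral_cong, rule arg_cong[where f=g])
        fix \<xi> :: "nat \<Rightarrow> nat list \<Rightarrow> real"
        show "join_vec d I ((\<lambda>j\<in>?J. Y (m a) (\<xi> j))(i := a)) = assemble i (m a) a \<xi>"
          unfolding join_vec_def assemble_def I'_def[symmetric]
        proof (rule restrict_ext)
          fix y assume "y \<in> I'"
          then obtain j x where y: "y = j # x" "j < d" "x \<in> I" using I'E by blast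
          show "((\<lambda>j\<in>?J. Y (m a) (\<xi> j))(i := a)) (hd y) (tl y)
            = (if hd y = i then a (tl y) else m a - \<tau> (m a) (\<xi> (hd y)) (tl y))"
            using y by (simp add: Y_def)
        qed
      qed
      finally show "(\<integral>\<^sup>+v. g (join_vec d I (v(i := a))) * (\<Prod>j\<in>?J. \<eta> i j (m a) (v j)) \<partial>PiM ?J (\<lambda>_. N)) = h a"
        unfolding h_def cardJ .
    qed
    also have "\<dots> = (\<Sum>z\<in>I. \<integral>\<^sup>+w. (\<integral>\<^sup>+\<omega>. h (recon z w \<omega>) \<partial>seeds) \<partial>\<nu>)"
      by (rule nn_integral_recon[OF h_meas])
    also have "\<dots> = (\<Sum>z\<in>I. \<integral>\<^sup>+w. (\<integral>\<^sup>+\<omega>. g (\<lambda>y\<in>I'. w - \<Phi>' (i # z) w \<omega> y) \<partial>seeds) \<partial>\<nu>')"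
    proof (rule sum.cong[OF refl])
      fix z assume z: "z \<in> I"
      define L where "L w = (\<integral>\<^sup>+\<omega>. (\<integral>\<^sup>+\<xi>. g (assemble i w (recon z w \<omega>) \<xi>) \<partial>?SJ) \<partial>seeds)" for w
      have assemble_z: "(\<lambda>p. g (assemble i (f p) (recon z (f p) (k p)) (\<xi> p))) \<in> borel_measurable M"
        if "f \<in> borel_measurable M" "k \<in> M \<rightarrow>\<^sub>M seeds" "\<And>j. j < d \<Longrightarrow> j \<noteq> i \<Longrightarrow> (\<lambda>p. \<xi> p j) \<in> M \<rightarrow>\<^sub>M seeds"
        for f k \<xi> and M :: "'b measure"
        by (rule measurable_compose[OF assemble_meas g]) (use that z in \<open>auto intro!: measurable_recon2\<close>)
      have inner: "(\<lambda>\<omega>. \<integral>\<^sup>+\<xi>. g (assemble i w (recon z w \<omega>) \<xi>) \<partial>?SJ) \<in> borel_measurable seeds" for w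
      proof -
        have "(\<lambda>p. g (assemble i w (recon z w (fst p)) (snd p))) \<in> borel_measurable (seeds \<Otimes>\<^sub>M ?SJ)"
          by (rule assemble_z) (auto intro!: measurable_compose[OF measurable_snd])
        from SJ.borel_measurable_nn_integral_fst[OF this] show ?thesis by simp
      qed
      have "(\<integral>\<^sup>+\<omega>. h (recon z w \<omega>) \<partial>seeds) = c w ^ (d - 1) * L w" for w
      proof -
        have "(\<integral>\<^sup>+\<omega>. h (recon z w \<omega>) \<partial>seeds)
            = (\<integral>\<^sup>+\<omega>. c w ^ (d - 1) * (\<integral>\<^sup>+\<xi>. g (assemble i w (recon z w \<omega>) \<xi>) \<partial>?SJ) \<partial>seeds)"
          by (rule nn_integral_cong) (simp add: h_def m_recon[OF z])
        then show ?thesis unfolding L_def by (simp add: nn_integral_cmult[OF inner])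
      qed
      then have "(\<integral>\<^sup>+w. (\<integral>\<^sup>+\<omega>. h (recon z w \<omega>) \<partial>seeds) \<partial>\<nu>) = (\<integral>\<^sup>+w. c w ^ (d - 1) * L w \<partial>\<nu>)" by simp
      also have "\<dots> = (\<integral>\<^sup>+w. L w \<partial>\<nu>')"
      proof (rule \<nu>'_int[symmetric])
        have "(\<lambda>p. g (assemble i (fst (fst p)) (recon z (fst (fst p)) (snd (fst p))) (snd p)))
            \<in> borel_measurable ((borel \<Otimes>\<^sub>M seeds) \<Otimes>\<^sub>M ?SJ)"
          by (rule assemble_z) (auto intro!: measurable_compose[OF measurable_snd])
        from SJ.borel_measurable_nn_integral_fst[OF this]
        have "(\<lambda>p. \<integral>\<^sup>+\<xi>. g (assemble i (fst p) (recon z (fst p) (snd p)) \<xi>) \<partial>?SJ)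
            \<in> borel_measurable (borel \<Otimes>\<^sub>M seeds)" by simp
        from seeds.borel_measurable_nn_integral_fst[OF this]
        show "L \<in> borel_measurable borel" unfolding L_def[abs_def] by simp
      qed
      also have "L = (\<lambda>w. \<integral>\<^sup>+\<omega>. g (\<lambda>y\<in>I'. w - \<Phi>' (i # z) w \<omega> y) \<partial>seeds)"
      proof (rule ext)
        fix w
        let ?K = "\<lambda>\<xi>. g (assemble i w (recon z w (\<xi> i)) \<xi>)"
        have K: "?K \<in> borel_measurable (PiM {..<d} (\<lambda>_. seeds))"
          using i by (intro assemble_z) auto
        have "L w = (\<integral>\<^sup>+\<omega>. (\<integral>\<^sup>+\<xi>. ?K (\<xi>(i := \<omega>)) \<partial>?SJ) \<partial>seeds)"
          unfolding L_def by (intro nn_integral_cong arg_cong[where f=g]) (auto simp: assemble_def fun_eq_iff)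
        also have "\<dots> = (\<integral>\<^sup>+\<xi>. ?K \<xi> \<partial>PiM (insert i ?J) (\<lambda>_. seeds))"
          by (rule PS.product_nn_integral_insert_rev[symmetric]) (use K ins in auto)
        also have "\<dots> = (\<integral>\<^sup>+\<omega>. ?K (\<lambda>j\<in>{..<d}. subtree j \<omega>) \<partial>seeds)"
          unfolding ins[symmetric] by (rule nn_integral_subtrees[OF prob_space_unif K, symmetric])
        also have "\<dots> = (\<integral>\<^sup>+\<omega>. g (\<lambda>y\<in>I'. w - \<Phi>' (i # z) w \<omega> y) \<partial>seeds)"
          using i by (simp add: assemble_eq)
        finally show "L w = (\<integral>\<^sup>+\<omega>. g (\<lambda>y\<in>I'. w - \<Phi>' (i # z) w \<omega> y) \<partial>seeds)" .
      qed
      finally show "(\<integral>\<^sup>+w. (\<integral>\<^sup>+\<omega>. h (recon z w \<omega>) \<partial>seeds) \<partial>\<nu>)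
        = (\<integral>\<^sup>+w. (\<integral>\<^sup>+\<omega>. g (\<lambda>y\<in>I'. w - \<Phi>' (i # z) w \<omega> y) \<partial>seeds) \<partial>\<nu>')" .
    qed
    finally show ?thesis .
  qed
  have identity: "(\<integral>\<^sup>+v. g v \<partial>join_law d I N)
      = (\<Sum>y\<in>I'. \<integral>\<^sup>+w. (\<integral>\<^sup>+\<omega>. g (\<lambda>x\<in>I'. w - \<Phi>' y w \<omega> x) \<partial>seeds) \<partial>\<nu>')"
    if g: "g \<in> borel_measurable (vectors I')" for g
  proof -
    define lead where "lead i v \<longleftrightarrow> (\<forall>j<d. j \<noteq> i \<longrightarrow> (if j < i then m (v i) < m (v j) else m (v i) \<le> m (v j)))"
      for i and v :: "nat \<Rightarrow> nat list \<Rightarrow> real"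
    have one: "(\<Sum>i<d. first i v) = 1"
      if v: "v \<in> space ?PN" for v
    proof -
      obtain i0 where i0: "i0 < d" "lead i0 v" "\<And>i. i < d \<Longrightarrow> lead i v \<Longrightarrow> i = i0"
        using first_minimum_unique[OF d, of "\<lambda>j. m (v j)"] unfolding lead_def by blast
      have vj: "v j \<in> space (vectors I)" if "j < d" for j
        using v that by (auto simp: spPN space_PiM[of "{..<d}"])
      have \<eta>_m: "\<eta> i j (m (v i)) (v j) = (if (if j < i then m (v i) < m (v j) else m (v i) \<le> m (v j)) then 1 else 0)"
        if "j < d" for i j
        using vj[OF that] by (simp add: \<eta>_def indicator_def m_iff)
      have "first i v = (if i = i0 then 1 else 0)" if i: "i < d" for i
      proof (cases "lead i v")
        case True
        then have "first i v = 1"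
          unfolding first_def by (intro prod.neutral) (auto simp: \<eta>_m lead_def)
        then show ?thesis using i0(3)[OF i True] by simp
      next
        case False
        then obtain j where "j < d" "j \<noteq> i" "\<not> (if j < i then m (v i) < m (v j) else m (v i) \<le> m (v j))"
          unfolding lead_def by blast
        then have "first i v = 0"
          unfolding first_def by (intro prod_zero) (auto intro!: bexI[of _ j] simp: \<eta>_m)
        then show ?thesis using i0(2) False by auto
      qed
      then have "(\<Sum>i<d. first i v) = (\<Sum>i<d. if i = i0 then 1 else 0)"
        by (intro sum.cong) auto
      then show ?thesis using i0(1) by simp
    qed
    have "(\<integral>\<^sup>+v. g v \<partial>join_law d I N) = (\<integral>\<^sup>+v. g (join_vec d I v) \<partial>?PN)"
      unfolding join_law_def I'_def[symmetric]
      by (rule nn_integral_distr) (use measurable_join g in \<open>auto simp: mPN I'_def\<close>)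
    also have "\<dots> = (\<integral>\<^sup>+v. (\<Sum>i<d. g (join_vec d I v) * first i v) \<partial>?PN)"
      by (intro nn_integral_cong) (simp add: sum_distrib_left[symmetric] one)
    also have "\<dots> = (\<Sum>i<d. \<integral>\<^sup>+v. g (join_vec d I v) * first i v \<partial>?PN)"
      by (rule nn_integral_sum) (use meas g in auto)
    also have "\<dots> = (\<Sum>i<d. \<Sum>z\<in>I. \<integral>\<^sup>+w. (\<integral>\<^sup>+\<omega>. g (\<lambda>y\<in>I'. w - \<Phi>' (i # z) w \<omega> y) \<partial>seeds) \<partial>\<nu>')"
      by (intro sum.cong refl block g) auto
    also have "\<dots> = (\<Sum>(i, z)\<in>{..<d} \<times> I. \<integral>\<^sup>+w. (\<integral>\<^sup>+\<omega>. g (\<lambda>y\<in>I'. w - \<Phi>' (i # z) w \<omega> y) \<partial>seeds) \<partial>\<nu>')"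
      by (rule sum.cartesian_product)
    also have "\<dots> = (\<Sum>y\<in>I'. \<integral>\<^sup>+w. (\<integral>\<^sup>+\<omega>. g (\<lambda>x\<in>I'. w - \<Phi>' y w \<omega> x) \<partial>seeds) \<partial>\<nu>')"
      unfolding I'_def by (subst sum.reindex_bij_betw[OF join_index_bij, symmetric]) (simp add: case_prod_beta)
    finally show ?thesis .
  qed
  have finI': "finite I'" and I'ne: "I' \<noteq> {}"
    using bij_betw_finite[OF join_index_bij[of d I]] finite_I I_nonempty d
    unfolding I'_def by (auto simp: join_index_def)
  have join_space: "join_vec d I \<in> ?PN \<rightarrow>\<^sub>M vectors I'"
    unfolding mPN I'_def by (rule measurable_join)
  have prob': "prob_space (join_law d I N)"
    unfolding join_law_def I'_def[symmetric]
    by (intro prob_space.prob_space_distr prob_space_PiM prob_N join_space)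
  have fh: "finite_halfline_measure \<nu>'"
    unfolding \<nu>'_def
  proof (rule finite_halfline_measure_density)
    show "finite_halfline_measure \<nu>" by (rule finite_halfline_measure_axioms)
    show "0 < c w ^ (d - 1)" for w using c_pos[of w] by (simp add: zero_less_iff_neq_zero)
    have "of_nat (card I') * emeasure \<nu>' UNIV = (\<Sum>y\<in>I'. \<integral>\<^sup>+w. (\<integral>\<^sup>+\<omega>. 1 \<partial>seeds) \<partial>\<nu>')"
      by (simp add: seeds.emeasure_space_1 \<nu>'_def)
    also have "\<dots> = (\<integral>\<^sup>+v. 1 \<partial>join_law d I N)"
      by (rule identity[symmetric]) simp
    also have "\<dots> = 1" using prob_space.emeasure_space_1[OF prob'] by simp
    finally have *: "of_nat (card I') * emeasure \<nu>' UNIV = 1" .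
    have "emeasure \<nu>' UNIV \<noteq> top"
    proof
      assume "emeasure \<nu>' UNIV = top"
      then show False using * finI' I'ne by (simp add: ennreal_mult_top)
    qed
    then show "emeasure (density \<nu> (\<lambda>w. c w ^ (d - 1))) UNIV < \<infinity>"
      by (simp add: \<nu>'_def less_top)
  qed measurable
  have md: "min_decomposition \<nu>' I' (join_law d I N) \<Phi>'"
  proof (intro min_decomposition.intro min_decomposition_axioms.intro)
    show "sets (join_law d I N) = sets (vectors I')" by (simp add: join_law_def I'_def)
    show "prob_space (join_law d I N)" by (rule prob')
    show "(\<lambda>(w, \<omega>). \<Phi>' z w \<omega> x) \<in> borel_measurable (borel \<Otimes>\<^sub>M seeds)" if z: "z \<in> I'" and x: "x \<in> I'" for z x
    proof -
      obtain i z' j x' where zx: "z = i # z'" "z' \<in> I" "x = j # x'" "x' \<in> I"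
        using I'E[OF z] I'E[OF x] by blast
      show ?thesis
        unfolding case_prod_beta' \<Phi>'_def
        by (cases "j = i") (use zx in \<open>auto intro!: \<tau>2 \<Phi>2 measurable_compose[OF measurable_snd measurable_subtree]\<close>)
    qed
    show "\<Phi>' z s \<omega> x \<le> \<Phi>' z t \<omega> x"
      if z: "z \<in> I'" and x: "x \<in> I'" and \<omega>: "\<omega> \<in> space seeds" and st: "s \<le> t" for z x \<omega> s t
    proof -
      obtain i z' j x' where zx: "z = i # z'" "z' \<in> I" "x = j # x'" "x' \<in> I"
        using I'E[OF z] I'E[OF x] by blast
      show ?thesis
        using zx \<Phi>_mono[OF zx(2) zx(4) subtree_seeds[OF \<omega>] st] \<tau>_mono[OF zx(4) subtree_seeds[OF \<omega>] st]
        by (simp add: \<Phi>'_def)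
    qed
    show "\<Phi>' z w \<omega> z = 0" if z: "z \<in> I'" and \<omega>: "\<omega> \<in> space seeds" for z w \<omega>
      using I'E[OF z] \<Phi>_self[OF _ subtree_seeds[OF \<omega>]] by (auto simp: \<Phi>'_def)
    show "\<Phi>' z w \<omega> x < 0"
      if z: "z \<in> I'" and x: "x \<in> I'" and xz: "x \<noteq> z" and \<omega>: "\<omega> \<in> space seeds" for z x w \<omega>
    proof -
      obtain i z' j x' where zx: "z = i # z'" "z' \<in> I" "x = j # x'" "x' \<in> I"
        using I'E[OF z] I'E[OF x] by blast
      show ?thesis
        using zx xz \<Phi>_neg[OF zx(2) zx(4) _ subtree_seeds[OF \<omega>]] \<tau>_neg[OF zx(4) subtree_seeds[OF \<omega>]]
        by (auto simp: \<Phi>'_def)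
    qed
  qed (fact fh finI' I'ne identity)+
  interpret md: min_decomposition \<nu>' I' "join_law d I N" \<Phi>' by (rule md)
  \<comment> \<open>The minimum of independent copies exceeds \<open>r\<close> if and only if each copy does.\<close>
  have tail: "of_nat (card I') * emeasure \<nu>' {r<..} = c r ^ d" for r
  proof -
    let ?B = "above I r"
    have "of_nat (card I') * emeasure \<nu>' {r<..}
        = emeasure (join_law d I N) (above I' r)"
      by (rule md.emeasure_min_greater[symmetric])
    also have "\<dots> = emeasure ?PN
        (join_vec d I -` (above I' r) \<inter> space ?PN)"
      unfolding join_law_def I'_def[symmetric]
      by (rule emeasure_distr[OF join_space md.sets_min_greater])
    also have "join_vec d I -` (above I' r) \<inter> space ?PN
        = (\<Pi>\<^sub>E i\<in>{..<d}. ?B)"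
    proof (intro set_eqI iffI)
      fix v assume v: "v \<in> join_vec d I -` (above I' r) \<inter> space ?PN"
      have "r < v i x" if "i < d" "x \<in> I" for i x
      proof -
        have "i # x \<in> I'" using that by (auto simp: I'_def join_index_def)
        then show ?thesis using v by (force simp: join_vec_def I'_def)
      qed
      then show "v \<in> (\<Pi>\<^sub>E i\<in>{..<d}. ?B)" using v by (auto simp: spPN space_PiM[of "{..<d}"] PiE_iff)
    next
      fix v assume v: "v \<in> (\<Pi>\<^sub>E i\<in>{..<d}. ?B)"
      then have sp: "v \<in> space ?PN" by (auto simp: spPN space_PiM[of "{..<d}"] PiE_iff)
      have "\<forall>y\<in>I'. r < join_vec d I v y"
        using v I'E by (force simp: join_vec_def I'_def[symmetric] PiE_iff)
      then show "v \<in> join_vec d I -` (above I' r) \<inter> space ?PN"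
        using sp measurable_space[OF join_space sp] by auto
    qed
    also have "emeasure ?PN (\<Pi>\<^sub>E i\<in>{..<d}. ?B) = (\<Prod>i<d. emeasure N ?B)"
      by (rule PN.emeasure_PiM) (auto simp: sets_N)
    finally show ?thesis by (simp add: emeasure_min_greater c_def)
  qed
  have "log_concave (\<lambda>r. of_nat (card I') * emeasure \<nu>' {r<..})"
    unfolding tail c_def
    by (intro log_concave_power log_concave_mult log_concave_const tail_log_concave)
  then have "log_concave (\<lambda>r. emeasure \<nu>' {r<..})"
    by (rule log_concave_cancel) (use finI' I'ne in auto)
  with md have "log_concave_min_decomposition \<nu>' I' (join_law d I N) \<Phi>'"
    by (intro log_concave_min_decomposition.intro log_concave_min_decomposition_axioms.intro)
  then show ?thesis unfolding I'_def by blast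
qed

section \<open>A single exponential variable, and adding one\<close>

text \<open>The exponential distribution with rate \<open>l\<close>.\<close>

definition exp_dist :: "real \<Rightarrow> real measure" where
  "exp_dist l = density lborel (\<lambda>x. ennreal (exponential_density l x))"

lemma sets_exp_dist [measurable_cong, simp]: "sets (exp_dist l) = sets borel"
  by (simp add: exp_dist_def)

lemma space_exp_dist [simp]: "space (exp_dist l) = UNIV"
  by (simp add: exp_dist_def)

lemma prob_space_exp_dist: "0 < l \<Longrightarrow> prob_space (exp_dist l)"
  unfolding exp_dist_def by (rule prob_space_exponential_density)

lemma measurable_exponential_density [measurable]: "exponential_density l \<in> borel_measurable borel"
  by (simp add: exponential_density_def[abs_def])

lemma nn_integral_exp_dist:
  "f \<in> borel_measurable borel \<Longrightarrow>
    (\<integral>\<^sup>+e. f e \<partial>exp_dist l) = (\<integral>\<^sup>+e. ennreal (exponential_density l e) * f e \<partial>lborel)"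
  unfolding exp_dist_def by (rule nn_integral_density) auto

text \<open>A vector with a single coordinate, which is exponential.\<close>

definition base_law :: "real \<Rightarrow> (nat list \<Rightarrow> real) measure" where
  "base_law l = distr (exp_dist l) (vectors {[]}) (\<lambda>e. \<lambda>x\<in>{[]}. e)"

text \<open>The only gap is zero, and the tail \<open>exp (- l * max 0 r)\<close> is log-concave since \<open>max 0\<close> is convex.\<close>

lemma base_decomposition:
  assumes l: "0 < l"
  shows "\<exists>\<nu> \<Phi>. log_concave_min_decomposition \<nu> {[]} (base_law l) \<Phi>"
proof -
  interpret E: prob_space "exp_dist l" by (rule prob_space_exp_dist[OF l])
  have tail: "emeasure (exp_dist l) {r<..} = ennreal (exp (- l * max 0 r))" for r
  proof (cases "r < 0")
    case False
    have "distributed (exp_dist l) lborel (\<lambda>x. x) (exponential_density l)"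
      unfolding distributed_def
    proof (intro conjI)
      show "distr (exp_dist l) lborel (\<lambda>x. x) = density lborel (\<lambda>x. ennreal (exponential_density l x))"
        by (simp add: exp_dist_def distr_id2)
      show "(\<lambda>x. x) \<in> exp_dist l \<rightarrow>\<^sub>M lborel"
        by (rule measurable_ident_sets) simp
      show "(\<lambda>x. ennreal (exponential_density l x)) \<in> borel_measurable lborel"
        using measurable_compose[OF measurable_exponential_density measurable_ennreal] by simp
    qed
    from E.exponential_distributedD_gt[OF this _ l, of r] False
    show ?thesis by (simp add: E.emeasure_eq_measure max_def mult.commute greaterThan_def)
  next
    case True
    interpret finite_halfline_measure "exp_dist l"
      unfolding exp_dist_def
      by (rule finite_halfline_density_lborel)
         (use l E.emeasure_space_1 in \<open>auto simp: exponential_density_def exp_dist_def\<close>)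
    have "emeasure (exp_dist l) {r<..} = 1"
      using G_eq[of r] F_nonpos[of r] True E.prob_space
      by (simp add: emeasure_greaterThan)
    then show ?thesis using True by (simp add: max_def)
  qed
  have "finite_halfline_measure (exp_dist l)"
    unfolding exp_dist_def
    by (rule finite_halfline_density_lborel)
       (use l E.emeasure_space_1 in \<open>auto simp: exponential_density_def exp_dist_def\<close>)
  moreover have m: "(\<lambda>e. \<lambda>x\<in>{[]::nat list}. e) \<in> exp_dist l \<rightarrow>\<^sub>M vectors {[]}"
    by (intro measurable_restrict measurable_ident_sets sets_exp_dist)
  moreover have "prob_space (base_law l)"
    unfolding base_law_def by (rule E.prob_space_distr[OF m])
  ultimately have "min_decomposition (exp_dist l) {[]} (base_law l) (\<lambda>_ _ _ _. 0)"
    by (intro min_decomposition.intro min_decomposition_axioms.intro)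
       (auto simp: base_law_def nn_integral_distr seeds.emeasure_space_1)
  moreover have "log_concave (\<lambda>r. emeasure (exp_dist l) {r<..})"
    unfolding log_concave_def tail
  proof safe
    fix r r' s :: real assume "r \<le> r'" "0 \<le> s"
    then have "max 0 (r + s) + max 0 r' \<le> max 0 (r' + s) + max 0 r" by (auto simp: max_def)
    then have "l * (max 0 (r + s) + max 0 r') \<le> l * (max 0 (r' + s) + max 0 r)"
      using l by (intro mult_left_mono) auto
    then show "ennreal (exp (- l * max 0 (r' + s))) * ennreal (exp (- l * max 0 r))
      \<le> ennreal (exp (- l * max 0 (r + s))) * ennreal (exp (- l * max 0 r'))"
      by (simp add: ennreal_mult[symmetric] exp_add[symmetric] distrib_left)
  qed
  ultimately show ?thesis
    by (blast intro: log_concave_min_decomposition.intro log_concave_min_decomposition_axioms.intro)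
qed

text \<open>An independent exponential variable is added to all coordinates.\<close>

definition shift_law :: "real \<Rightarrow> nat list set \<Rightarrow> (nat list \<Rightarrow> real) measure \<Rightarrow> (nat list \<Rightarrow> real) measure" where
  "shift_law l I N = distr (exp_dist l \<Otimes>\<^sub>M N) (vectors I) (\<lambda>(e, v). \<lambda>x\<in>I. e + v x)"

text \<open>The gaps do not change under the shift; only their law given the minimum does, because the new
  minimum \<open>w\<close> leaves the old minimum \<open>m\<close> random. The density of the new variable at \<open>w - m\<close> is proportional to
  \<open>exp (- l * w) * exp (l * m)\<close> on \<open>m \<le> w\<close>, so given \<open>w\<close> the law of \<open>m\<close> is a truncation of the measure \<open>\<theta>\<close> below.\<close>

theorem (in log_concave_min_decomposition) shift_decomposition:
  assumes l: "0 < l"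
  shows "\<exists>\<nu>' \<Phi>'. log_concave_min_decomposition \<nu>' I (shift_law l I N) \<Phi>'"
proof -
  interpret E: prob_space "exp_dist l" by (rule prob_space_exp_dist[OF l])
  interpret N: prob_space N by (rule prob_N)
  interpret fm: finite_measure \<nu> by (rule finite_measure_nu)
  interpret LN: pair_sigma_finite \<nu> lborel ..
  define \<theta> where "\<theta> = density \<nu> (\<lambda>m. ennreal (exp (l * m)))"
  have "halfline_measure \<theta>"
    unfolding \<theta>_def
  proof (rule halfline_measure_density)
    show "halfline_measure \<nu>" by (rule halfline_measure_axioms)
    fix t
    have "emeasure (density \<nu> (\<lambda>m. ennreal (exp (l * m)))) {..t}
        = (\<integral>\<^sup>+m. ennreal (exp (l * m)) * indicator {..t} m \<partial>\<nu>)"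
      by (rule emeasure_density) auto
    also have "\<dots> \<le> (\<integral>\<^sup>+m. ennreal (exp (l * t)) * indicator {..t} m \<partial>\<nu>)"
      using l by (intro nn_integral_mono) (auto split: split_indicator intro!: ennreal_leI)
    also have "\<dots> = ennreal (exp (l * t)) * emeasure \<nu> {..t}"
      by (rule nn_integral_cmult_indicator) simp
    also have "\<dots> < \<infinity>" using atMost_finite[of t] by (simp add: ennreal_mult_less_top)
    finally show "emeasure (density \<nu> (\<lambda>m. ennreal (exp (l * m)))) {..t} < \<infinity>" .
  qed auto
  then interpret \<theta>: halfline_measure \<theta> .
  define a where "a w = ennreal (l * exp (- l * w))" for w
  define \<nu>' where "\<nu>' = density lborel (\<lambda>w. a w * ennreal (\<theta>.F w))"
  define \<Phi>' where "\<Phi>' z w \<omega> = \<Phi> z (\<theta>.trunc_quantile w (\<omega> [])) (subtree 0 \<omega>)" for z w \<omega>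
  have a_meas [measurable]: "a \<in> borel_measurable borel" by (simp add: a_def[abs_def])
  have aF: "(\<lambda>w. a w * ennreal (\<theta>.F w)) \<in> borel_measurable borel"
    by (intro borel_measurable_times_ennreal a_meas measurable_compose[OF \<theta>.measurable_F measurable_ennreal])
  have sp_N: "space N = space (vectors I)" by (rule sets_eq_imp_space_eq[OF sets_N])
  have shift_meas: "(\<lambda>(e, v). \<lambda>x\<in>I. e + v x) \<in> exp_dist l \<Otimes>\<^sub>M N \<rightarrow>\<^sub>M vectors I"
    unfolding case_prod_beta'
  proof (rule measurable_restrict)
    fix x assume x: "x \<in> I"
    have "(\<lambda>v. v x) \<in> borel_measurable N"
      unfolding measurable_cong_sets[OF sets_N refl] using x by (rule measurable_component_singleton)
    from measurable_compose[OF measurable_snd this]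
    show "(\<lambda>p. fst p + snd p x) \<in> borel_measurable (exp_dist l \<Otimes>\<^sub>M N)"
      by (intro borel_measurable_add) auto
  qed
  have prob': "prob_space (shift_law l I N)"
  proof -
    interpret pair_prob_space "exp_dist l" N ..
    show ?thesis unfolding shift_law_def by (rule prob_space_distr[OF shift_meas])
  qed
  have \<Phi>2: "(\<lambda>p. \<Phi> z (f p) (k p) x) \<in> borel_measurable M"
    if "z \<in> I" "x \<in> I" "f \<in> borel_measurable M" "k \<in> M \<rightarrow>\<^sub>M seeds" for f k z x and M :: "'b measure"
    using measurable_compose[OF measurable_Pair[OF that(3,4)] measurable_\<Phi>[OF that(1,2)]] by simp
  have Q2: "(\<lambda>p. \<theta>.trunc_quantile (f p) (u p)) \<in> borel_measurable M"
    if "f \<in> borel_measurable M" "u \<in> M \<rightarrow>\<^sub>M unif" for f u and M :: "'b measure"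
    using measurable_compose[OF measurable_Pair[OF that] \<theta>.measurable_trunc_quantile] by simp
  have law: "(\<integral>\<^sup>+v. g v \<partial>shift_law l I N) = (\<integral>\<^sup>+e. (\<integral>\<^sup>+v. g (\<lambda>x\<in>I. e + v x) \<partial>N) \<partial>exp_dist l)"
    if g: "g \<in> borel_measurable (vectors I)" for g
  proof -
    have "(\<integral>\<^sup>+v. g v \<partial>shift_law l I N) = (\<integral>\<^sup>+p. g (\<lambda>x\<in>I. fst p + snd p x) \<partial>(exp_dist l \<Otimes>\<^sub>M N))"
      unfolding shift_law_def using nn_integral_distr[OF shift_meas, of g] g by (simp add: case_prod_beta')
    also have "\<dots> = (\<integral>\<^sup>+e. (\<integral>\<^sup>+v. g (\<lambda>x\<in>I. e + v x) \<partial>N) \<partial>exp_dist l)"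
      using N.nn_integral_fst[OF measurable_compose[OF shift_meas g]] by (simp add: case_prod_beta')
    finally show ?thesis .
  qed
  have identity: "(\<integral>\<^sup>+v. g v \<partial>shift_law l I N)
      = (\<Sum>z\<in>I. \<integral>\<^sup>+w. (\<integral>\<^sup>+\<omega>. g (\<lambda>x\<in>I. w - \<Phi>' z w \<omega> x) \<partial>seeds) \<partial>\<nu>')"
    if g: "g \<in> borel_measurable (vectors I)" for g
  proof -
    define h where "h z w m = (\<integral>\<^sup>+\<omega>. g (\<lambda>x\<in>I. w - \<Phi> z m \<omega> x) \<partial>seeds)" for z w m
    have vec: "(\<lambda>p. g (\<lambda>x\<in>I. f p - \<Phi> z (k p) (\<omega> p) x)) \<in> borel_measurable M"
      if "z \<in> I" "f \<in> borel_measurable M" "k \<in> borel_measurable M" "\<omega> \<in> M \<rightarrow>\<^sub>M seeds" for f k \<omega> z and M :: "'b measure"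
      by (rule measurable_compose[OF measurable_restrict g]) (intro borel_measurable_diff that \<Phi>2)
    have h_meas: "(\<lambda>(w, m). h z w m) \<in> borel_measurable (borel \<Otimes>\<^sub>M borel)" if z: "z \<in> I" for z
    proof -
      have "(\<lambda>p. g (\<lambda>x\<in>I. fst (fst p) - \<Phi> z (snd (fst p)) (snd p) x)) \<in> borel_measurable ((borel \<Otimes>\<^sub>M borel) \<Otimes>\<^sub>M seeds)"
        by (rule vec[OF z]) simp_all
      from seeds.borel_measurable_nn_integral_fst[OF this]
      show ?thesis by (simp add: h_def case_prod_beta')
    qed
    have h2 [measurable]: "(\<lambda>p. h z (f p) (k p)) \<in> borel_measurable M"
      if "z \<in> I" "f \<in> borel_measurable M" "k \<in> borel_measurable M" for f k z and M :: "'b measure"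
      using measurable_compose[OF measurable_Pair[OF that(2,3)] h_meas[OF that(1)]] by simp
    have "(\<integral>\<^sup>+v. g v \<partial>shift_law l I N) = (\<integral>\<^sup>+e. (\<integral>\<^sup>+v. g (\<lambda>x\<in>I. e + v x) \<partial>N) \<partial>exp_dist l)"
      by (rule law[OF g])
    also have "\<dots> = (\<integral>\<^sup>+e. (\<Sum>z\<in>I. \<integral>\<^sup>+m. h z (e + m) m \<partial>\<nu>) \<partial>exp_dist l)"
    proof (rule nn_integral_cong)
      fix e :: real
      have "(\<lambda>v. g (\<lambda>x\<in>I. e + v x)) \<in> borel_measurable (vectors I)"
        by (rule measurable_compose[OF measurable_restrict g])
           (intro borel_measurable_add measurable_component_singleton measurable_const; simp)
      then have "(\<integral>\<^sup>+v. g (\<lambda>x\<in>I. e + v x) \<partial>N)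
          = (\<Sum>z\<in>I. \<integral>\<^sup>+m. (\<integral>\<^sup>+\<omega>. g (\<lambda>x\<in>I. e + (\<lambda>x\<in>I. m - \<Phi> z m \<omega> x) x) \<partial>seeds) \<partial>\<nu>)"
        by (rule nn_integral_N)
      moreover have eq: "(\<lambda>x\<in>I. e + (\<lambda>x\<in>I. m - \<Phi> z m \<omega> x) x) = (\<lambda>x\<in>I. (e + m) - \<Phi> z m \<omega> x)" for m z \<omega>
        by (rule restrict_ext) simp
      ultimately show "(\<integral>\<^sup>+v. g (\<lambda>x\<in>I. e + v x) \<partial>N) = (\<Sum>z\<in>I. \<integral>\<^sup>+m. h z (e + m) m \<partial>\<nu>)"
        by (simp only: h_def eq)
    qed
    also have "\<dots> = (\<Sum>z\<in>I. \<integral>\<^sup>+e. (\<integral>\<^sup>+m. h z (e + m) m \<partial>\<nu>) \<partial>exp_dist l)"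
    proof (rule nn_integral_sum)
      fix z assume z: "z \<in> I"
      have "(\<lambda>p. h z (fst p + snd p) (snd p)) \<in> borel_measurable (exp_dist l \<Otimes>\<^sub>M \<nu>)"
        by (intro h2 z) measurable
      from fm.borel_measurable_nn_integral_fst[OF this]
      show "(\<lambda>e. \<integral>\<^sup>+m. h z (e + m) m \<partial>\<nu>) \<in> borel_measurable (exp_dist l)" by simp
    qed
    also have "\<dots> = (\<Sum>z\<in>I. \<integral>\<^sup>+w. (\<integral>\<^sup>+\<omega>. g (\<lambda>x\<in>I. w - \<Phi>' z w \<omega> x) \<partial>seeds) \<partial>\<nu>')"
    proof (rule sum.cong[OF refl])
      fix z assume z: "z \<in> I"
      note h2 [OF z, measurable]
      have hm: "(\<lambda>e. \<integral>\<^sup>+m. h z (e + m) m \<partial>\<nu>) \<in> borel_measurable borel"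
      proof -
        have "(\<lambda>p. h z (fst p + snd p) (snd p)) \<in> borel_measurable (borel \<Otimes>\<^sub>M \<nu>)"
          by (intro h2 z) measurable
        from fm.borel_measurable_nn_integral_fst[OF this] show ?thesis by simp
      qed
      have h\<nu>: "(\<lambda>m. h z (e + m) m) \<in> borel_measurable borel" for e
        by (intro h2 z borel_measurable_add) simp_all
      have "(\<integral>\<^sup>+e. (\<integral>\<^sup>+m. h z (e + m) m \<partial>\<nu>) \<partial>exp_dist l)
          = (\<integral>\<^sup>+e. (\<integral>\<^sup>+m. ennreal (exponential_density l e) * h z (e + m) m \<partial>\<nu>) \<partial>lborel)"
        unfolding nn_integral_exp_dist[OF hm]
        by (intro nn_integral_cong nn_integral_cmult[symmetric]) (simp add: h\<nu>)
      also have "\<dots> = (\<integral>\<^sup>+m. (\<integral>\<^sup>+e. ennreal (exponential_density l e) * h z (e + m) m \<partial>lborel) \<partial>\<nu>)"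
        by (rule LN.Fubini') measurable
      also have "\<dots> = (\<integral>\<^sup>+m. (\<integral>\<^sup>+w. ennreal (exponential_density l (w - m)) * h z w m \<partial>lborel) \<partial>\<nu>)"
      proof (rule nn_integral_cong)
        fix m
        show "(\<integral>\<^sup>+e. ennreal (exponential_density l e) * h z (e + m) m \<partial>lborel)
            = (\<integral>\<^sup>+w. ennreal (exponential_density l (w - m)) * h z w m \<partial>lborel)"
          by (subst nn_integral_real_affine[where c=1 and t="- m"]) auto
      qed
      also have "\<dots> = (\<integral>\<^sup>+w. (\<integral>\<^sup>+m. ennreal (exponential_density l (w - m)) * h z w m \<partial>\<nu>) \<partial>lborel)"
        by (rule LN.Fubini'[symmetric]) measurable
      also have "\<dots> = (\<integral>\<^sup>+w. a w * ennreal (\<theta>.F w) * (\<integral>\<^sup>+u. h z w (\<theta>.trunc_quantile w u) \<partial>unif) \<partial>lborel)"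
      proof (rule nn_integral_cong)
        fix w
        have hw: "h z w \<in> borel_measurable borel" using z by measurable
        have "(\<integral>\<^sup>+m. ennreal (exponential_density l (w - m)) * h z w m \<partial>\<nu>)
            = (\<integral>\<^sup>+m. a w * (ennreal (exp (l * m)) * (h z w m * indicator {..w} m)) \<partial>\<nu>)"
        proof (rule nn_integral_cong)
          fix m
          show "ennreal (exponential_density l (w - m)) * h z w m
            = a w * (ennreal (exp (l * m)) * (h z w m * indicator {..w} m))"
          proof (cases "m \<le> w")
            case True
            then have "ennreal (exponential_density l (w - m)) = a w * ennreal (exp (l * m))"
              using l by (simp add: exponential_density_def a_def ennreal_mult[symmetric] exp_add[symmetric] algebra_simps)
            then show ?thesis using True by (simp add: mult_ac)
          next
            case False
            then show ?thesis by (simp add: exponential_density_def)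
          qed
        qed
        also have "\<dots> = a w * (\<integral>\<^sup>+m. ennreal (exp (l * m)) * (h z w m * indicator {..w} m) \<partial>\<nu>)"
        proof (rule nn_integral_cmult)
          have "(\<lambda>m. ennreal (exp (l * m))) \<in> borel_measurable borel" by simp
          then show "(\<lambda>m. ennreal (exp (l * m)) * (h z w m * indicator {..w} m)) \<in> borel_measurable \<nu>"
            unfolding measurable_nu by (intro borel_measurable_times_ennreal hw borel_measurable_indicator) simp_all
        qed
        also have "(\<integral>\<^sup>+m. ennreal (exp (l * m)) * (h z w m * indicator {..w} m) \<partial>\<nu>)
            = (\<integral>\<^sup>+m. h z w m * indicator {..w} m \<partial>\<theta>)"
          unfolding \<theta>_def using hw by (subst nn_integral_density) auto
        also have "\<dots> = ennreal (\<theta>.F w) * (\<integral>\<^sup>+u. h z w (\<theta>.trunc_quantile w u) \<partial>unif)"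
          by (rule \<theta>.nn_integral_trunc_quantile[OF hw])
        finally show "(\<integral>\<^sup>+m. ennreal (exponential_density l (w - m)) * h z w m \<partial>\<nu>)
            = a w * ennreal (\<theta>.F w) * (\<integral>\<^sup>+u. h z w (\<theta>.trunc_quantile w u) \<partial>unif)"
          by (simp add: mult.assoc)
      qed
      also have "\<dots> = (\<integral>\<^sup>+w. (\<integral>\<^sup>+u. h z w (\<theta>.trunc_quantile w u) \<partial>unif) \<partial>\<nu>')"
        unfolding \<nu>'_def
      proof (rule nn_integral_density[symmetric])
        have "(\<lambda>p. h z (fst p) (\<theta>.trunc_quantile (fst p) (snd p))) \<in> borel_measurable (lborel \<Otimes>\<^sub>M unif)"
          by (intro h2 z Q2) measurable
        from unif.borel_measurable_nn_integral_fst[OF this]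
        show "(\<lambda>w. \<integral>\<^sup>+u. h z w (\<theta>.trunc_quantile w u) \<partial>unif) \<in> borel_measurable lborel" by simp
      qed (use aF in simp)
      also have "\<dots> = (\<integral>\<^sup>+w. (\<integral>\<^sup>+\<omega>. g (\<lambda>x\<in>I. w - \<Phi>' z w \<omega> x) \<partial>seeds) \<partial>\<nu>')"
      proof (rule nn_integral_cong)
        fix w
        have "(\<lambda>p. g (\<lambda>x\<in>I. w - \<Phi> z (\<theta>.trunc_quantile w (fst p)) (snd p) x)) \<in> borel_measurable (unif \<Otimes>\<^sub>M seeds)"
          by (intro vec z Q2) simp_all
        from nn_integral_root_subtree[OF prob_space_unif this]
        show "(\<integral>\<^sup>+u. h z w (\<theta>.trunc_quantile w u) \<partial>unif) = (\<integral>\<^sup>+\<omega>. g (\<lambda>x\<in>I. w - \<Phi>' z w \<omega> x) \<partial>seeds)"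
          by (simp add: h_def \<Phi>'_def)
      qed
      finally show "(\<integral>\<^sup>+e. (\<integral>\<^sup>+m. h z (e + m) m \<partial>\<nu>) \<partial>exp_dist l)
        = (\<integral>\<^sup>+w. (\<integral>\<^sup>+\<omega>. g (\<lambda>x\<in>I. w - \<Phi>' z w \<omega> x) \<partial>seeds) \<partial>\<nu>')" .
    qed
    finally show ?thesis .
  qed
  have fh: "finite_halfline_measure \<nu>'"
    unfolding \<nu>'_def
  proof (rule finite_halfline_density_lborel)
    show "a w * ennreal (\<theta>.F w) = 0" if "w < 0" for w using that by (simp add: \<theta>.F_nonpos)
    show "0 < a w * ennreal (\<theta>.F w)" if "0 < w" for w
      using that l \<theta>.F_pos[of w] by (simp add: a_def ennreal_zero_less_mult_iff)
    have "of_nat (card I) * emeasure \<nu>' UNIV = (\<Sum>y\<in>I. \<integral>\<^sup>+w. (\<integral>\<^sup>+\<omega>. 1 \<partial>seeds) \<partial>\<nu>')"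
      by (simp add: seeds.emeasure_space_1 \<nu>'_def)
    also have "\<dots> = (\<integral>\<^sup>+v. 1 \<partial>shift_law l I N)"
      by (rule identity[symmetric]) simp
    also have "\<dots> = 1" using prob_space.emeasure_space_1[OF prob'] by simp
    finally have *: "of_nat (card I) * emeasure \<nu>' UNIV = 1" .
    have "emeasure \<nu>' UNIV \<noteq> top"
    proof
      assume "emeasure \<nu>' UNIV = top"
      then show False using * finite_I I_nonempty by (simp add: ennreal_mult_top)
    qed
    then show "emeasure (density lborel (\<lambda>w. a w * ennreal (\<theta>.F w))) UNIV < \<infinity>"
      by (simp add: \<nu>'_def less_top)
  qed (fact aF)
  have md: "min_decomposition \<nu>' I (shift_law l I N) \<Phi>'"
  proof (intro min_decomposition.intro min_decomposition_axioms.intro)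
    show "sets (shift_law l I N) = sets (vectors I)" by (simp add: shift_law_def)
    show "(\<lambda>(w, \<omega>). \<Phi>' z w \<omega> x) \<in> borel_measurable (borel \<Otimes>\<^sub>M seeds)" if "z \<in> I" "x \<in> I" for z x
      unfolding case_prod_beta' \<Phi>'_def
      by (intro \<Phi>2 that Q2 measurable_fst measurable_compose[OF measurable_snd measurable_subtree]
            measurable_compose[OF measurable_snd measurable_component_singleton]) simp
    show "\<Phi>' z s \<omega> x \<le> \<Phi>' z t \<omega> x" if "z \<in> I" "x \<in> I" "\<omega> \<in> space seeds" "s \<le> t" for z x \<omega> s t
      unfolding \<Phi>'_def
      by (intro \<Phi>_mono that subtree_seeds \<theta>.trunc_quantile_mono seeds_component)
    show "\<Phi>' z w \<omega> z = 0" if "z \<in> I" "\<omega> \<in> space seeds" for z w \<omega>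
      unfolding \<Phi>'_def by (intro \<Phi>_self that subtree_seeds)
    show "\<Phi>' z w \<omega> x < 0" if "z \<in> I" "x \<in> I" "x \<noteq> z" "\<omega> \<in> space seeds" for z x w \<omega>
      unfolding \<Phi>'_def by (intro \<Phi>_neg that subtree_seeds)
  qed (fact fh finite_I I_nonempty prob' identity)+
  interpret md: min_decomposition \<nu>' I "shift_law l I N" \<Phi>' by (rule md)
  define G' where "G' y = of_nat (card I) * emeasure \<nu> {y<..}" for y
  have G'_meas [measurable]: "G' \<in> borel_measurable borel"
    unfolding G'_def[abs_def] emeasure_greaterThan by measurable
  \<comment> \<open>The tail of the sum is a convolution; the substitution \<open>y = r - e\<close> turns it into a primitive.\<close>
  have tail: "of_nat (card I) * emeasure \<nu>' {r<..}
      = (ennreal l * ennreal (exp ((- l) * r))) * (\<integral>\<^sup>+y. (ennreal (exp (l * y)) * G' y) * indicator {..r} y \<partial>lborel)" for r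
  proof -
    let ?B = "\<lambda>r. above I r"
    have "of_nat (card I) * emeasure \<nu>' {r<..} = emeasure (shift_law l I N) (?B r)"
      by (rule md.emeasure_min_greater[symmetric])
    also have "\<dots> = (\<integral>\<^sup>+v. indicator (?B r) v \<partial>shift_law l I N)"
      by (rule nn_integral_indicator[symmetric]) (simp add: shift_law_def sets_min_greater)
    also have "\<dots> = (\<integral>\<^sup>+e. (\<integral>\<^sup>+v. indicator (?B r) (\<lambda>x\<in>I. e + v x) \<partial>N) \<partial>exp_dist l)"
      by (rule law) (simp add: sets_min_greater)
    also have "\<dots> = (\<integral>\<^sup>+e. G' (r - e) \<partial>exp_dist l)"
    proof (rule nn_integral_cong)
      fix e
      have "(\<integral>\<^sup>+v. indicator (?B r) (\<lambda>x\<in>I. e + v x) \<partial>N) = (\<integral>\<^sup>+v. indicator (?B (r - e)) v \<partial>N)"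
      proof (rule nn_integral_cong)
        fix v assume "v \<in> space N"
        then show "indicator (?B r) (\<lambda>x\<in>I. e + v x) = (indicator (?B (r - e)) v :: ennreal)"
          unfolding sp_N by (auto simp: indicator_def space_PiM algebra_simps)
      qed
      also have "\<dots> = emeasure N (?B (r - e))"
        by (rule nn_integral_indicator) (simp add: sets_N sets_min_greater)
      finally show "(\<integral>\<^sup>+v. indicator (?B r) (\<lambda>x\<in>I. e + v x) \<partial>N) = G' (r - e)"
        unfolding G'_def emeasure_min_greater .
    qed
    also have "\<dots> = (\<integral>\<^sup>+e. ennreal (exponential_density l e) * G' (r - e) \<partial>lborel)"
      by (rule nn_integral_exp_dist) measurable
    also have "\<dots> = (\<integral>\<^sup>+y. ennreal (exponential_density l (r - y)) * G' y \<partial>lborel)"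
      by (subst nn_integral_real_affine[where c="-1" and t=r]) auto
    also have "\<dots> = (\<integral>\<^sup>+y. (ennreal l * ennreal (exp ((- l) * r))) * ((ennreal (exp (l * y)) * G' y) * indicator {..r} y) \<partial>lborel)"
    proof (rule nn_integral_cong)
      fix y
      show "ennreal (exponential_density l (r - y)) * G' y
        = (ennreal l * ennreal (exp ((- l) * r))) * ((ennreal (exp (l * y)) * G' y) * indicator {..r} y)"
      proof (cases "y \<le> r")
        case True
        then have "ennreal (exponential_density l (r - y)) = ennreal l * ennreal (exp ((- l) * r)) * ennreal (exp (l * y))"
          using l by (simp add: exponential_density_def ennreal_mult[symmetric] exp_add[symmetric] algebra_simps)
        then show ?thesis using True by (simp add: mult_ac)
      next
        case False
        then show ?thesis by (simp add: exponential_density_def)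
      qed
    qed
    also have "\<dots> = (ennreal l * ennreal (exp ((- l) * r))) * (\<integral>\<^sup>+y. (ennreal (exp (l * y)) * G' y) * indicator {..r} y \<partial>lborel)"
      by (rule nn_integral_cmult) measurable
    finally show ?thesis .
  qed
  have "log_concave (\<lambda>r. of_nat (card I) * emeasure \<nu>' {r<..})"
    unfolding tail
  proof (intro log_concave_mult log_concave_const log_concave_exp log_concave_primitive)
    show "log_concave G'"
      unfolding G'_def[abs_def] by (intro log_concave_mult log_concave_const tail_log_concave)
  qed measurable
  then have "log_concave (\<lambda>r. emeasure \<nu>' {r<..})"
    by (rule log_concave_cancel) (use finite_I I_nonempty in auto)
  with md have "log_concave_min_decomposition \<nu>' I (shift_law l I N) \<Phi>'"
    by (intro log_concave_min_decomposition.intro log_concave_min_decomposition_axioms.intro)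
  then show ?thesis by blast
qed

section \<open>Passage times in the tree\<close>

lemma level_0: "level d 0 = {[]}"
  by (auto simp: level_def tree_def)

lemma level_Suc: "level d (Suc h) = join_index d (level d h)"
  by (auto simp: level_def tree_def join_index_def length_Suc_conv)

text \<open>The law of the passage times from the root to level \<open>h\<close>, the weight of the root included, when the
  weights at distance \<open>k\<close> from the root have mean \<open>c * \<alpha> ^ k\<close>.\<close>

fun tree_law :: "real \<Rightarrow> nat \<Rightarrow> nat \<Rightarrow> real \<Rightarrow> (nat list \<Rightarrow> real) measure" where
  "tree_law \<alpha> d 0 c = base_law (1 / c)"
| "tree_law \<alpha> d (Suc h) c =
    shift_law (1 / c) (level d (Suc h)) (join_law d (level d h) (tree_law \<alpha> d h (c * \<alpha>)))"

lemma tree_law_decomposition: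
  assumes "0 < d" "0 < \<alpha>" "0 < c"
  shows "\<exists>\<nu> \<Phi>. log_concave_min_decomposition \<nu> (level d h) (tree_law \<alpha> d h c) \<Phi>"
  using assms(3)
proof (induction h arbitrary: c)
  case 0
  then show ?case using base_decomposition[of "1 / c"] by (simp add: level_0)
next
  case (Suc h)
  then have c: "0 < c * \<alpha>" using assms by simp
  obtain \<nu> \<Phi> where "log_concave_min_decomposition \<nu> (level d h) (tree_law \<alpha> d h (c * \<alpha>)) \<Phi>"
    using Suc.IH[OF c] by blast
  then obtain \<nu>' \<Phi>' where "log_concave_min_decomposition \<nu>' (level d (Suc h))
      (join_law d (level d h) (tree_law \<alpha> d h (c * \<alpha>))) \<Phi>'"
    using log_concave_min_decomposition.join_decomposition[OF _ assms(1)] unfolding level_Suc by blast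
  then show ?case
    using log_concave_min_decomposition.shift_decomposition[of _ _ _ _ "1 / c"] Suc.prems by simp
qed

text \<open>Independent exponential weights of mean one at all vertices.\<close>

abbreviation exp_field :: "(nat list \<Rightarrow> real) measure" where
  "exp_field \<equiv> tree_prod (exp_dist 1)"

text \<open>The passage time from the root to a vertex, the weight of the root being scaled by \<open>c\<close>; see \<open>path_sum_eq\<close>.\<close>

fun path_sum :: "real \<Rightarrow> real \<Rightarrow> (nat list \<Rightarrow> real) \<Rightarrow> nat list \<Rightarrow> real" where
  "path_sum c \<alpha> u [] = c * u []"
| "path_sum c \<alpha> u (i # x) = c * u [] + path_sum (c * \<alpha>) \<alpha> (subtree i u) x"

lemma prefixes_Cons: "{y. prefix y (i # x)} = insert [] ((#) i ` {y. prefix y x})"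
  by (auto simp: prefix_Cons)

lemma finite_prefixes: "finite {y. prefix y x}"
  by (induction x) (simp_all add: prefixes_Cons)

lemma path_sum_eq: "path_sum c \<alpha> u x = (\<Sum>y | prefix y x. c * \<alpha> ^ length y * u y)"
proof (induction x arbitrary: c u)
  case Nil
  then show ?case by simp
next
  case (Cons i x)
  have "(\<Sum>y | prefix y (i # x). c * \<alpha> ^ length y * u y)
      = c * u [] + (\<Sum>y\<in>(#) i ` {y. prefix y x}. c * \<alpha> ^ length y * u y)"
    unfolding prefixes_Cons using finite_prefixes by (subst sum.insert) auto
  also have "(\<Sum>y\<in>(#) i ` {y. prefix y x}. c * \<alpha> ^ length y * u y)
      = (\<Sum>y | prefix y x. c * \<alpha> * \<alpha> ^ length y * subtree i u y)"
    by (subst sum.reindex) (auto simp: subtree_def mult_ac)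
  finally show ?case by (simp add: Cons.IH)
qed

lemma T_eq_path_sum: "T \<alpha> U x \<omega> = path_sum 1 \<alpha> (\<lambda>y. U y \<omega>) x"
  by (simp add: T_def path_sum_eq)

text \<open>Without the weight of the root, the passage time is that inside the tree above a child of the root.\<close>

lemma T0_Cons: "T0 \<alpha> U (i # x) \<omega> = path_sum \<alpha> \<alpha> (subtree i (\<lambda>y. U y \<omega>)) x"
  by (simp add: T0_def T_eq_path_sum)

lemma measurable_path_sum:
  assumes "\<And>y. prefix y x \<Longrightarrow> (\<lambda>p. u p y) \<in> borel_measurable M"
  shows "(\<lambda>p. path_sum c \<alpha> (u p) x) \<in> borel_measurable M"
  unfolding path_sum_eq using assms by (intro borel_measurable_sum borel_measurable_times) auto

lemma measurable_exp_component: "(\<lambda>\<omega>. \<omega> y) \<in> borel_measurable exp_field"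
  using measurable_component_singleton[of y UNIV "\<lambda>_. exp_dist 1"]
  by (simp add: measurable_cong_sets[OF refl sets_exp_dist])

lemma nn_integral_exp_scale:
  assumes c: "0 < c" and f: "f \<in> borel_measurable borel"
  shows "(\<integral>\<^sup>+e. f (c * e) \<partial>exp_dist 1) = (\<integral>\<^sup>+e. f e \<partial>exp_dist (1 / c))"
proof -
  note f [measurable]
  have "(\<integral>\<^sup>+e. f e \<partial>exp_dist (1 / c)) = (\<integral>\<^sup>+e. ennreal (exponential_density (1 / c) e) * f e \<partial>lborel)"
    by (rule nn_integral_exp_dist[OF f])
  also have "\<dots> = ennreal c * (\<integral>\<^sup>+e. ennreal (exponential_density (1 / c) (0 + c * e)) * f (0 + c * e) \<partial>lborel)"
    using c by (subst nn_integral_real_affine[where c=c and t=0]) auto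
  also have "\<dots> = (\<integral>\<^sup>+e. ennreal c * (ennreal (exponential_density (1 / c) (0 + c * e)) * f (0 + c * e)) \<partial>lborel)"
    by (rule nn_integral_cmult[symmetric]) measurable
  also have "\<dots> = (\<integral>\<^sup>+e. ennreal (exponential_density 1 e) * f (c * e) \<partial>lborel)"
  proof (rule nn_integral_cong)
    fix e
    have "c * exponential_density (1 / c) (c * e) = exponential_density 1 e"
      using c by (simp add: exponential_density_def mult_less_0_iff)
    then have "ennreal c * ennreal (exponential_density (1 / c) (c * e)) = ennreal (exponential_density 1 e)"
      using c by (simp add: ennreal_mult[symmetric] exponential_density_nonneg)
    then show "ennreal c * (ennreal (exponential_density (1 / c) (0 + c * e)) * f (0 + c * e))
      = ennreal (exponential_density 1 e) * f (c * e)"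
      by (simp add: mult.assoc[symmetric])
  qed
  also have "\<dots> = (\<integral>\<^sup>+e. f (c * e) \<partial>exp_dist 1)"
    by (rule nn_integral_exp_dist[symmetric]) measurable
  finally show ?thesis by simp
qed

text \<open>The passage times to the vertices in \<open>L\<close>.\<close>

definition path_vec :: "real \<Rightarrow> real \<Rightarrow> nat list set \<Rightarrow> (nat list \<Rightarrow> real) \<Rightarrow> nat list \<Rightarrow> real" where
  "path_vec c \<alpha> L u = (\<lambda>x\<in>L. path_sum c \<alpha> u x)"

lemma measurable_path_vec: "path_vec c \<alpha> L \<in> exp_field \<rightarrow>\<^sub>M vectors L"
  unfolding path_vec_def
  by (intro measurable_restrict measurable_path_sum measurable_exp_component)

lemma nn_integral_join_law:
  assumes N: "sets N = sets (vectors L)" and g: "g \<in> borel_measurable (vectors (join_index d L))"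
  shows "(\<integral>\<^sup>+v. g v \<partial>join_law d L N) = (\<integral>\<^sup>+v. g (join_vec d L v) \<partial>PiM {..<d} (\<lambda>_. N))"
proof -
  have sets_PN: "sets (PiM {..<d} (\<lambda>_. N)) = sets (PiM {..<d} (\<lambda>_. vectors L))"
    by (rule sets_PiM_cong) (auto simp: N)
  have "join_vec d L \<in> PiM {..<d} (\<lambda>_. N) \<rightarrow>\<^sub>M vectors (join_index d L)"
    unfolding measurable_cong_sets[OF sets_PN refl] by (rule measurable_join)
  then show ?thesis unfolding join_law_def using g by (intro nn_integral_distr) auto
qed

lemma join_path_vec:
  assumes N: "distr exp_field (vectors L) (path_vec c \<alpha> L) = N"
    and g: "g \<in> borel_measurable (vectors (join_index d L))"
  shows "(\<integral>\<^sup>+\<xi>. g (join_vec d L (\<lambda>i\<in>{..<d}. path_vec c \<alpha> L (\<xi> i))) \<partial>PiM {..<d} (\<lambda>_. exp_field))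
    = (\<integral>\<^sup>+v. g v \<partial>join_law d L N)"
proof -
  have P: "prob_space exp_field"
    by (intro prob_space_tree_prod prob_space_exp_dist) simp
  have setsN: "sets N = sets (vectors L)" unfolding N[symmetric] by simp
  have pN: "prob_space N"
    unfolding N[symmetric] by (rule prob_space.prob_space_distr[OF P measurable_path_vec])
  have m: "path_vec c \<alpha> L \<in> exp_field \<rightarrow>\<^sub>M N"
    unfolding measurable_cong_sets[OF refl setsN] by (rule measurable_path_vec)
  have "PiM {..<d} (\<lambda>_. N) = PiM {..<d} (\<lambda>_. distr exp_field N (path_vec c \<alpha> L))"
    using distr_cong[OF refl setsN[symmetric], of "exp_field" "path_vec c \<alpha> L"] N by simp
  also have "\<dots> = distr (PiM {..<d} (\<lambda>_. exp_field)) (PiM {..<d} (\<lambda>_. N)) (compose {..<d} (path_vec c \<alpha> L))"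
    by (rule distr_PiM_finite_prob_space'[symmetric]) (use P pN m in auto)
  finally have PN: "PiM {..<d} (\<lambda>_. N)
      = distr (PiM {..<d} (\<lambda>_. exp_field)) (PiM {..<d} (\<lambda>_. N)) (compose {..<d} (path_vec c \<alpha> L))" .
  have sets_PN: "sets (PiM {..<d} (\<lambda>_. N)) = sets (PiM {..<d} (\<lambda>_. vectors L))"
    by (rule sets_PiM_cong) (auto simp: setsN)
  have gj: "(\<lambda>v. g (join_vec d L v)) \<in> borel_measurable (PiM {..<d} (\<lambda>_. N))"
    unfolding measurable_cong_sets[OF sets_PN refl] by (rule measurable_compose[OF measurable_join g])
  have cm: "compose {..<d} (path_vec c \<alpha> L) \<in> PiM {..<d} (\<lambda>_. exp_field) \<rightarrow>\<^sub>M PiM {..<d} (\<lambda>_. N)"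
    unfolding compose_def by (rule measurable_restrict_map[OF m])
  have "(\<integral>\<^sup>+v. g v \<partial>join_law d L N) = (\<integral>\<^sup>+v. g (join_vec d L v) \<partial>PiM {..<d} (\<lambda>_. N))"
    by (rule nn_integral_join_law[OF setsN g])
  also have "\<dots> = (\<integral>\<^sup>+\<xi>. g (join_vec d L (compose {..<d} (path_vec c \<alpha> L) \<xi>)) \<partial>PiM {..<d} (\<lambda>_. exp_field))"
    by (subst PN, rule nn_integral_distr[OF cm]) (use gj in simp)
  finally show ?thesis unfolding compose_def by (rule sym)
qed

lemma subtrees_path_vec:
  assumes N: "distr exp_field (vectors L) (path_vec c \<alpha> L) = N"
    and g: "g \<in> borel_measurable (vectors (join_index d L))"
  shows "(\<integral>\<^sup>+\<omega>. g (join_vec d L (\<lambda>i\<in>{..<d}. path_vec c \<alpha> L (subtree i \<omega>))) \<partial>exp_field)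
    = (\<integral>\<^sup>+v. g v \<partial>join_law d L N)"
proof -
  let ?F = "\<lambda>\<xi>. g (join_vec d L (\<lambda>i\<in>{..<d}. path_vec c \<alpha> L (\<xi> i)))"
  have "?F \<in> borel_measurable (PiM {..<d} (\<lambda>_. exp_field))"
    by (rule measurable_compose[OF measurable_compose[OF measurable_restrict_map[OF measurable_path_vec] measurable_join] g])
  from nn_integral_subtrees[OF prob_space_exp_dist this]
  have "(\<integral>\<^sup>+\<omega>. ?F (\<lambda>i\<in>{..<d}. subtree i \<omega>) \<partial>exp_field)
      = (\<integral>\<^sup>+\<xi>. ?F \<xi> \<partial>PiM {..<d} (\<lambda>_. exp_field))" by simp
  moreover have eq: "(\<lambda>i\<in>{..<d}. path_vec c \<alpha> L ((\<lambda>i\<in>{..<d}. subtree i \<omega>) i)) = (\<lambda>i\<in>{..<d}. path_vec c \<alpha> L (subtree i \<omega>))" for \<omega>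
    by (rule restrict_ext) simp
  ultimately show ?thesis by (simp only: eq join_path_vec[OF N g])
qed

lemma path_vec_law:
  assumes "0 < d" "0 < \<alpha>" "0 < c"
  shows "distr exp_field (vectors (level d h)) (path_vec c \<alpha> (level d h)) = tree_law \<alpha> d h c"
  using assms(3)
proof (induction h arbitrary: c)
  case 0
  show ?case
  proof (rule measure_eqI_nn_integral)
    fix g :: "_ \<Rightarrow> ennreal"
    assume "g \<in> borel_measurable (distr exp_field (vectors (level d 0)) (path_vec c \<alpha> (level d 0)))"
    then have g: "g \<in> borel_measurable (vectors {[]})" by (simp add: level_0)
    have ge: "(\<lambda>e. g (\<lambda>x\<in>{[]}. e)) \<in> borel_measurable borel"
      by (rule measurable_compose[OF measurable_restrict g]) simp
    interpret product_prob_space "\<lambda>_::nat list. exp_dist 1" UNIV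
      using prob_space_exp_dist[of 1]
      by (simp add: product_prob_space_def product_prob_space_axioms_def product_sigma_finite_def prob_space_imp_sigma_finite)
    have "(\<integral>\<^sup>+v. g v \<partial>distr exp_field (vectors {[]}) (path_vec c \<alpha> {[]}))
        = (\<integral>\<^sup>+\<omega>. g (\<lambda>x\<in>{[]}. c * \<omega> []) \<partial>exp_field)"
      by (subst nn_integral_distr[OF measurable_path_vec])
         (use g in \<open>auto simp: path_vec_def intro!: nn_integral_cong arg_cong[where f=g] restrict_ext\<close>)
    also have "\<dots> = (\<integral>\<^sup>+e. g (\<lambda>x\<in>{[]}. c * e) \<partial>distr exp_field (exp_dist 1) (\<lambda>\<omega>. \<omega> []))"
    proof (rule nn_integral_distr[symmetric])
      show "(\<lambda>e. g (\<lambda>x\<in>{[]}. c * e)) \<in> borel_measurable (distr exp_field (exp_dist 1) (\<lambda>\<omega>. \<omega> []))"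
        using measurable_compose[OF _ ge, of "\<lambda>e. c * e" borel] by simp
    qed simp
    also have "distr exp_field (exp_dist 1) (\<lambda>\<omega>. \<omega> []) = exp_dist 1"
      by (rule PiM_component) simp
    also have "(\<integral>\<^sup>+e. g (\<lambda>x\<in>{[]}. c * e) \<partial>exp_dist 1) = (\<integral>\<^sup>+e. g (\<lambda>x\<in>{[]}. e) \<partial>exp_dist (1 / c))"
      by (rule nn_integral_exp_scale[OF 0 ge])
    also have "\<dots> = (\<integral>\<^sup>+v. g v \<partial>base_law (1 / c))"
      unfolding base_law_def
      by (rule nn_integral_distr[symmetric], intro measurable_restrict measurable_ident_sets sets_exp_dist)
         (use g in simp)
    finally show "(\<integral>\<^sup>+v. g v \<partial>distr exp_field (vectors (level d 0)) (path_vec c \<alpha> (level d 0)))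
        = (\<integral>\<^sup>+v. g v \<partial>tree_law \<alpha> d 0 c)" by (simp add: level_0)
  qed (simp add: base_law_def level_0)
next
  case (Suc h)
  let ?L = "level d h" and ?L' = "level d (Suc h)"
  let ?N = "tree_law \<alpha> d h (c * \<alpha>)"
  have c': "0 < c * \<alpha>" using Suc.prems assms by simp
  note IH = Suc.IH[OF c']
  obtain \<nu> \<Phi> where "log_concave_min_decomposition \<nu> ?L ?N \<Phi>"
    using tree_law_decomposition[OF assms(1,2) c'] by blast
  then interpret log_concave_min_decomposition \<nu> ?L ?N \<Phi> .
  show ?case
  proof (rule measure_eqI_nn_integral)
    fix g :: "_ \<Rightarrow> ennreal"
    assume "g \<in> borel_measurable (distr exp_field (vectors ?L') (path_vec c \<alpha> ?L'))"
    then have g: "g \<in> borel_measurable (vectors ?L')" by simp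
    have shift: "(\<lambda>p. \<lambda>y\<in>?L'. f p + k p y) \<in> M \<rightarrow>\<^sub>M vectors ?L'"
      if "f \<in> borel_measurable M" "k \<in> M \<rightarrow>\<^sub>M vectors ?L'" for f k and M :: "'b measure"
      by (intro measurable_restrict borel_measurable_add that measurable_compose[OF that(2) measurable_component_singleton])
    let ?W = "\<lambda>\<xi>. join_vec d ?L (\<lambda>i\<in>{..<d}. path_vec (c * \<alpha>) \<alpha> ?L (\<xi> i))"
    have W: "?W \<in> PiM {..<d} (\<lambda>_. exp_field) \<rightarrow>\<^sub>M vectors ?L'"
      unfolding level_Suc by (rule measurable_compose[OF measurable_restrict_map[OF measurable_path_vec] measurable_join])
    have vec: "path_vec c \<alpha> ?L' \<omega> = (\<lambda>y\<in>?L'. c * \<omega> [] + ?W (\<lambda>i\<in>{..<d}. subtree i \<omega>) y)" for \<omega>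
      unfolding path_vec_def
    proof (rule restrict_ext)
      fix y assume "y \<in> ?L'"
      then obtain i x where y: "y = i # x" "i < d" "x \<in> ?L" "y \<in> join_index d ?L"
        unfolding level_Suc by (auto simp: join_index_def)
      then show "path_sum c \<alpha> \<omega> y = c * \<omega> [] + join_vec d ?L (\<lambda>i\<in>{..<d}. \<lambda>x\<in>?L. path_sum (c * \<alpha>) \<alpha> ((\<lambda>i\<in>{..<d}. subtree i \<omega>) i) x) y"
        by (simp add: join_vec_def)
    qed
    let ?F = "\<lambda>p. g (\<lambda>y\<in>?L'. c * fst p + ?W (snd p) y)"
    have fst1: "(\<lambda>p. c * fst p) \<in> borel_measurable (exp_dist 1 \<Otimes>\<^sub>M X)" for X :: "'x measure"
    proof -
      have "fst \<in> exp_dist 1 \<Otimes>\<^sub>M X \<rightarrow>\<^sub>M exp_dist 1" by simp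
      then have "fst \<in> borel_measurable (exp_dist 1 \<Otimes>\<^sub>M X)" by (simp add: measurable_cong_sets[OF refl sets_exp_dist])
      then show ?thesis by simp
    qed
    have F: "?F \<in> borel_measurable (exp_dist 1 \<Otimes>\<^sub>M PiM {..<d} (\<lambda>_. exp_field))"
      by (rule measurable_compose[OF shift g]) (intro fst1 measurable_compose[OF measurable_snd W])+
    have gadd: "(\<lambda>v. g (\<lambda>y\<in>?L'. e + v y)) \<in> borel_measurable (vectors ?L')" for e
      by (rule measurable_compose[OF shift g]) simp_all
    interpret J: prob_space "join_law d ?L ?N"
    proof -
      obtain \<nu>' \<Phi>' where "log_concave_min_decomposition \<nu>' (join_index d ?L) (join_law d ?L ?N) \<Phi>'"
        using join_decomposition[OF assms(1)] by blast
      then interpret J: log_concave_min_decomposition \<nu>' "join_index d ?L" "join_law d ?L ?N" \<Phi>' .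
      show "prob_space (join_law d ?L ?N)" by (rule J.prob_N)
    qed
    have sJ: "sets (join_law d ?L ?N) = sets (vectors ?L')" by (simp add: join_law_def level_Suc)
    have "(\<integral>\<^sup>+v. g v \<partial>distr exp_field (vectors ?L') (path_vec c \<alpha> ?L'))
        = (\<integral>\<^sup>+\<omega>. g (path_vec c \<alpha> ?L' \<omega>) \<partial>exp_field)"
      by (rule nn_integral_distr[OF measurable_path_vec]) (use g in simp)
    also have "\<dots> = (\<integral>\<^sup>+\<omega>. ?F (\<omega> [], \<lambda>i\<in>{..<d}. subtree i \<omega>) \<partial>exp_field)"
      by (simp only: vec fst_conv snd_conv)
    also have "\<dots> = (\<integral>\<^sup>+b. (\<integral>\<^sup>+\<xi>. ?F (b, \<xi>) \<partial>PiM {..<d} (\<lambda>_. exp_field)) \<partial>exp_dist 1)"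
      by (rule nn_integral_tree_prod[OF prob_space_exp_dist F]) simp
    also have "\<dots> = (\<integral>\<^sup>+b. (\<integral>\<^sup>+v. g (\<lambda>y\<in>?L'. c * b + v y) \<partial>join_law d ?L ?N) \<partial>exp_dist 1)"
    proof (rule nn_integral_cong)
      fix b
      show "(\<integral>\<^sup>+\<xi>. ?F (b, \<xi>) \<partial>PiM {..<d} (\<lambda>_. exp_field))
          = (\<integral>\<^sup>+v. g (\<lambda>y\<in>?L'. c * b + v y) \<partial>join_law d ?L ?N)"
        using join_path_vec[OF IH, of "\<lambda>v. g (\<lambda>y\<in>?L'. c * b + v y)" d] gadd[of "c * b"]
        by (simp only: level_Suc fst_conv snd_conv)
    qed
    also have "\<dots> = (\<integral>\<^sup>+b. (\<integral>\<^sup>+v. g (\<lambda>y\<in>?L'. b + v y) \<partial>join_law d ?L ?N) \<partial>exp_dist (1 / c))"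
    proof (rule nn_integral_exp_scale[OF Suc.prems])
      have "(\<lambda>p. g (\<lambda>y\<in>?L'. fst p + snd p y)) \<in> borel_measurable (borel \<Otimes>\<^sub>M join_law d ?L ?N)"
        by (rule measurable_compose[OF shift g])
           (unfold measurable_cong_sets[OF refl sJ, symmetric], simp_all)
      from J.borel_measurable_nn_integral_fst[OF this]
      show "(\<lambda>b. \<integral>\<^sup>+v. g (\<lambda>y\<in>?L'. b + v y) \<partial>join_law d ?L ?N) \<in> borel_measurable borel" by simp
    qed
    also have "\<dots> = (\<integral>\<^sup>+v. g v \<partial>tree_law \<alpha> d (Suc h) c)"
    proof -
      have m: "(\<lambda>p. \<lambda>y\<in>?L'. fst p + snd p y) \<in> exp_dist (1 / c) \<Otimes>\<^sub>M join_law d ?L ?N \<rightarrow>\<^sub>M vectors ?L'"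
      proof (rule shift)
        have "fst \<in> exp_dist (1 / c) \<Otimes>\<^sub>M join_law d ?L ?N \<rightarrow>\<^sub>M exp_dist (1 / c)" by simp
        then show "fst \<in> borel_measurable (exp_dist (1 / c) \<Otimes>\<^sub>M join_law d ?L ?N)"
          by (simp add: measurable_cong_sets[OF refl sets_exp_dist])
        show "snd \<in> exp_dist (1 / c) \<Otimes>\<^sub>M join_law d ?L ?N \<rightarrow>\<^sub>M vectors ?L'"
          unfolding measurable_cong_sets[OF refl sJ, symmetric] by simp
      qed
      have "(\<integral>\<^sup>+v. g v \<partial>tree_law \<alpha> d (Suc h) c)
          = (\<integral>\<^sup>+p. g (\<lambda>y\<in>?L'. fst p + snd p y) \<partial>(exp_dist (1 / c) \<Otimes>\<^sub>M join_law d ?L ?N))"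
        using nn_integral_distr[OF m, of g] g by (simp add: shift_law_def case_prod_beta')
      also have "\<dots> = (\<integral>\<^sup>+b. (\<integral>\<^sup>+v. g (\<lambda>y\<in>?L'. b + v y) \<partial>join_law d ?L ?N) \<partial>exp_dist (1 / c))"
        using J.nn_integral_fst[OF measurable_compose[OF m g]] by simp
      finally show ?thesis by simp
    qed
    finally show "(\<integral>\<^sup>+v. g v \<partial>distr exp_field (vectors ?L') (path_vec c \<alpha> ?L'))
        = (\<integral>\<^sup>+v. g v \<partial>tree_law \<alpha> d (Suc h) c)" .
  qed (simp add: shift_law_def)
qed

section \<open>Conditioning on the minimiser\<close>

text \<open>The minimum, its position and the gaps as functions of a vector. As in the definition of \<^const>\<open>First\<close>, the position
  is unspecified if the minimum is attained more than once.\<close>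

definition inf_vec :: "nat list set \<Rightarrow> (nat list \<Rightarrow> real) \<Rightarrow> real" where
  "inf_vec I v = (INF x\<in>I. v x)"

definition argmin_vec :: "nat list set \<Rightarrow> (nat list \<Rightarrow> real) \<Rightarrow> nat list" where
  "argmin_vec I v = (THE z. z \<in> I \<and> v z = inf_vec I v)"

definition gap_vec :: "nat list set \<Rightarrow> (nat list \<Rightarrow> real) \<Rightarrow> nat list \<Rightarrow> real" where
  "gap_vec I v = (\<lambda>x\<in>I. inf_vec I v - v x)"

lemma inf_vec_Min: "finite I \<Longrightarrow> I \<noteq> {} \<Longrightarrow> inf_vec I v = Min (v ` I)"
  unfolding inf_vec_def by (simp add: cInf_eq_Min)

lemma measurable_inf_vec:
  assumes "finite I" "I \<noteq> {}"
  shows "inf_vec I \<in> borel_measurable (vectors I)"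
proof -
  have "(\<lambda>v. Min ((\<lambda>x. v x) ` I)) \<in> borel_measurable (vectors I)"
    using assms by (intro borel_measurable_Min) auto
  then show ?thesis using inf_vec_Min[OF assms] by (simp add: fun_eq_iff cong: measurable_cong)
qed

lemma measurable_gap_vec:
  assumes "finite I" "I \<noteq> {}"
  shows "gap_vec I \<in> vectors I \<rightarrow>\<^sub>M nonpos_space I"
  unfolding gap_vec_def nonpos_space_def
proof (rule measurable_restrict, rule measurable_restrict_space2)
  fix x assume x: "x \<in> I"
  show "(\<lambda>v. inf_vec I v - v x) \<in> borel_measurable (vectors I)"
    using x by (intro borel_measurable_diff measurable_inf_vec assms) simp
  show "(\<lambda>v. inf_vec I v - v x) \<in> space (vectors I) \<rightarrow> {..0}"
    using x assms by (auto simp: inf_vec_Min)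
qed

text \<open>The unspecified value may depend on the set of minimisers, but only on it, and there are finitely
  many such sets.\<close>

lemma sets_argmin_vec:
  assumes "finite I" "I \<noteq> {}"
  shows "{v \<in> space (vectors I). argmin_vec I v = z} \<in> sets (vectors I)"
proof -
  let ?A = "\<lambda>S. {v \<in> space (vectors I). \<forall>x\<in>I. (x \<in> S) = (v x = inf_vec I v)}"
  have "{v \<in> space (vectors I). argmin_vec I v = z} = (\<Union>S\<in>{S \<in> Pow I. (THE z. z \<in> S) = z}. ?A S)"
  proof (intro set_eqI iffI)
    fix v assume v: "v \<in> {v \<in> space (vectors I). argmin_vec I v = z}"
    then have "v \<in> ?A {x \<in> I. v x = inf_vec I v}" "(THE z. z \<in> {x \<in> I. v x = inf_vec I v}) = z"
      by (auto simp: argmin_vec_def)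
    then show "v \<in> (\<Union>S\<in>{S \<in> Pow I. (THE z. z \<in> S) = z}. ?A S)"
      by (intro UN_I[where a="{x \<in> I. v x = inf_vec I v}"]) auto
  next
    fix v assume "v \<in> (\<Union>S\<in>{S \<in> Pow I. (THE z. z \<in> S) = z}. ?A S)"
    then obtain S where S: "S \<subseteq> I" "(THE z. z \<in> S) = z" "v \<in> ?A S" by auto
    then have "(\<lambda>z. z \<in> I \<and> v z = inf_vec I v) = (\<lambda>z. z \<in> S)" by (auto simp: fun_eq_iff)
    then show "v \<in> {v \<in> space (vectors I). argmin_vec I v = z}"
      using S by (simp add: argmin_vec_def)
  qed
  also have "\<dots> \<in> sets (vectors I)"
  proof (rule sets.finite_UN)
    show "finite {S \<in> Pow I. (THE z. z \<in> S) = z}" using assms by simp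
    fix S
    show "?A S \<in> sets (vectors I)"
    proof (rule sets.sets_Collect_finite_All[OF _ assms(1)])
      fix x assume x: "x \<in> I"
      have vx: "(\<lambda>v. v x) \<in> borel_measurable (vectors I)" using x by simp
      have "{v \<in> space (vectors I). v x = inf_vec I v} \<in> sets (vectors I)"
        by (rule borel_measurable_eq[OF vx measurable_inf_vec[OF assms]])
      moreover have "{v \<in> space (vectors I). v x \<noteq> inf_vec I v} \<in> sets (vectors I)"
        by (rule borel_measurable_neq[OF vx measurable_inf_vec[OF assms]])
      ultimately show "{v \<in> space (vectors I). (x \<in> S) = (v x = inf_vec I v)} \<in> sets (vectors I)"
        by (cases "x \<in> S") simp_all
    qed
  qed
  finally show ?thesis .
qed

context min_decomposition
begin

text \<open>The conditional law of the gaps given that the minimum is attained at \<open>z\<close> and equals \<open>t\<close>.\<close>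

definition gap_kernel :: "nat list \<Rightarrow> real \<Rightarrow> (nat list \<Rightarrow> real) measure" where
  "gap_kernel z t = distr seeds (nonpos_space I) (\<lambda>\<omega>. \<lambda>x\<in>I. \<Phi> z t \<omega> x)"

lemma measurable_gaps:
  assumes z: "z \<in> I"
  shows "(\<lambda>(t, \<omega>). \<lambda>x\<in>I. \<Phi> z t \<omega> x) \<in> borel \<Otimes>\<^sub>M seeds \<rightarrow>\<^sub>M nonpos_space I"
  unfolding case_prod_beta' nonpos_space_def
proof (rule measurable_restrict, rule measurable_restrict_space2)
  fix x assume x: "x \<in> I"
  show "(\<lambda>p. \<Phi> z (fst p) (snd p) x) \<in> borel_measurable (borel \<Otimes>\<^sub>M seeds)"
    using measurable_\<Phi>[OF z x] by (simp add: case_prod_beta')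
  show "(\<lambda>p. \<Phi> z (fst p) (snd p) x) \<in> space (borel \<Otimes>\<^sub>M seeds) \<rightarrow> {..0}"
    using \<Phi>_nonpos[OF z x] by (auto simp: space_pair_measure)
qed

lemma measurable_gaps_seeds:
  "z \<in> I \<Longrightarrow> (\<lambda>\<omega>. \<lambda>x\<in>I. \<Phi> z t \<omega> x) \<in> seeds \<rightarrow>\<^sub>M nonpos_space I"
  using measurable_compose_Pair1[OF _ measurable_gaps, of t] by simp

lemma measurable_gap_kernel:
  assumes "z \<in> I"
  shows "gap_kernel z \<in> borel \<rightarrow>\<^sub>M prob_algebra (nonpos_space I)"
  unfolding gap_kernel_def
proof (rule measurable_distr_prob_space2)
  show "(\<lambda>_. seeds) \<in> borel \<rightarrow>\<^sub>M prob_algebra seeds"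
    by (rule measurable_const) (simp add: space_prob_algebra seeds.prob_space_axioms)
qed (rule measurable_gaps[OF assms])

lemma gap_kernel_mono:
  assumes z: "z \<in> I" and st: "s \<le> t"
  shows "stoch_le I (gap_kernel z s) (gap_kernel z t)"
  unfolding stoch_le_def
proof (intro allI impI)
  fix \<psi> :: "(nat list \<Rightarrow> real) \<Rightarrow> real"
  assume \<psi>: "\<psi> \<in> borel_measurable (nonpos_space I)" and bd: "bounded (\<psi> ` space (nonpos_space I))"
    and mono: "mono_on (space (nonpos_space I)) \<psi>"
  obtain K where K: "\<And>v. v \<in> space (nonpos_space I) \<Longrightarrow> \<bar>\<psi> v\<bar> \<le> K"
    using bd by (auto simp: bounded_iff)
  have sp: "(\<lambda>x\<in>I. \<Phi> z t \<omega> x) \<in> space (nonpos_space I)" if "\<omega> \<in> space seeds" for t \<omega>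
    by (rule measurable_space[OF measurable_gaps_seeds[OF z] that])
  have int: "integrable seeds (\<lambda>\<omega>. \<psi> (\<lambda>x\<in>I. \<Phi> z t \<omega> x))" for t
  proof (rule seeds.integrable_const_bound)
    show "AE \<omega> in seeds. norm (\<psi> (\<lambda>x\<in>I. \<Phi> z t \<omega> x)) \<le> K"
      using K sp by (intro AE_I2) auto
  qed (rule measurable_compose[OF measurable_gaps_seeds[OF z] \<psi>])
  have "(\<integral>v. \<psi> v \<partial>gap_kernel z t) = (\<integral>\<omega>. \<psi> (\<lambda>x\<in>I. \<Phi> z t \<omega> x) \<partial>seeds)" for t
    unfolding gap_kernel_def by (rule integral_distr[OF measurable_gaps_seeds[OF z] \<psi>])
  moreover have "(\<integral>\<omega>. \<psi> (\<lambda>x\<in>I. \<Phi> z s \<omega> x) \<partial>seeds) \<le> (\<integral>\<omega>. \<psi> (\<lambda>x\<in>I. \<Phi> z t \<omega> x) \<partial>seeds)"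
  proof (rule integral_mono[OF int int])
    fix \<omega> assume \<omega>: "\<omega> \<in> space seeds"
    show "\<psi> (\<lambda>x\<in>I. \<Phi> z s \<omega> x) \<le> \<psi> (\<lambda>x\<in>I. \<Phi> z t \<omega> x)"
      using \<Phi>_mono[OF z _ \<omega> st] by (intro mono_onD[OF mono] sp \<omega>) (auto simp: le_fun_def)
  qed
  ultimately show "(\<integral>v. \<psi> v \<partial>gap_kernel z s) \<le> (\<integral>v. \<psi> v \<partial>gap_kernel z t)" by simp
qed

lemma inf_vec_recon:
  assumes "z \<in> I" "\<omega> \<in> space seeds"
  shows "inf_vec I (recon z w \<omega>) = w"
  unfolding inf_vec_Min[OF finite_I I_nonempty]
proof (rule Min_eqI)
  show "w \<le> y" if "y \<in> recon z w \<omega> ` I" for y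
    using that recon_ge_iff[OF assms, of w w] by auto
  show "w \<in> recon z w \<omega> ` I"
    using assms \<Phi>_self[OF assms, of w] by (intro image_eqI[of _ _ z]) (auto simp: recon_def)
qed (use finite_I in simp)

lemma argmin_vec_recon:
  assumes "z \<in> I" "\<omega> \<in> space seeds"
  shows "argmin_vec I (recon z w \<omega>) = z"
  unfolding argmin_vec_def inf_vec_recon[OF assms]
proof (rule the_equality)
  show "z \<in> I \<and> recon z w \<omega> z = w" using assms \<Phi>_self[OF assms, of w] by (simp add: recon_def)
  show "x = z" if "x \<in> I \<and> recon z w \<omega> x = w" for x
    using that \<Phi>_neg[OF assms(1) _ _ assms(2), of x w] by (cases "x = z") (auto simp: recon_def)
qed

lemma gap_vec_recon:
  assumes "z \<in> I" "\<omega> \<in> space seeds"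
  shows "gap_vec I (recon z w \<omega>) = (\<lambda>x\<in>I. \<Phi> z w \<omega> x)"
  unfolding gap_vec_def inf_vec_recon[OF assms] by (rule restrict_ext) (simp add: recon_def)

text \<open>On the event that the minimum is attained at \<open>z\<close>, the minimum has law \<open>\<nu>\<close> and the gaps have conditional law
  \<^term>\<open>gap_kernel z\<close>.\<close>

lemma nn_integral_argmin:
  assumes z: "z \<in> I" and f: "(\<lambda>(t, y). f t y) \<in> borel_measurable (borel \<Otimes>\<^sub>M nonpos_space I)"
  shows "(\<integral>\<^sup>+v. f (inf_vec I v) (gap_vec I v) * indicator {v \<in> space (vectors I). argmin_vec I v = z} v \<partial>N)
    = (\<integral>\<^sup>+w. (\<integral>\<^sup>+y. f w y \<partial>gap_kernel z w) \<partial>\<nu>)"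
proof -
  have fm: "(\<lambda>v. f (inf_vec I v) (gap_vec I v)) \<in> borel_measurable (vectors I)"
    using measurable_compose[OF measurable_Pair[OF measurable_inf_vec[OF finite_I I_nonempty]
        measurable_gap_vec[OF finite_I I_nonempty]] f] by simp
  have "(\<integral>\<^sup>+v. f (inf_vec I v) (gap_vec I v) * indicator {v \<in> space (vectors I). argmin_vec I v = z} v \<partial>N)
      = (\<Sum>z'\<in>I. \<integral>\<^sup>+w. (\<integral>\<^sup>+\<omega>. f (inf_vec I (recon z' w \<omega>)) (gap_vec I (recon z' w \<omega>)) *
          indicator {v \<in> space (vectors I). argmin_vec I v = z} (recon z' w \<omega>) \<partial>seeds) \<partial>\<nu>)"
    by (rule nn_integral_recon)
       (intro borel_measurable_times_ennreal fm borel_measurable_indicator sets_argmin_vec finite_I I_nonempty)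
  also have "\<dots> = (\<Sum>z'\<in>I. if z' = z then \<integral>\<^sup>+w. (\<integral>\<^sup>+\<omega>. f w (\<lambda>x\<in>I. \<Phi> z w \<omega> x) \<partial>seeds) \<partial>\<nu> else 0)"
  proof (rule sum.cong[OF refl])
    fix z' assume z': "z' \<in> I"
    have "(\<integral>\<^sup>+w. (\<integral>\<^sup>+\<omega>. f (inf_vec I (recon z' w \<omega>)) (gap_vec I (recon z' w \<omega>)) *
          indicator {v \<in> space (vectors I). argmin_vec I v = z} (recon z' w \<omega>) \<partial>seeds) \<partial>\<nu>)
        = (\<integral>\<^sup>+w. (\<integral>\<^sup>+\<omega>. (if z' = z then f w (\<lambda>x\<in>I. \<Phi> z w \<omega> x) else 0) \<partial>seeds) \<partial>\<nu>)"
      by (intro nn_integral_cong)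
         (use z' recon_space in \<open>auto simp: inf_vec_recon gap_vec_recon argmin_vec_recon indicator_def\<close>)
    then show "(\<integral>\<^sup>+w. (\<integral>\<^sup>+\<omega>. f (inf_vec I (recon z' w \<omega>)) (gap_vec I (recon z' w \<omega>)) *
          indicator {v \<in> space (vectors I). argmin_vec I v = z} (recon z' w \<omega>) \<partial>seeds) \<partial>\<nu>)
        = (if z' = z then \<integral>\<^sup>+w. (\<integral>\<^sup>+\<omega>. f w (\<lambda>x\<in>I. \<Phi> z w \<omega> x) \<partial>seeds) \<partial>\<nu> else 0)"
      by simp
  qed
  also have "\<dots> = (\<integral>\<^sup>+w. (\<integral>\<^sup>+\<omega>. f w (\<lambda>x\<in>I. \<Phi> z w \<omega> x) \<partial>seeds) \<partial>\<nu>)"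
    using z finite_I by simp
  also have "\<dots> = (\<integral>\<^sup>+w. (\<integral>\<^sup>+y. f w y \<partial>gap_kernel z w) \<partial>\<nu>)"
    unfolding gap_kernel_def
    using measurable_compose_Pair1[OF _ f] measurable_gaps_seeds[OF z]
    by (intro nn_integral_cong) (simp add: nn_integral_distr)
  finally show ?thesis .
qed

end

text \<open>It suffices to compare the integrals over the events \<open>Y \<in> B\<close>, which form the \<open>\<sigma>\<close>-algebra of \<open>Y\<close>. The
  kernel is asked for on the whole real line, so nothing has to be said about where \<open>Y\<close> is nonnegative.\<close>

lemma regular_cond_probI:
  assumes P: "prob_space P" and X: "X \<in> P \<rightarrow>\<^sub>M S" and Y: "Y \<in> borel_measurable P"
    and \<kappa>: "\<kappa> \<in> borel \<rightarrow>\<^sub>M prob_algebra S"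
    and eq: "\<And>B A. B \<in> sets borel \<Longrightarrow> A \<in> sets S \<Longrightarrow>
      (\<integral>\<^sup>+\<omega>. indicator B (Y \<omega>) * indicator A (X \<omega>) \<partial>P)
        = (\<integral>\<^sup>+\<omega>. indicator B (Y \<omega>) * emeasure (\<kappa> (Y \<omega>)) A \<partial>P)"
  shows "regular_cond_prob P S X Y \<kappa>"
  unfolding regular_cond_prob_def
proof (intro conjI ballI)
  interpret P: prob_space P by (rule P)
  show "\<kappa> \<in> restrict_space borel {0..} \<rightarrow>\<^sub>M prob_algebra S"
    by (rule measurable_restrict_space1[OF \<kappa>])
  fix A assume A: "A \<in> sets S"
  let ?F = "vimage_algebra (space P) Y borel"
  have sub: "subalgebra P ?F"
    unfolding subalgebra_def using Y by (auto simp: sets_vimage_algebra2 measurable_sets)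
  interpret F: finite_measure_subalgebra P ?F
    by (unfold_locales) (rule sub)
  have \<kappa>p: "prob_space (\<kappa> t)" for t
    using measurable_space[OF \<kappa>, of t] by (simp add: space_prob_algebra)
  have \<kappa>m: "(\<lambda>t. measure (\<kappa> t) A) \<in> borel_measurable borel"
    using measurable_compose[OF measurable_prob_algebraD[OF \<kappa>] measurable_measure_subprob_algebra[OF A]] .
  have Xm: "(\<lambda>\<omega>. indicator A (X \<omega>) :: real) \<in> borel_measurable P"
    by (rule measurable_compose[OF X borel_measurable_indicator[OF A]])
  have \<kappa>Y: "(\<lambda>\<omega>. measure (\<kappa> (Y \<omega>)) A) \<in> borel_measurable P"
    by (rule measurable_compose[OF Y \<kappa>m])
  show "AE \<omega> in P. real_cond_exp P ?F (\<lambda>\<omega>. indicator A (X \<omega>)) \<omega> = measure (\<kappa> (Y \<omega>)) A"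
  proof (rule F.real_cond_exp_charact)
    show "integrable P (\<lambda>\<omega>. indicator A (X \<omega>) :: real)"
      by (rule P.integrable_const_bound[where B=1]) (use Xm in auto)
    show "integrable P (\<lambda>\<omega>. measure (\<kappa> (Y \<omega>)) A)"
      by (rule P.integrable_const_bound[where B=1]) (use \<kappa>Y prob_space.prob_le_1[OF \<kappa>p] in auto)
    show "(\<lambda>\<omega>. measure (\<kappa> (Y \<omega>)) A) \<in> borel_measurable ?F"
      using measurable_vimage_algebra1[of Y "space P" borel] by (intro measurable_compose[OF _ \<kappa>m]) auto
    fix C assume "C \<in> sets ?F"
    then obtain B where B: "B \<in> sets borel" "C = Y -` B \<inter> space P"
      by (auto simp: sets_vimage_algebra2)
    have Cm: "C \<in> sets P" unfolding B(2) by (rule measurable_sets[OF Y B(1)])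
    have "(\<integral>\<omega>\<in>C. indicator A (X \<omega>) \<partial>P) = enn2real (\<integral>\<^sup>+\<omega>. ennreal (indicator C \<omega> * indicator A (X \<omega>)) \<partial>P)"
      unfolding set_lebesgue_integral_def real_scaleR_def
      by (rule integral_eq_nn_integral) (use Xm Cm in auto)
    also have "(\<integral>\<^sup>+\<omega>. ennreal (indicator C \<omega> * indicator A (X \<omega>)) \<partial>P)
        = (\<integral>\<^sup>+\<omega>. indicator B (Y \<omega>) * indicator A (X \<omega>) \<partial>P)"
      by (rule nn_integral_cong) (auto simp: B(2) indicator_def)
    also have "\<dots> = (\<integral>\<^sup>+\<omega>. indicator B (Y \<omega>) * emeasure (\<kappa> (Y \<omega>)) A \<partial>P)"
      by (rule eq[OF B(1) A])
    also have "\<dots> = (\<integral>\<^sup>+\<omega>. ennreal (indicator C \<omega> * measure (\<kappa> (Y \<omega>)) A) \<partial>P)"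
    proof (rule nn_integral_cong)
      fix \<omega> assume "\<omega> \<in> space P"
      moreover have "emeasure (\<kappa> (Y \<omega>)) A = ennreal (measure (\<kappa> (Y \<omega>)) A)"
        using finite_measure.emeasure_eq_measure prob_space.finite_measure[OF \<kappa>p] by blast
      ultimately show "indicator B (Y \<omega>) * emeasure (\<kappa> (Y \<omega>)) A = ennreal (indicator C \<omega> * measure (\<kappa> (Y \<omega>)) A)"
        by (auto simp: B(2) indicator_def)
    qed
    also have "enn2real \<dots> = (\<integral>\<omega>\<in>C. measure (\<kappa> (Y \<omega>)) A \<partial>P)"
      unfolding set_lebesgue_integral_def real_scaleR_def
      by (rule integral_eq_nn_integral[symmetric]) (use \<kappa>Y Cm in auto)
    finally show "(\<integral>\<omega>\<in>C. indicator A (X \<omega>) \<partial>P) = (\<integral>\<omega>\<in>C. measure (\<kappa> (Y \<omega>)) A \<partial>P)" .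
  qed
qed

lemma tree_prefix: "x \<in> tree d \<Longrightarrow> prefix y x \<Longrightarrow> y \<in> tree d"
  by (auto simp: tree_def prefix_def)

lemma path_sum_cong:
  "(\<And>y. prefix y x \<Longrightarrow> u y = v y) \<Longrightarrow> path_sum c \<alpha> u x = path_sum c \<alpha> v x"
  unfolding path_sum_eq by (intro sum.cong) auto

text \<open>The vector of the passage times to level \<open>n\<close>, the weight of the root excluded.\<close>

definition T0_vec :: "nat \<Rightarrow> real \<Rightarrow> (nat list \<Rightarrow> 'a \<Rightarrow> real) \<Rightarrow> nat \<Rightarrow> 'a \<Rightarrow> nat list \<Rightarrow> real" where
  "T0_vec d \<alpha> U n \<omega> = (\<lambda>x\<in>level d n. T0 \<alpha> U x \<omega>)"

lemma inf_vec_T0_vec: "inf_vec (level d n) (T0_vec d \<alpha> U n \<omega>) = T_not d \<alpha> U n \<omega>"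
  by (simp add: inf_vec_def T_not_def T0_vec_def)

lemma gap_vec_T0_vec: "gap_vec (level d n) (T0_vec d \<alpha> U n \<omega>) = gap d \<alpha> U n \<omega>"
  unfolding gap_vec_def gap_def inf_vec_T0_vec by (rule restrict_ext) (simp add: T0_vec_def)

text \<open>The minimisers of \<^const>\<open>T\<close> and \<^const>\<open>T0\<close> agree, since the two differ by the weight of the root only.\<close>

lemma argmin_vec_T0_vec:
  assumes "finite (level d n)" "level d n \<noteq> {}"
  shows "argmin_vec (level d n) (T0_vec d \<alpha> U n \<omega>) = First d \<alpha> U n \<omega>"
proof -
  have "(INF x\<in>level d n. T \<alpha> U x \<omega>) = Min ((\<lambda>x. T0 \<alpha> U x \<omega> + T \<alpha> U [] \<omega>) ` level d n)"
    using assms by (simp add: cInf_eq_Min T0_def)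
  also have "\<dots> = Min ((\<lambda>x. T0 \<alpha> U x \<omega>) ` level d n) + T \<alpha> U [] \<omega>"
    using assms by (rule Min_add_commute)
  also have "Min ((\<lambda>x. T0 \<alpha> U x \<omega>) ` level d n) = T_not d \<alpha> U n \<omega>"
    using assms by (simp add: T_not_def cInf_eq_Min)
  finally have "T \<alpha> U x \<omega> = (INF x\<in>level d n. T \<alpha> U x \<omega>) \<longleftrightarrow> T0 \<alpha> U x \<omega> = T_not d \<alpha> U n \<omega>" for x
    by (auto simp: T0_def)
  then show ?thesis
    unfolding argmin_vec_def First_def inf_vec_T0_vec
    by (intro arg_cong[where f=The]) (auto simp: T0_vec_def fun_eq_iff)
qed

text \<open>The weights with indices in \<^term>\<open>tree d\<close> are replaced by \<open>exp_field\<close>; the additional weights play no role,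
  because paths to vertices of the tree stay inside the tree.\<close>

lemma T0_vec_law:
  fixes M :: "'a measure"
  assumes d: "0 < d" and \<alpha>: "0 < \<alpha>" and M: "prob_space M"
    and indep: "prob_space.indep_vars M (\<lambda>_. borel) U (tree d)"
    and expo: "\<And>x. x \<in> tree d \<Longrightarrow> distributed M lborel (U x) (exponential_density 1)"
  shows "T0_vec d \<alpha> U (Suc h) \<in> M \<rightarrow>\<^sub>M vectors (level d (Suc h))"
    and "distr M (vectors (level d (Suc h))) (T0_vec d \<alpha> U (Suc h))
      = join_law d (level d h) (tree_law \<alpha> d h \<alpha>)"
proof -
  interpret M: prob_space M by (rule M)
  let ?L = "level d h" and ?L' = "level d (Suc h)"
  let ?E = "exp_dist 1"
  define W where "W \<omega> = (\<lambda>x\<in>tree d. U x \<omega>)" for \<omega>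
  define V where "V u = (\<lambda>x\<in>?L'. path_sum \<alpha> \<alpha> (subtree (hd x) u) (tl x))" for u
  have Um: "U x \<in> borel_measurable M" if "x \<in> tree d" for x
    using distributed_measurable[OF expo[OF that]] by simp
  have L'E: "\<exists>i y. x = i # y \<and> i < d \<and> y \<in> ?L" if "x \<in> ?L'" for x
    using that by (auto simp: level_Suc join_index_def)
  have tree_L': "hd x # y \<in> tree d" if "x \<in> ?L'" "prefix y (tl x)" for x y
  proof -
    have "x \<in> tree d" "x \<noteq> []" using that(1) by (auto simp: level_def)
    moreover from this have "prefix (hd x # y) x" using that(2) by (cases x) auto
    ultimately show ?thesis using tree_prefix by blast
  qed
  have VW: "T0_vec d \<alpha> U (Suc h) \<omega> = V (W \<omega>)" for \<omega>
    unfolding T0_vec_def V_def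
  proof (rule restrict_ext)
    fix x assume x: "x \<in> ?L'"
    then have x_eq: "x = hd x # tl x" using L'E[OF x] by auto
    have "T0 \<alpha> U x \<omega> = path_sum \<alpha> \<alpha> (subtree (hd x) (\<lambda>y. U y \<omega>)) (tl x)"
      by (subst x_eq) (rule T0_Cons)
    also have "\<dots> = path_sum \<alpha> \<alpha> (subtree (hd x) (W \<omega>)) (tl x)"
      by (rule path_sum_cong) (use tree_L'[OF x] in \<open>auto simp: subtree_def W_def\<close>)
    finally show "T0 \<alpha> U x \<omega> = path_sum \<alpha> \<alpha> (subtree (hd x) (W \<omega>)) (tl x)" .
  qed
  have Vm: "V \<in> PiM (tree d) (\<lambda>_. borel) \<rightarrow>\<^sub>M vectors ?L'"
    unfolding V_def
  proof (intro measurable_restrict measurable_path_sum)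
    fix x y assume "x \<in> ?L'" "prefix y (tl x)"
    from tree_L'[OF this]
    show "(\<lambda>u. subtree (hd x) u y) \<in> borel_measurable (PiM (tree d) (\<lambda>_. borel))"
      unfolding subtree_def by (rule measurable_component_singleton)
  qed
  have Wm: "W \<in> M \<rightarrow>\<^sub>M PiM (tree d) (\<lambda>_. borel)"
    unfolding W_def by (intro measurable_restrict Um)
  show meas: "T0_vec d \<alpha> U (Suc h) \<in> M \<rightarrow>\<^sub>M vectors ?L'"
    using measurable_compose[OF Wm Vm] by (simp add: VW[abs_def])
  have E: "distr M borel (U x) = ?E" if "x \<in> tree d" for x
    using distributed_distr_eq_density[OF expo[OF that]] distr_cong[of M M borel lborel "U x" "U x"]
    by (simp add: exp_dist_def)
  have "[] \<in> tree d" by (simp add: tree_def)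
  then have "distr M (PiM (tree d) (\<lambda>_. borel)) W = PiM (tree d) (\<lambda>x. distr M borel (U x))"
    unfolding W_def using M.indep_vars_iff_distr_eq_PiM'[where I="tree d" and M'="\<lambda>_. borel" and X=U] Um indep by auto
  also have "\<dots> = PiM (tree d) (\<lambda>_. ?E)"
    by (rule PiM_cong) (simp_all add: E)
  also have "\<dots> = distr (tree_prod ?E) (PiM (tree d) (\<lambda>_. ?E)) (\<lambda>u. \<lambda>x\<in>tree d. u x)"
    using distr_PiM_reindex[of UNIV "\<lambda>_. ?E" "\<lambda>x. x" "tree d"] prob_space_exp_dist[of 1] by simp
  finally have law: "distr M (PiM (tree d) (\<lambda>_. borel)) W
      = distr (tree_prod ?E) (PiM (tree d) (\<lambda>_. ?E)) (\<lambda>u. \<lambda>x\<in>tree d. u x)" .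
  have sets_E: "sets (PiM (tree d) (\<lambda>_. ?E)) = sets (PiM (tree d) (\<lambda>_. borel))"
    by (rule sets_PiM_cong) auto
  show "distr M (vectors ?L') (T0_vec d \<alpha> U (Suc h)) = join_law d ?L (tree_law \<alpha> d h \<alpha>)"
  proof (rule measure_eqI_nn_integral)
    fix g :: "_ \<Rightarrow> ennreal"
    assume "g \<in> borel_measurable (distr M (vectors ?L') (T0_vec d \<alpha> U (Suc h)))"
    then have g: "g \<in> borel_measurable (vectors ?L')" by simp
    have gV: "(\<lambda>u. g (V u)) \<in> borel_measurable (PiM (tree d) (\<lambda>_. borel))"
      by (rule measurable_compose[OF Vm g])
    have "(\<integral>\<^sup>+v. g v \<partial>distr M (vectors ?L') (T0_vec d \<alpha> U (Suc h))) = (\<integral>\<^sup>+\<omega>. g (V (W \<omega>)) \<partial>M)"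
      by (subst nn_integral_distr[OF meas]) (use g in \<open>simp_all add: VW\<close>)
    also have "\<dots> = (\<integral>\<^sup>+u. g (V u) \<partial>distr M (PiM (tree d) (\<lambda>_. borel)) W)"
      by (rule nn_integral_distr[OF Wm, symmetric]) (use gV in simp)
    also have "\<dots> = (\<integral>\<^sup>+u. g (V (\<lambda>x\<in>tree d. u x)) \<partial>tree_prod ?E)"
      unfolding law
    proof (rule nn_integral_distr)
      show "(\<lambda>u. \<lambda>x\<in>tree d. u x) \<in> tree_prod ?E \<rightarrow>\<^sub>M PiM (tree d) (\<lambda>_. ?E)"
        by (intro measurable_restrict measurable_component_singleton) simp
      show "(\<lambda>u. g (V u)) \<in> borel_measurable (distr (tree_prod ?E) (PiM (tree d) (\<lambda>_. ?E)) (\<lambda>u. \<lambda>x\<in>tree d. u x))"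
        unfolding measurable_distr_eq1 measurable_cong_sets[OF sets_E refl] by (rule gV)
    qed
    also have "\<dots> = (\<integral>\<^sup>+u. g (join_vec d ?L (\<lambda>i\<in>{..<d}. path_vec \<alpha> \<alpha> ?L (subtree i u))) \<partial>tree_prod ?E)"
    proof (rule nn_integral_cong, rule arg_cong[where f=g])
      fix u
      show "V (\<lambda>x\<in>tree d. u x) = join_vec d ?L (\<lambda>i\<in>{..<d}. path_vec \<alpha> \<alpha> ?L (subtree i u))"
        unfolding V_def join_vec_def level_Suc[symmetric]
      proof (rule restrict_ext)
        fix x assume x: "x \<in> ?L'"
        then obtain i y where y: "x = i # y" "i < d" "y \<in> ?L" using L'E by blast
        have "path_sum \<alpha> \<alpha> (subtree (hd x) (\<lambda>x\<in>tree d. u x)) (tl x) = path_sum \<alpha> \<alpha> (subtree (hd x) u) (tl x)"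
          by (rule path_sum_cong) (use tree_L'[OF x] in \<open>auto simp: subtree_def\<close>)
        then show "path_sum \<alpha> \<alpha> (subtree (hd x) (\<lambda>x\<in>tree d. u x)) (tl x)
            = (\<lambda>i\<in>{..<d}. path_vec \<alpha> \<alpha> ?L (subtree i u)) (hd x) (tl x)"
          using y by (simp add: path_vec_def)
      qed
    qed
    also have "\<dots> = (\<integral>\<^sup>+v. g v \<partial>join_law d ?L (tree_law \<alpha> d h \<alpha>))"
      by (rule subtrees_path_vec[OF path_vec_law[OF d \<alpha> \<alpha>]]) (use g in \<open>simp add: level_Suc\<close>)
    finally show "(\<integral>\<^sup>+v. g v \<partial>distr M (vectors ?L') (T0_vec d \<alpha> U (Suc h)))
        = (\<integral>\<^sup>+v. g v \<partial>join_law d ?L (tree_law \<alpha> d h \<alpha>))" .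
  qed (simp add: join_law_def level_Suc)
qed

theorem lemma3p3:
  fixes M :: "'a measure" and d :: nat and \<alpha> :: real
    and U :: "nat list \<Rightarrow> 'a \<Rightarrow> real" and z :: "nat list"
  assumes "d \<ge> 2" and "0 < \<alpha>" and "\<alpha> < 1"
    and "prob_space M"
    and "prob_space.indep_vars M (\<lambda>_. borel) U (tree d)"
    and "\<And>x. x \<in> tree d \<Longrightarrow> distributed M lborel (U x) (exponential_density 1)"
    and "z \<in> tree d" and "z \<noteq> []"
  shows "\<exists>\<mu> :: real \<Rightarrow> (nat list \<Rightarrow> real) measure.
    regular_cond_prob (P_cond M d \<alpha> U z) (nonpos_space (level d (length z)))
      (gap d \<alpha> U (length z)) (T_not d \<alpha> U (length z)) \<mu> \<and>
    (\<forall>s t. 0 \<le> s \<longrightarrow> s \<le> t \<longrightarrow> stoch_le (level d (length z)) (\<mu> s) (\<mu> t))"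
proof -
  interpret M: prob_space M by fact
  have d: "0 < d" using assms(1) by simp
  obtain h where h: "length z = Suc h" using assms(8) by (cases z) auto
  define n where "n = length z"
  let ?I = "level d n"
  let ?X = "T0_vec d \<alpha> U n"
  define N where "N = distr M (vectors ?I) ?X"
  have Xm: "?X \<in> M \<rightarrow>\<^sub>M vectors ?I"
    and N_eq: "N = join_law d (level d h) (tree_law \<alpha> d h \<alpha>)"
    using T0_vec_law[OF d assms(2,4,5,6), where h=h] by (simp_all add: N_def n_def h)
  obtain \<nu>0 \<Phi>0 where "log_concave_min_decomposition \<nu>0 (level d h) (tree_law \<alpha> d h \<alpha>) \<Phi>0"
    using tree_law_decomposition[OF d assms(2,2)] by blast
  from log_concave_min_decomposition.join_decomposition[OF this d]
  obtain \<nu> \<Phi> where "log_concave_min_decomposition \<nu> ?I N \<Phi>"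
    unfolding N_eq n_def h level_Suc by blast
  then interpret D: log_concave_min_decomposition \<nu> ?I N \<Phi> .
  have zI: "z \<in> ?I" using assms(7) by (simp add: level_def n_def)
  let ?F = "{\<omega> \<in> space M. First d \<alpha> U n \<omega> = z}"
  let ?A = "{v \<in> space (vectors ?I). argmin_vec ?I v = z}"
  have Xsp: "?X \<omega> \<in> space (vectors ?I)" if "\<omega> \<in> space M" for \<omega>
    by (rule measurable_space[OF Xm that])
  have F_eq: "?F = ?X -` ?A \<inter> space M"
    using Xsp by (auto simp: argmin_vec_T0_vec[OF D.finite_I D.I_nonempty])
  have Am: "?A \<in> sets (vectors ?I)" by (rule sets_argmin_vec[OF D.finite_I D.I_nonempty])
  have Fm: "?F \<in> sets M" unfolding F_eq by (rule measurable_sets[OF Xm Am])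
  have T_not_m: "T_not d \<alpha> U n \<in> borel_measurable M"
    using measurable_compose[OF Xm measurable_inf_vec[OF D.finite_I D.I_nonempty]]
    by (simp add: inf_vec_T0_vec[abs_def])
  have gap_m: "gap d \<alpha> U n \<in> M \<rightarrow>\<^sub>M nonpos_space ?I"
    using measurable_compose[OF Xm measurable_gap_vec[OF D.finite_I D.I_nonempty]]
    by (simp add: gap_vec_T0_vec[abs_def])
  \<comment> \<open>On the conditioning event the minimum and the gaps are governed by \<open>\<nu>\<close> and the kernel.\<close>
  have key: "(\<integral>\<^sup>+\<omega>. f (T_not d \<alpha> U n \<omega>) (gap d \<alpha> U n \<omega>) * indicator ?F \<omega> \<partial>M)
      = (\<integral>\<^sup>+w. (\<integral>\<^sup>+y. f w y \<partial>D.gap_kernel z w) \<partial>\<nu>)"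
    if f: "(\<lambda>(t, y). f t y) \<in> borel_measurable (borel \<Otimes>\<^sub>M nonpos_space ?I)" for f
  proof -
    have fm: "(\<lambda>v. f (inf_vec ?I v) (gap_vec ?I v)) \<in> borel_measurable (vectors ?I)"
      using measurable_compose[OF measurable_Pair[OF measurable_inf_vec[OF D.finite_I D.I_nonempty]
          measurable_gap_vec[OF D.finite_I D.I_nonempty]] f] by simp
    have "(\<integral>\<^sup>+\<omega>. f (T_not d \<alpha> U n \<omega>) (gap d \<alpha> U n \<omega>) * indicator ?F \<omega> \<partial>M)
        = (\<integral>\<^sup>+\<omega>. f (inf_vec ?I (?X \<omega>)) (gap_vec ?I (?X \<omega>)) * indicator ?A (?X \<omega>) \<partial>M)"
      by (rule nn_integral_cong)
         (use Xsp in \<open>simp add: inf_vec_T0_vec gap_vec_T0_vec indicator_def argmin_vec_T0_vec[OF D.finite_I D.I_nonempty]\<close>)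
    also have "\<dots> = (\<integral>\<^sup>+v. f (inf_vec ?I v) (gap_vec ?I v) * indicator ?A v \<partial>N)"
      unfolding N_def
    proof (rule nn_integral_distr[OF Xm, symmetric])
      show "(\<lambda>v. f (inf_vec ?I v) (gap_vec ?I v) * indicator ?A v) \<in> borel_measurable (distr M (vectors ?I) ?X)"
        unfolding measurable_distr_eq1 by (intro borel_measurable_times_ennreal fm borel_measurable_indicator Am)
    qed
    also have "\<dots> = (\<integral>\<^sup>+w. (\<integral>\<^sup>+y. f w y \<partial>D.gap_kernel z w) \<partial>\<nu>)"
      by (rule D.nn_integral_argmin[OF zI f])
    finally show ?thesis .
  qed
  have kp: "prob_space (D.gap_kernel z t)" "sets (D.gap_kernel z t) = sets (nonpos_space ?I)" for t
    using measurable_space[OF D.measurable_gap_kernel[OF zI], of t] by (simp_all add: space_prob_algebra)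
  have "emeasure M ?F = (\<integral>\<^sup>+\<omega>. 1 * indicator ?F \<omega> \<partial>M)" using Fm by simp
  also have "\<dots> = emeasure \<nu> UNIV"
    by (subst key[of "\<lambda>_ _. 1"]) (simp_all add: prob_space.emeasure_space_1[OF kp(1)])
  finally have F_pos: "emeasure M ?F \<noteq> 0"
    using D.emeasure_total by (cases "emeasure \<nu> UNIV = 0") auto
  let ?P = "P_cond M d \<alpha> U z"
  have P: "?P = uniform_measure M ?F" by (simp add: P_cond_def n_def)
  have P_meas: "measurable ?P S = measurable M S" for S :: "'b measure"
    by (rule measurable_cong_sets) (simp_all add: P)
  have P_int: "(\<integral>\<^sup>+\<omega>. f (T_not d \<alpha> U n \<omega>) (gap d \<alpha> U n \<omega>) \<partial>?P)
      = (\<integral>\<^sup>+w. (\<integral>\<^sup>+y. f w y \<partial>D.gap_kernel z w) \<partial>\<nu>) / emeasure M ?F"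
    if f: "(\<lambda>(t, y). f t y) \<in> borel_measurable (borel \<Otimes>\<^sub>M nonpos_space ?I)" for f
  proof -
    have "(\<lambda>\<omega>. f (T_not d \<alpha> U n \<omega>) (gap d \<alpha> U n \<omega>)) \<in> borel_measurable M"
      using measurable_compose[OF measurable_Pair[OF T_not_m gap_m] f] by simp
    then show ?thesis
      unfolding P by (subst nn_integral_uniform_measure[OF _ Fm]) (simp_all add: key[OF f])
  qed
  have "regular_cond_prob ?P (nonpos_space ?I) (gap d \<alpha> U n) (T_not d \<alpha> U n) (D.gap_kernel z)"
  proof (rule regular_cond_probI)
    show "prob_space ?P"
      unfolding P using F_pos M.emeasure_finite by (intro prob_space_uniform_measure) auto
    show "gap d \<alpha> U n \<in> ?P \<rightarrow>\<^sub>M nonpos_space ?I" "T_not d \<alpha> U n \<in> borel_measurable ?P"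
      unfolding P_meas by (fact gap_m T_not_m)+
    show kernel: "D.gap_kernel z \<in> borel \<rightarrow>\<^sub>M prob_algebra (nonpos_space ?I)"
      by (rule D.measurable_gap_kernel[OF zI])
    fix B :: "real set" and A assume B: "B \<in> sets borel" and A: "A \<in> sets (nonpos_space ?I)"
    have kA: "(\<lambda>t. emeasure (D.gap_kernel z t) A) \<in> borel_measurable borel"
      using measurable_compose[OF measurable_prob_algebraD[OF kernel] measurable_emeasure_subprob_algebra[OF A]] .
    have "(\<integral>\<^sup>+\<omega>. indicator B (T_not d \<alpha> U n \<omega>) * indicator A (gap d \<alpha> U n \<omega>) \<partial>?P)
        = (\<integral>\<^sup>+w. (\<integral>\<^sup>+y. indicator B w * indicator A y \<partial>D.gap_kernel z w) \<partial>\<nu>) / emeasure M ?F"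
      by (rule P_int) (use A B in \<open>simp add: case_prod_beta'\<close>)
    also have "\<dots> = (\<integral>\<^sup>+w. (\<integral>\<^sup>+y. indicator B w * emeasure (D.gap_kernel z w) A \<partial>D.gap_kernel z w) \<partial>\<nu>) / emeasure M ?F"
    proof -
      have "(\<integral>\<^sup>+y. indicator B w * indicator A y \<partial>D.gap_kernel z w)
          = indicator B w * emeasure (D.gap_kernel z w) A" for w
        by (rule nn_integral_cmult_indicator) (simp add: kp A)
      then show ?thesis by (simp add: prob_space.emeasure_space_1[OF kp(1)])
    qed
    also have "\<dots> = (\<integral>\<^sup>+\<omega>. indicator B (T_not d \<alpha> U n \<omega>) * emeasure (D.gap_kernel z (T_not d \<alpha> U n \<omega>)) A \<partial>?P)"
    proof (rule P_int[symmetric])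
      have "(\<lambda>t. indicator B t * emeasure (D.gap_kernel z t) A) \<in> borel_measurable borel"
        by (intro borel_measurable_times_ennreal kA borel_measurable_indicator B)
      from measurable_compose[OF measurable_fst this]
      show "(\<lambda>(t, y). indicator B t * emeasure (D.gap_kernel z t) A) \<in> borel_measurable (borel \<Otimes>\<^sub>M nonpos_space ?I)"
        by (simp add: case_prod_beta')
    qed
    finally show "(\<integral>\<^sup>+\<omega>. indicator B (T_not d \<alpha> U n \<omega>) * indicator A (gap d \<alpha> U n \<omega>) \<partial>?P)
      = (\<integral>\<^sup>+\<omega>. indicator B (T_not d \<alpha> U n \<omega>) * emeasure (D.gap_kernel z (T_not d \<alpha> U n \<omega>)) A \<partial>?P)" .
  qed
  moreover have "stoch_le ?I (D.gap_kernel z s) (D.gap_kernel z t)" if "s \<le> t" for s t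
    by (rule D.gap_kernel_mono[OF zI that])
  ultimately show ?thesis unfolding n_def by blast
qed

end
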